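(* Let $n\geq 1$ be an integer. (i) Let $\vec a=(a_0,a_1,\dots,a_n)^t\in\mathbb{C}^{1+n}$ and $\vec b=(b_1,\dots,b_n)^t\in\mathbb{C}^n$ with $a_0^2+2\sum_{i=1}^n a_ib_i\neq 0$. Then for every $c\in\mathbb{C}$ the representation $\pi_{c,\vec a,\vec b}$ of $o(2n+3,\mathbb{C})$ on $\mathscr{B}_{\vec a,\vec b}$ is irreducible. (ii) Let $n_1,n_2\in\{1,\dots,n\}$ with $n_1\leq n_2$, and let $c\in\mathbb{C}\setminus(\mathbb{Z}/2)$. Then the representation $\pi_c^{n_1,n_2}$ of $o(2n+3,\mathbb{C})$ on $\mathscr{B}=\mathbb{C}[x_0,x_1,\dots,x_n,y_1,\dots,y_n]$ is irreducible, and its underlying module $\mathscr{B}$ is an infinite-dimensional irreducible weight $o(2n+3,\mathbb{C})$-module with finite-dimensional weight subspaces.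
   Context: Fix an integer $n\ge 1$. For integers $p\le q$ write $\overline{p,q}=\{p,p+1,\dots,q\}$ (empty index ranges, such as $\overline{n+1,n}$, are the empty set). $\mathbb{Z}/2=\{m/2: m\in\mathbb{Z}\}$. **The Lie algebra.** Let $E_{r,s}$ ($r,s\in\overline{0,2n+2}$) be the $(2n+3)\times(2n+3)$ matrix, with rows and columns indexed by $0,1,\dots,2n+2$, having $1$ in the $(r,s)$-entry and $0$ elsewhere. For $i,j\in\overline{1,n+1}$ put $$A_{i,j}=E_{i,j}-E_{n+1+j,n+1+i},\quad B_{i,j}=E_{i,n+1+j}-E_{j,n+1+i},\quad C_{i,j}=E_{n+1+i,j}-E_{n+1+j,i},$$ $$K_i=E_{0,i}-E_{n+1+i,0},\qquad K_{n+1+i}=E_{0,n+1+i}-E_{i,0}.$$ Then $o(2n+2,\mathbb{C})=\sum_{i,j=1}^{n+1}(\mathbb{C}A_{i,j}+\mathbb{C}B_{i,j}+\mathbb{C}C_{i,j})$ and $o(2n+3,\mathbb{C})=o(2n+2,\mathbb{C})+\sum_{i=1}^{2n+2}\mathbb{C}K_i$, with the commutator bracket. **The representation $\pi_c$.** Set $$D=\sum_{r=0}^n x_r\partial_{x_r}+\sum_{r=1}^n y_r\partial_{y_r},\qquad \eta=\tfrac12 x_0^2+\sum_{i=1}^n x_iy_i .$$ For $c\in\mathbb{C}$, $\pi_c$ is the representation of $o(2n+3,\mathbb{C})$ by differential operators in $x_0,x_1,\dots,x_n,y_1,\dots,y_n$ determined, for $i,j\in\overline{1,n}$, by $$\pi_c(A_{i,j})=x_i\partial_{x_j}-y_j\partial_{y_i},\quad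 \pi_c(B_{i,j})=x_i\partial_{y_j}-x_j\partial_{y_i},\quad \pi_c(C_{i,j})=y_i\partial_{x_j}-y_j\partial_{x_i},$$ $$\pi_c(A_{n+1,i})=\partial_{x_i},\quad \pi_c(A_{n+1,n+1})=-D-c,\quad \pi_c(B_{i,n+1})=-\partial_{y_i},$$ $$\pi_c(A_{i,n+1})=\eta\partial_{y_i}-x_i(D+c),\quad \pi_c(C_{n+1,i})=y_i(D+c)-\eta\partial_{x_i},$$ $$\pi_c(K_i)=x_0\partial_{x_i}-y_i\partial_{x_0},\quad \pi_c(K_{n+1+i})=x_0\partial_{y_i}-x_i\partial_{x_0},$$ $$\pi_c(K_{n+1})=\eta\partial_{x_0}-x_0(D+c),\quad \pi_c(K_{2n+2})=-\partial_{x_0}.$$ **The representation $\pi_{c,\vec a,\vec b}$.** Let $\mathscr{B}=\mathbb{C}[x_0,x_1,\dots,x_n,y_1,\dots,y_n]$. For $\vec a=(a_0,\dots,a_n)^t\in\mathbb{C}^{1+n}$ and $\vec b=(b_1,\dots,b_n)^t\in\mathbb{C}^n$ put $\vec a\cdot\vec x=\sum_{i=0}^n a_ix_i$, $\vec b\cdot\vec y=\sum_{i=1}^n b_iy_i$ and $$\mathscr{B}_{\vec a,\vec b}=\{f e^{\vec a\cdot\vec x+\vec b\cdot\vec y}\mid f\in\mathscr{B}\}.$$ This space is invariant under the differential operators above; $\pi_{c,\vec a,\vec b}$ denotes the representation $\pi_c$ of $o(2n+3,\mathbb{C})$ on $\mathscr{B}_{\vec a,\vec b}$. **The representation $\pi_c^{n_1,n_2}$.**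 For $n_1,n_2\in\overline{1,n}$ with $n_1\le n_2$, $\pi_c^{n_1,n_2}$ is the representation of $o(2n+3,\mathbb{C})$ on $\mathscr{B}$ obtained from the operators of $\pi_c$ by the replacements $$\partial_{x_r}\mapsto -x_r,\quad x_r\mapsto\partial_{x_r}\quad (r\in\overline{1,n_1}),\qquad \partial_{y_s}\mapsto -y_s,\quad y_s\mapsto\partial_{y_s}\quad (s\in\overline{n_2+1,n}),$$ all other variables and partial derivatives (including $x_0,\partial_{x_0}$) being left unchanged; that is, one composes $\pi_c$ (valued in the Weyl algebra of polynomial differential operators in $x_0,\dots,x_n,y_1,\dots,y_n$) with the automorphism of the Weyl algebra given by these replacements. **Weight modules.** A module is a weight module if it is the direct sum of its weight subspaces, where weights are taken with respect to the diagonal Cartan subalgebra $\sum_{i=1}^{n+1}\mathbb{C}A_{i,i}$. *)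

theory Defs
  imports "HOL-Analysis.Analysis" "HOL-Library.Function_Algebras"
begin

section \<open>Complex vector spaces of functions\<close>

text \<open>
  All the vector spaces below (matrices, polynomials, functions) are spaces of complex-valued
  functions; addition is the pointwise one of \<^theory>\<open>HOL-Library.Function_Algebras\<close>.
  The multiplication of that theory is pointwise as well and is not used: products of
  matrices and of operators are \<open>mmul\<close> and \<open>\<circ>\<close>.
\<close>

definition fscale :: "complex \<Rightarrow> ('a \<Rightarrow> complex) \<Rightarrow> 'a \<Rightarrow> complex"
  where "fscale c f = (\<lambda>z. c * f z)"

interpretation cfun: vector_space "fscale :: complex \<Rightarrow> ('a \<Rightarrow> complex) \<Rightarrow> 'a \<Rightarrow> complex"
  by unfold_locales (auto simp: fscale_def fun_eq_iff algebra_simps)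

definition finite_dimensional :: "('a \<Rightarrow> complex) set \<Rightarrow> bool"
  where "finite_dimensional V \<longleftrightarrow> (\<exists>S. finite S \<and> S \<subseteq> V \<and> V = cfun.span S)"

text \<open>Internal direct sum of a family of subspaces; the index set may be infinite.\<close>

definition is_direct_sum :: "('a \<Rightarrow> complex) set \<Rightarrow> 'i set \<Rightarrow> ('i \<Rightarrow> ('a \<Rightarrow> complex) set) \<Rightarrow> bool"
  where "is_direct_sum V I U \<longleftrightarrow>
    (\<forall>i\<in>I. cfun.subspace (U i)) \<and>
    V = cfun.span (\<Union>i\<in>I. U i) \<and>
    (\<forall>J f. finite J \<and> J \<subseteq> I \<and> (\<forall>i\<in>J. f i \<in> U i) \<and> (\<Sum>i\<in>J. f i) = 0 \<longrightarrow> (\<forall>i\<in>J. f i = 0))"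


section \<open>Representations of Lie algebras\<close>

definition lie_representation ::
  "('m \<Rightarrow> complex) set \<Rightarrow> (('m \<Rightarrow> complex) \<Rightarrow> ('m \<Rightarrow> complex) \<Rightarrow> 'm \<Rightarrow> complex) \<Rightarrow>
   ('a \<Rightarrow> complex) set \<Rightarrow> (('m \<Rightarrow> complex) \<Rightarrow> ('a \<Rightarrow> complex) \<Rightarrow> 'a \<Rightarrow> complex) \<Rightarrow> bool"
  where "lie_representation L br V \<rho> \<longleftrightarrow>
    cfun.subspace V \<and>
    (\<forall>M\<in>L. \<forall>v\<in>V. \<rho> M v \<in> V) \<and>
    (\<forall>M\<in>L. \<forall>v\<in>V. \<forall>w\<in>V. \<rho> M (v + w) = \<rho> M v + \<rho> M w) \<and>
    (\<forall>M\<in>L. \<forall>v\<in>V. \<forall>k. \<rho> M (fscale k v) = fscale k (\<rho> M v)) \<and>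
    (\<forall>M\<in>L. \<forall>N\<in>L. \<forall>v\<in>V. \<rho> (M + N) v = \<rho> M v + \<rho> N v) \<and>
    (\<forall>M\<in>L. \<forall>v\<in>V. \<forall>k. \<rho> (fscale k M) v = fscale k (\<rho> M v)) \<and>
    (\<forall>M\<in>L. \<forall>N\<in>L. \<forall>v\<in>V. \<rho> (br M N) v = \<rho> M (\<rho> N v) - \<rho> N (\<rho> M v))"

definition irreducible_representation ::
  "('m \<Rightarrow> complex) set \<Rightarrow> (('m \<Rightarrow> complex) \<Rightarrow> ('m \<Rightarrow> complex) \<Rightarrow> 'm \<Rightarrow> complex) \<Rightarrow>
   ('a \<Rightarrow> complex) set \<Rightarrow> (('m \<Rightarrow> complex) \<Rightarrow> ('a \<Rightarrow> complex) \<Rightarrow> 'a \<Rightarrow> complex) \<Rightarrow> bool"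
  where "irreducible_representation L br V \<rho> \<longleftrightarrow>
    lie_representation L br V \<rho> \<and> V \<noteq> {0} \<and>
    (\<forall>W. cfun.subspace W \<and> W \<subseteq> V \<and> (\<forall>M\<in>L. \<forall>w\<in>W. \<rho> M w \<in> W) \<longrightarrow> W = {0} \<or> W = V)"

text \<open>
  Weights are elements of the dual of \<open>H\<close>. They are made \<^const>\<open>extensional\<close> because two
  functions agreeing on \<open>H\<close> are the same weight and must be counted once in the direct sum.
\<close>

definition dual_space :: "('m \<Rightarrow> complex) set \<Rightarrow> (('m \<Rightarrow> complex) \<Rightarrow> complex) set"
  where "dual_space H = {\<mu> \<in> extensional H.
    (\<forall>M\<in>H. \<forall>N\<in>H. \<mu> (M + N) = \<mu> M + \<mu> N) \<and> (\<forall>M\<in>H. \<forall>k. \<mu> (fscale k M) = k * \<mu> M)}"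

definition weight_space ::
  "('m \<Rightarrow> complex) set \<Rightarrow> ('a \<Rightarrow> complex) set \<Rightarrow>
   (('m \<Rightarrow> complex) \<Rightarrow> ('a \<Rightarrow> complex) \<Rightarrow> 'a \<Rightarrow> complex) \<Rightarrow>
   (('m \<Rightarrow> complex) \<Rightarrow> complex) \<Rightarrow> ('a \<Rightarrow> complex) set"
  where "weight_space H V \<rho> \<mu> = {v \<in> V. \<forall>M\<in>H. \<rho> M v = fscale (\<mu> M) v}"

definition weight_module ::
  "('m \<Rightarrow> complex) set \<Rightarrow> ('a \<Rightarrow> complex) set \<Rightarrow>
   (('m \<Rightarrow> complex) \<Rightarrow> ('a \<Rightarrow> complex) \<Rightarrow> 'a \<Rightarrow> complex) \<Rightarrow> bool"
  where "weight_module H V \<rho> \<longleftrightarrow> is_direct_sum V (dual_space H) (weight_space H V \<rho>)"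


section \<open>The orthogonal Lie algebra \<open>o(2n+3)\<close>\<close>

text \<open>Matrices are functions of an index pair; only the indices \<open>0, \<dots>, 2n+2\<close> occur.\<close>

type_synonym cmat = "nat \<times> nat \<Rightarrow> complex"

definition Emat :: "nat \<Rightarrow> nat \<Rightarrow> cmat"
  where "Emat r s = (\<lambda>p. if p = (r, s) then 1 else 0)"

definition mmul :: "nat \<Rightarrow> cmat \<Rightarrow> cmat \<Rightarrow> cmat"
  where "mmul n M N = (\<lambda>(r, s). \<Sum>k=0..2*n+2. M (r, k) * N (k, s))"

definition commutator :: "nat \<Rightarrow> cmat \<Rightarrow> cmat \<Rightarrow> cmat"
  where "commutator n M N = mmul n M N - mmul n N M"

definition Amat :: "nat \<Rightarrow> nat \<Rightarrow> nat \<Rightarrow> cmat"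
  where "Amat n i j = Emat i j - Emat (n+1+j) (n+1+i)"

definition Bmat :: "nat \<Rightarrow> nat \<Rightarrow> nat \<Rightarrow> cmat"
  where "Bmat n i j = Emat i (n+1+j) - Emat j (n+1+i)"

definition Cmat :: "nat \<Rightarrow> nat \<Rightarrow> nat \<Rightarrow> cmat"
  where "Cmat n i j = Emat (n+1+i) j - Emat (n+1+j) i"

definition Kmat :: "nat \<Rightarrow> nat \<Rightarrow> cmat"
  where "Kmat n k = (if k \<le> n+1 then Emat 0 k - Emat (n+1+k) 0 else Emat 0 k - Emat (k-(n+1)) 0)"

definition o_even :: "nat \<Rightarrow> cmat set"
  where "o_even n = cfun.span
    (\<Union>i\<in>{1..n+1}. \<Union>j\<in>{1..n+1}. {Amat n i j, Bmat n i j, Cmat n i j})"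

definition o_odd :: "nat \<Rightarrow> cmat set"
  where "o_odd n = cfun.span (o_even n \<union> Kmat n ` {1..2*n+2})"

definition cartan :: "nat \<Rightarrow> cmat set"
  where "cartan n = cfun.span ((\<lambda>i. Amat n i i) ` {1..n+1})"


section \<open>Polynomials and exponential polynomials\<close>

text \<open>
  Over \<open>\<complex>\<close> polynomials are identified with polynomial functions, so that polynomials and their
  products with exponentials are functions of the same kind and the differential operators act
  on both by honest partial derivatives.
\<close>

datatype coord = X nat | Y nat

type_synonym point = "coord \<Rightarrow> complex"
type_synonym cfunction = "point \<Rightarrow> complex"
type_synonym coperator = "cfunction \<Rightarrow> cfunction"

definition coords :: "nat \<Rightarrow> coord set"
  where "coords n = X ` {0..n} \<union> Y ` {1..n}"

definition monomial :: "nat \<Rightarrow> (coord \<Rightarrow> nat) \<Rightarrow> cfunction"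
  where "monomial n m = (\<lambda>z. \<Prod>v\<in>coords n. z v ^ m v)"

definition polys :: "nat \<Rightarrow> cfunction set"
  where "polys n = cfun.span (range (monomial n))"

definition exp_polys :: "nat \<Rightarrow> (nat \<Rightarrow> complex) \<Rightarrow> (nat \<Rightarrow> complex) \<Rightarrow> cfunction set"
  where "exp_polys n a b =
    {\<lambda>z. f z * exp ((\<Sum>i=0..n. a i * z (X i)) + (\<Sum>i=1..n. b i * z (Y i))) | f. f \<in> polys n}"

definition mult_op :: "coord \<Rightarrow> coperator"
  where "mult_op v F = (\<lambda>z. z v * F z)"

definition partial_op :: "coord \<Rightarrow> coperator"
  where "partial_op v F = (\<lambda>z. deriv (\<lambda>t. F (z(v := t))) (z v))"

definition oscale :: "complex \<Rightarrow> coperator \<Rightarrow> coperator"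
  where "oscale c T = (\<lambda>F. fscale c (T F))"


section \<open>The differential operators\<close>

text \<open>
  The operators are written as expressions in families \<open>q\<close> and \<open>p\<close> standing for the generators
  \<open>x\<^sub>v\<close> and \<open>\<partial>\<^sub>v\<close> of the Weyl algebra. Taking \<open>q = mult_op\<close> and \<open>p = partial_op\<close> gives \<open>\<pi>\<^sub>c\<close>;
  composing with an automorphism of the Weyl algebra amounts to taking for \<open>q\<close>, \<open>p\<close> the images of
  the generators. The parentheses are needed: \<open>\<circ>\<close> binds more weakly than \<open>+\<close> and \<open>-\<close>.
\<close>

context
  fixes n :: nat and q p :: "coord \<Rightarrow> coperator"
begin

definition D_op :: coperator
  where "D_op = (\<Sum>r=0..n. q (X r) \<circ> p (X r)) + (\<Sum>r=1..n. q (Y r) \<circ> p (Y r))"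

definition Dc_op :: "complex \<Rightarrow> coperator"
  where "Dc_op c = D_op + oscale c id"

definition eta_op :: coperator
  where "eta_op = oscale (1/2) (q (X 0) \<circ> q (X 0)) + (\<Sum>i=1..n. q (X i) \<circ> q (Y i))"

definition A_op :: "complex \<Rightarrow> nat \<Rightarrow> nat \<Rightarrow> coperator"
  where "A_op c i j =
    (if i \<le> n \<and> j \<le> n then (q (X i) \<circ> p (X j)) - (q (Y j) \<circ> p (Y i))
     else if j \<le> n then p (X j)
     else if i \<le> n then (eta_op \<circ> p (Y i)) - (q (X i) \<circ> Dc_op c)
     else - Dc_op c)"

text \<open>Only used for \<open>i < j\<close>, so that \<open>j > n\<close> means \<open>j = n+1\<close>.\<close>

definition B_op :: "nat \<Rightarrow> nat \<Rightarrow> coperator"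
  where "B_op i j =
    (if j \<le> n then (q (X i) \<circ> p (Y j)) - (q (X j) \<circ> p (Y i))
     else - p (Y i))"

text \<open>Only used for \<open>j < i\<close>.\<close>

definition C_op :: "complex \<Rightarrow> nat \<Rightarrow> nat \<Rightarrow> coperator"
  where "C_op c i j =
    (if i \<le> n then (q (Y i) \<circ> p (X j)) - (q (Y j) \<circ> p (X i))
     else (q (Y j) \<circ> Dc_op c) - (eta_op \<circ> p (X j)))"

definition K_op :: "complex \<Rightarrow> nat \<Rightarrow> coperator"
  where "K_op c k =
    (if k \<le> n then (q (X 0) \<circ> p (X k)) - (q (Y k) \<circ> p (X 0))
     else if k = n+1 then (eta_op \<circ> p (X 0)) - (q (X 0) \<circ> Dc_op c)
     else if k \<le> 2*n+1 then (q (X 0) \<circ> p (Y (k-(n+1)))) - (q (X (k-(n+1))) \<circ> p (X 0))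
     else - p (X 0))"

text \<open>
  Linear extension from the basis \<open>A\<^sub>i\<^sub>j\<close>, \<open>B\<^sub>i\<^sub>j\<close> (\<open>i < j\<close>), \<open>C\<^sub>i\<^sub>j\<close> (\<open>j < i\<close>), \<open>K\<^sub>k\<close> of
  \<open>o(2n+3)\<close>: the coefficients of \<open>M\<close> are its entries in the positions \<open>(i, j)\<close>, \<open>(i, n+1+j)\<close>,
  \<open>(n+1+i, j)\<close>, \<open>(0, k)\<close>. The values on all the generators are computed below.
\<close>

definition pi_op :: "complex \<Rightarrow> cmat \<Rightarrow> coperator"
  where "pi_op c M =
    (\<Sum>i=1..n+1. \<Sum>j=1..n+1. oscale (M (i, j)) (A_op c i j)) +
    (\<Sum>j=1..n+1. \<Sum>i\<in>{1..<j}. oscale (M (i, n+1+j)) (B_op i j)) +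
    (\<Sum>i=1..n+1. \<Sum>j\<in>{1..<i}. oscale (M (n+1+i, j)) (C_op c i j)) +
    (\<Sum>k=1..2*n+2. oscale (M (0, k)) (K_op c k))"

end

definition pi_rep :: "nat \<Rightarrow> complex \<Rightarrow> cmat \<Rightarrow> coperator"
  where "pi_rep n c = pi_op n mult_op partial_op c"

definition swapped :: "nat \<Rightarrow> nat \<Rightarrow> nat \<Rightarrow> coord set"
  where "swapped n n1 n2 = X ` {1..n1} \<union> Y ` {n2+1..n}"

definition pi_swap_rep :: "nat \<Rightarrow> nat \<Rightarrow> nat \<Rightarrow> complex \<Rightarrow> cmat \<Rightarrow> coperator"
  where "pi_swap_rep n n1 n2 c = pi_op n
    (\<lambda>v. if v \<in> swapped n n1 n2 then partial_op v else mult_op v)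
    (\<lambda>v. if v \<in> swapped n n1 n2 then - mult_op v else partial_op v) c"


section \<open>Values of the representation on the generators\<close>

lemma oscale_simps [simp]: "oscale 0 T = 0" "oscale 1 T = T" "oscale (-1) T = - T"
  by (auto simp: oscale_def fscale_def fun_eq_iff)

lemma oscale_if: "oscale (if P then a else b) T = (if P then oscale a T else oscale b T)"
  by simp

lemma pi_op_add: "pi_op n q p c (M + N) = pi_op n q p c M + pi_op n q p c N"
proof -
  have *: "oscale (a + b) T = oscale a T + oscale b T" for a b T
    by (auto simp: oscale_def fscale_def fun_eq_iff algebra_simps)
  show ?thesis
    by (simp add: pi_op_def * sum.distrib)
qed

lemma pi_op_diff: "pi_op n q p c (M - N) = pi_op n q p c M - pi_op n q p c N"
  using pi_op_add [of n q p c "M - N" N] by simp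

lemma sum_delta2:
  fixes T :: "nat \<Rightarrow> nat \<Rightarrow> coperator"
  assumes "finite I" "\<And>i. finite (J i)"
  shows "(\<Sum>i\<in>I. \<Sum>j\<in>J i. oscale (if P \<and> i = r \<and> j = s then 1 else 0) (T i j)) =
    (if P \<and> r \<in> I \<and> s \<in> J r then T r s else 0)"
proof -
  have "(\<Sum>j\<in>J i. oscale (if P \<and> i = r \<and> j = s then 1 else 0) (T i j)) =
      (if i = r then if P \<and> s \<in> J r then T r s else 0 else 0)" for i
    using assms(2)[of i] by (cases "i = r"; cases P) (simp_all add: oscale_if sum.delta cong: if_cong)
  then show ?thesis
    using assms(1) by (simp add: sum.delta)
qed

lemma pi_op_zero: "pi_op n q p c 0 = 0"
  using pi_op_diff [of n q p c 0 0] by simp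

lemma pi_op_Emat:
  "pi_op n q p c (Emat r s) =
    (if r \<in> {1..n+1} \<and> s \<in> {1..n+1} then A_op n q p c r s else 0) +
    (if n+1 \<le> s \<and> s-(n+1) \<in> {1..n+1} \<and> r \<in> {1..<s-(n+1)} then B_op n q p r (s-(n+1)) else 0) +
    (if n+1 \<le> r \<and> r-(n+1) \<in> {1..n+1} \<and> s \<in> {1..<r-(n+1)} then C_op n q p c (r-(n+1)) s else 0) +
    (if r = 0 \<and> s \<in> {1..2*n+2} then K_op n q p c s else 0)"
proof -
  have A: "Emat r s (i, j) = (if True \<and> i = r \<and> j = s then 1 else 0)" for i j
    by (auto simp: Emat_def)
  have B: "Emat r s (i, n+1+j) = (if n+1 \<le> s \<and> j = s-(n+1) \<and> i = r then 1 else 0)" for i j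
    by (auto simp: Emat_def)
  have C: "Emat r s (n+1+i, j) = (if n+1 \<le> r \<and> i = r-(n+1) \<and> j = s then 1 else 0)" for i j
    by (auto simp: Emat_def)
  have K: "(\<Sum>k=1..2*n+2. oscale (Emat r s (0, k)) (K_op n q p c k)) =
      (if r = 0 \<and> s \<in> {1..2*n+2} then K_op n q p c s else 0)"
    by (cases "r = 0") (simp_all add: Emat_def oscale_if sum.delta cong: if_cong)
  show ?thesis
    unfolding pi_op_def K unfolding B C unfolding A
    by (subst sum_delta2, simp, simp)+ simp
qed

lemma pi_op_Amat:
  assumes "i \<in> {1..n+1}" "j \<in> {1..n+1}"
  shows "pi_op n q p c (Amat n i j) = A_op n q p c i j"
  using assms by (simp add: Amat_def pi_op_diff pi_op_Emat)

lemma pi_op_Bmat: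
  assumes "i \<in> {1..n}" "j \<in> {1..n}"
  shows "pi_op n q p c (Bmat n i j) = (q (X i) \<circ> p (Y j)) - (q (X j) \<circ> p (Y i))"
  using assms
  by (cases i j rule: linorder_cases)
    (simp_all add: Bmat_def pi_op_diff pi_op_Emat pi_op_zero B_op_def)

lemma pi_op_Bmat_last:
  assumes "i \<in> {1..n}"
  shows "pi_op n q p c (Bmat n i (n+1)) = - p (Y i)"
  using assms by (auto simp: Bmat_def pi_op_diff pi_op_Emat B_op_def)

lemma pi_op_Cmat:
  assumes "i \<in> {1..n}" "j \<in> {1..n}"
  shows "pi_op n q p c (Cmat n i j) = (q (Y i) \<circ> p (X j)) - (q (Y j) \<circ> p (X i))"
  using assms
  by (cases i j rule: linorder_cases)
    (simp_all add: Cmat_def pi_op_diff pi_op_Emat pi_op_zero C_op_def)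

lemma pi_op_Cmat_last:
  assumes "i \<in> {1..n}"
  shows "pi_op n q p c (Cmat n (n+1) i) = (q (Y i) \<circ> Dc_op n q p c) - (eta_op n q \<circ> p (X i))"
  using assms by (auto simp: Cmat_def pi_op_diff pi_op_Emat C_op_def)

lemma pi_op_Kmat:
  assumes "k \<in> {1..2*n+2}"
  shows "pi_op n q p c (Kmat n k) = K_op n q p c k"
  using assms by (auto simp: Kmat_def pi_op_diff pi_op_Emat)

end

theory Submission
  imports Defs
begin

text \<open>
  The matrices of \<open>o(2n+3)\<close> are those with \<open>M (s', r') = - M (r, s)\<close>, where \<open>r \<mapsto> r'\<close> exchanges
  \<open>i\<close> and \<open>n+1+i\<close> and fixes \<open>0\<close>. The variables, together with two more functions \<open>1\<close> and \<open>-\<eta>\<close>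
  in the positions \<open>n+1\<close> and \<open>2n+2\<close>, form homogeneous coordinates \<open>Z\<^sub>r\<close> on the quadric cone; with
  the partial derivatives, \<open>-(D+c)\<close> and \<open>0\<close> as the conjugate family \<open>P\<^sub>s\<close> all the formulas for
  \<open>\<pi>\<^sub>c\<close> become \<open>\<pi>\<^sub>c(M) = \<Sum> M(r,s) Z\<^sub>r P\<^sub>s\<close>. The \<open>Z\<close> and \<open>P\<close> satisfy the canonical commutation
  relations up to terms that cancel when summed against a skew matrix, and so \<open>\<pi>\<^sub>c\<close> respects
  brackets (\<open>rho_commutator\<close>). Only the relations of the Weyl algebra enter, and therefore the
  result holds at once for the differential operators on exponential polynomials and for the
  operators with swapped variables. Below, \<open>v'\<close> is the variable paired with \<open>v\<close> in \<open>\<eta>\<close>; thus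
  \<open>x\<^sub>0\<close> is its own partner. The letters \<open>q\<^sub>v\<close> and \<open>p\<^sub>v\<close> stand for the operators that represent \<open>x\<^sub>v\<close>
  and \<open>\<partial>\<^sub>v\<close>.

  Part (i). Let \<open>\<alpha>\<close> consist of the exponents \<open>a\<^sub>i\<close> and \<open>b\<^sub>i\<close>. A nonzero invariant subspace \<open>W\<close> is closed under the translations \<open>\<partial>\<^sub>v\<close>, and repeated
  application of \<open>\<partial>\<^sub>v - \<alpha>\<^sub>v\<close> brings any element down to the pure exponential
  (\<open>lowering_reaches_vacuum\<close>). Modulo terms of lower degree, the rotations and the Euler operator
  multiply by the linear forms \<open>\<alpha>\<^sub>w x\<^sub>v - \<alpha>\<^sub>v\<^sub>' x\<^sub>w\<^sub>'\<close> and \<open>\<Sum> \<alpha>\<^sub>v x\<^sub>v\<close>. Since \<open>\<alpha>\<close> is not isotropic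
  these span all linear forms, so that \<open>W\<close> contains all monomials by induction on the degree
  (\<open>irreducible_exp_module\<close>).

  Part (ii). It suffices to show that an invariant subspace \<open>W\<close> is closed under all the generators
  of the Weyl algebra, for which polynomials form a simple module. The translations \<open>p\<^sub>v\<close> belong to
  the Lie algebra. If \<open>J\<^sub>v = q\<^sub>v (D+c) - \<eta> p\<^sub>v\<^sub>'\<close> are the special conformal operators and \<open>\<Delta>\<close> the
  Laplacian dual to \<open>\<eta>\<close>, then
  \<open>\<Sum> J\<^sub>v p\<^sub>v = D (D+c-1) - \<eta>\<Delta>\<close> and \<open>\<Sum> J\<^sub>v J\<^sub>v\<^sub>' = \<eta> (\<eta>\<Delta> + \<kappa> (D+c))\<close> with \<open>\<kappa> = 2c+1-2n\<close>.
  Hence \<open>W\<close> is closed under \<open>\<eta>\<Delta>\<close> and under \<open>\<eta> (\<eta>\<Delta> + \<kappa> (D+c))\<close>. As no two dual variables are both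
  swapped, \<open>\<Delta>\<close> is locally nilpotent (\<open>Lap_nilpotent\<close>), and on the eigenspace \<open>D = d\<close> the operator
  \<open>\<eta>\<Delta>\<close> is annihilated by a product of factors \<open>\<eta>\<Delta> - \<mu>\<^sub>j\<close> with \<open>\<mu>\<^sub>j = j (2d-2j+2n-1)\<close>
  (\<open>chain_kills\<close>). Now \<open>\<mu>\<^sub>j + \<kappa> (d+c) = (c+d-j) (2j+\<kappa>)\<close>, which does not vanish because \<open>d\<close> is an
  integer and \<open>2c\<close> is not; so \<open>\<eta>\<Delta> + \<kappa> (D+c)\<close> is invertible there, \<open>W\<close> is closed under
  \<open>\<eta>\<close>, and \<open>J\<^sub>v + \<eta> p\<^sub>v\<^sub>' = q\<^sub>v (D+c)\<close> yields closure under \<open>q\<^sub>v\<close>.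

  For the weights, the Cartan subalgebra acts diagonally on monomials. A weight fixes
  \<open>m(v) + m(v')\<close> for every swapped \<open>v\<close> and the eigenvalue of \<open>D\<close>; the former bounds the exponents of
  the swapped variables and the latter then bounds all the others.
\<close>


section \<open>Joint eigenvectors\<close>

lemma sum_fun_apply: "(\<Sum>i\<in>I. f i) x = (\<Sum>i\<in>I. f i x)"
  for f :: "'i \<Rightarrow> 'a \<Rightarrow> 'b::comm_monoid_add"
  by (induction I rule: infinite_finite_induct) simp_all

lemma fscale_apply [simp]: "fscale c f z = c * f z"
  by (simp add: fscale_def)

text \<open>
  A subspace that is stable under a family of operators contains the components of each of its
  elements along joint eigenvectors with pairwise different systems of eigenvalues. For the zero
  subspace this is the linear independence of such eigenvectors. The operators need to be linear on
  \<open>V\<close> only, because differentiation is not additive on arbitrary functions.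
\<close>

lemma joint_eigenvectors_in_subspace:
  fixes T :: "'h \<Rightarrow> ('a \<Rightarrow> complex) \<Rightarrow> 'a \<Rightarrow> complex"
  assumes "finite I"
    and W: "cfun.subspace W" "\<And>M w. M \<in> H \<Longrightarrow> w \<in> W \<Longrightarrow> T M w \<in> W"
    and V: "cfun.subspace V"
    and add: "\<And>M f g. M \<in> H \<Longrightarrow> f \<in> V \<Longrightarrow> g \<in> V \<Longrightarrow> T M (f + g) = T M f + T M g"
    and scale: "\<And>M k f. M \<in> H \<Longrightarrow> f \<in> V \<Longrightarrow> T M (fscale k f) = fscale k (T M f)"
    and sep: "\<And>i j. i \<in> I \<Longrightarrow> j \<in> I \<Longrightarrow> i \<noteq> j \<Longrightarrow> \<exists>M\<in>H. ev M i \<noteq> ev M j"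
    and f: "\<And>i. i \<in> I \<Longrightarrow> f i \<in> V"
    and eig: "\<And>M i. M \<in> H \<Longrightarrow> i \<in> I \<Longrightarrow> T M (f i) = fscale (ev M i) (f i)"
    and "(\<Sum>i\<in>I. f i) \<in> W" and "i \<in> I"
  shows "f i \<in> W"
  using \<open>finite I\<close> sep f eig \<open>(\<Sum>i\<in>I. f i) \<in> W\<close> \<open>i \<in> I\<close>
proof (induction I arbitrary: f i rule: finite_psubset_induct)
  case (psubset I)
  show ?case
  proof (cases "I = {i}")
    case True
    then show ?thesis using psubset.prems(4) by simp
  next
    case False
    then obtain j where j: "j \<in> I" "j \<noteq> i" using psubset.prems(5) by auto
    obtain M where M: "M \<in> H" "ev M i \<noteq> ev M j"
      using psubset.prems(1)[of i j] psubset.prems(5) j by auto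
    define g where "g k = fscale (ev M k - ev M j) (f k)" for k
    have T_zero: "T M 0 = 0"
      using scale[OF M(1) cfun.subspace_0[OF V], of 0] by (auto simp: fun_eq_iff)
    have T_sum: "T M (\<Sum>k\<in>J. f k) = (\<Sum>k\<in>J. T M (f k))" if "J \<subseteq> I" for J
      using finite_subset[OF that psubset.hyps] that
    proof (induction J rule: finite_induct)
      case (insert x F)
      then show "T M (\<Sum>k\<in>insert x F. f k) = (\<Sum>k\<in>insert x F. T M (f k))"
        using add[OF M(1), of "f x" "\<Sum>k\<in>F. f k"] psubset.prems(2)
        by (simp add: cfun.subspace_sum[OF V] subset_iff)
    qed (simp add: T_zero)
    \<comment> \<open>\<open>T M - ev M j\<close> kills the component \<open>j\<close> and rescales the others, \<open>i\<close> by a nonzero factor\<close>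
    have "(\<Sum>k\<in>I. g k) = T M (\<Sum>k\<in>I. f k) - fscale (ev M j) (\<Sum>k\<in>I. f k)"
      using psubset.prems(3)[OF M(1)] T_sum[OF order_refl]
      by (simp add: g_def fun_eq_iff sum_fun_apply algebra_simps sum_subtractf sum_distrib_left)
    also have "\<dots> \<in> W"
      by (intro cfun.subspace_diff cfun.subspace_scale W M psubset.prems)
    finally have "(\<Sum>k\<in>I. g k) \<in> W" .
    moreover have "(\<Sum>k\<in>I. g k) = (\<Sum>k\<in>I - {j}. g k)"
      using psubset.hyps j by (subst sum.remove[of I j]) (simp_all add: g_def fun_eq_iff)
    ultimately have sum_g: "(\<Sum>k\<in>I - {j}. g k) \<in> W" by simp
    have "g i \<in> W"
    proof (rule psubset.IH[OF _ _ _ _ sum_g])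
      show "I - {j} \<subset> I" using j by auto
      show "T N (g k) = fscale (ev N k) (g k)" if "N \<in> H" "k \<in> I - {j}" for N k
        using that psubset.prems(2,3) scale[OF that(1), of "f k"]
        by (simp add: g_def mult_ac fun_eq_iff)
      show "g k \<in> V" if "k \<in> I - {j}" for k
        unfolding g_def using that psubset.prems(2) by (intro cfun.subspace_scale[OF V]) auto
    qed (use psubset.prems j in auto)
    then have "fscale (1 / (ev M i - ev M j)) (g i) \<in> W"
      by (rule cfun.subspace_scale[OF W(1)])
    then show ?thesis
      using M by (simp add: g_def fscale_def)
  qed
qed


section \<open>Exponential monomials\<close>

definition exp_monomial :: "coord set \<Rightarrow> (coord \<Rightarrow> complex) \<Rightarrow> (coord \<Rightarrow> nat) \<Rightarrow> cfunction"
  where "exp_monomial A \<alpha> m = (\<lambda>z. (\<Prod>v\<in>A. z v ^ m v) * exp (\<Sum>v\<in>A. \<alpha> v * z v))"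

text \<open>
  A single space that contains all the modules to be considered, whatever the exponents. On it
  multiplication and differentiation are everywhere defined linear operators satisfying the
  canonical commutation relations, so that operators form a ring.
\<close>

definition exp_poly_space :: "cfunction set"
  where "exp_poly_space = cfun.span {exp_monomial A \<alpha> m | A \<alpha> m. finite A}"

lemma subspace_exp_poly_space [simp]: "cfun.subspace exp_poly_space"
  by (simp add: exp_poly_space_def)

lemma exp_monomial_in_space [simp]: "finite A \<Longrightarrow> exp_monomial A \<alpha> m \<in> exp_poly_space"
  by (auto simp: exp_poly_space_def intro!: cfun.span_base)

text \<open>
  Adding a coordinate with exponent and frequency zero does not change the function. Hence the
  effect of one or two operators can always be computed on generators that involve their
  coordinates.
\<close>

lemma exp_poly_space_eq_span_pair:
  "exp_poly_space = cfun.span {exp_monomial A \<alpha> m | A \<alpha> m. finite A \<and> v \<in> A \<and> w \<in> A}"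
proof
  have "exp_monomial A \<alpha> m = exp_monomial (insert v (insert w A))
      (\<lambda>u. if u \<in> A then \<alpha> u else 0) (\<lambda>u. if u \<in> A then m u else 0)" if "finite A" for A \<alpha> m
  proof -
    have "(\<Prod>u\<in>A. z u ^ m u) =
        (\<Prod>u\<in>insert v (insert w A). z u ^ (if u \<in> A then m u else 0))" for z :: "coord \<Rightarrow> complex"
      using that by (intro prod.mono_neutral_cong_left) auto
    moreover have "(\<Sum>u\<in>A. \<alpha> u * z u) =
        (\<Sum>u\<in>insert v (insert w A). (if u \<in> A then \<alpha> u else 0) * z u)" for z :: "coord \<Rightarrow> complex"
      using that by (intro sum.mono_neutral_cong_left) auto
    ultimately show ?thesis by (simp add: exp_monomial_def)
  qed
  then have "{exp_monomial A \<alpha> m | A \<alpha> m. finite A} \<subseteq>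
      {exp_monomial A \<alpha> m | A \<alpha> m. finite A \<and> v \<in> A \<and> w \<in> A}"
    by (smt (verit, best) Collect_mono finite_insert insertCI)
  then show "exp_poly_space \<subseteq> cfun.span {exp_monomial A \<alpha> m | A \<alpha> m. finite A \<and> v \<in> A \<and> w \<in> A}"
    unfolding exp_poly_space_def by (rule cfun.span_mono)
next
  show "cfun.span {exp_monomial A \<alpha> m | A \<alpha> m. finite A \<and> v \<in> A \<and> w \<in> A} \<subseteq> exp_poly_space"
    unfolding exp_poly_space_def by (rule cfun.span_mono) auto
qed

lemma exp_poly_space_induct [consumes 1, case_names zero add base]:
  assumes "f \<in> exp_poly_space"
    and "P 0"
    and "\<And>c f g. f \<in> exp_poly_space \<Longrightarrow> g \<in> exp_poly_space \<Longrightarrow> P f \<Longrightarrow> P g \<Longrightarrow> P (fscale c f + g)"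
    and base: "\<And>A \<alpha> m. finite A \<Longrightarrow> v \<in> A \<Longrightarrow> w \<in> A \<Longrightarrow> P (exp_monomial A \<alpha> m)"
  shows "P f"
proof -
  have "f \<in> cfun.span {exp_monomial A \<alpha> m | A \<alpha> m. finite A \<and> v \<in> A \<and> w \<in> A}"
    using assms(1) unfolding exp_poly_space_eq_span_pair[of v w] .
  then have "f \<in> exp_poly_space \<and> P f"
  proof (induction rule: cfun.span_induct_alt)
    case base
    show "0 \<in> exp_poly_space \<and> P 0" using assms(2) by (simp add: cfun.subspace_0)
  next
    case (step c x y)
    then have "x \<in> exp_poly_space" "P x" using base by auto
    with step show "fscale c x + y \<in> exp_poly_space \<and> P (fscale c x + y)"
      using assms(3)[of x y c] unfolding exp_poly_space_eq_span_pair[of v w, symmetric]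
      by (auto intro!: cfun.subspace_add cfun.subspace_scale)
  qed
  then show ?thesis ..
qed

text \<open>
  Splitting off one variable reduces partial derivatives to derivatives of \<open>t ^ k * exp (a * t)\<close>.
\<close>

lemma exp_monomial_fun_upd:
  assumes "finite A" "v \<in> A"
  shows "exp_monomial A \<alpha> m (z(v := t)) =
    t ^ m v * exp (\<alpha> v * t) * exp_monomial (A - {v}) \<alpha> m z"
proof -
  have "(\<Prod>u\<in>A. (z(v := t)) u ^ m u) = t ^ m v * (\<Prod>u\<in>A - {v}. z u ^ m u)"
    using assms by (subst prod.remove[of A v]) (auto intro!: prod.cong)
  moreover have "(\<Sum>u\<in>A. \<alpha> u * (z(v := t)) u) = \<alpha> v * t + (\<Sum>u\<in>A - {v}. \<alpha> u * z u)"
    using assms by (subst sum.remove[of A v]) (auto intro!: sum.cong)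
  ultimately show ?thesis by (simp add: exp_monomial_def exp_add)
qed

lemma mult_op_exp_monomial:
  assumes "finite A" "v \<in> A"
  shows "mult_op v (exp_monomial A \<alpha> m) = exp_monomial A \<alpha> (m(v := Suc (m v)))"
proof
  fix z
  have "mult_op v (exp_monomial A \<alpha> m) z = z v * exp_monomial A \<alpha> m (z(v := z v))"
    by (simp add: mult_op_def)
  also have "\<dots> = exp_monomial A \<alpha> (m(v := Suc (m v))) (z(v := z v))"
    unfolding exp_monomial_fun_upd[OF assms] by (simp add: exp_monomial_def)
  finally show "mult_op v (exp_monomial A \<alpha> m) z = exp_monomial A \<alpha> (m(v := Suc (m v))) z"
    by simp
qed

lemma partial_op_exp_monomial:
  assumes "finite A" "v \<in> A"
  shows "partial_op v (exp_monomial A \<alpha> m) =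
    fscale (of_nat (m v)) (exp_monomial A \<alpha> (m(v := m v - 1))) + fscale (\<alpha> v) (exp_monomial A \<alpha> m)"
proof
  fix z
  have "((\<lambda>t. exp_monomial A \<alpha> m (z(v := t))) has_field_derivative
      (of_nat (m v) * z v ^ (m v - 1) * exp (\<alpha> v * z v) + \<alpha> v * (z v ^ m v * exp (\<alpha> v * z v)))
        * exp_monomial (A - {v}) \<alpha> m z) (at (z v))"
    unfolding exp_monomial_fun_upd[OF assms]
    by (auto intro!: derivative_eq_intros simp: algebra_simps)
  then have "partial_op v (exp_monomial A \<alpha> m) z =
      (of_nat (m v) * z v ^ (m v - 1) * exp (\<alpha> v * z v) + \<alpha> v * (z v ^ m v * exp (\<alpha> v * z v)))
        * exp_monomial (A - {v}) \<alpha> m z"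
    unfolding partial_op_def by (rule DERIV_imp_deriv)
  also have "\<dots> = (fscale (of_nat (m v)) (exp_monomial A \<alpha> (m(v := m v - 1)))
      + fscale (\<alpha> v) (exp_monomial A \<alpha> m)) (z(v := z v))"
    unfolding plus_fun_apply fscale_apply exp_monomial_fun_upd[OF assms]
    by (simp add: exp_monomial_def algebra_simps)
  finally show "partial_op v (exp_monomial A \<alpha> m) z =
      (fscale (of_nat (m v)) (exp_monomial A \<alpha> (m(v := m v - 1)))
        + fscale (\<alpha> v) (exp_monomial A \<alpha> m)) z" by simp
qed

lemma exp_poly_space_differentiable:
  assumes "f \<in> exp_poly_space"
  shows "(\<lambda>t. f (z(v := t))) field_differentiable at t"
  using assms
proof (induction rule: exp_poly_space_induct[where v = v and w = v])
  case zero
  show ?case by simp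
next
  case (add c f g)
  then show ?case by (auto intro!: derivative_intros)
next
  case (base A \<alpha> m)
  show ?case
    unfolding exp_monomial_fun_upd[OF base(1,2)]
    by (auto simp: field_differentiable_def intro!: exI derivative_eq_intros)
qed

lemma mult_op_add: "mult_op v (f + g) = mult_op v f + mult_op v g"
  by (simp add: mult_op_def fun_eq_iff algebra_simps)

lemma mult_op_scale: "mult_op v (fscale k f) = fscale k (mult_op v f)"
  by (simp add: mult_op_def fun_eq_iff)

lemma partial_op_add:
  "f \<in> exp_poly_space \<Longrightarrow> g \<in> exp_poly_space \<Longrightarrow> partial_op v (f + g) = partial_op v f + partial_op v g"
  by (simp add: partial_op_def fun_eq_iff deriv_add exp_poly_space_differentiable)

lemma partial_op_scale:
  "f \<in> exp_poly_space \<Longrightarrow> partial_op v (fscale k f) = fscale k (partial_op v f)"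
  by (simp add: partial_op_def fun_eq_iff deriv_cmult exp_poly_space_differentiable)

lemma mult_op_in_space:
  assumes "f \<in> exp_poly_space"
  shows "mult_op v f \<in> exp_poly_space"
  using assms
proof (induction rule: exp_poly_space_induct[where v = v and w = v])
  case zero
  have "mult_op v 0 = 0" by (simp add: mult_op_def fun_eq_iff)
  then show "mult_op v 0 \<in> exp_poly_space" by (simp add: cfun.subspace_0)
next
  case (add c f g)
  then show "mult_op v (fscale c f + g) \<in> exp_poly_space"
    by (simp add: mult_op_add mult_op_scale cfun.subspace_add cfun.subspace_scale)
qed (simp add: mult_op_exp_monomial)

lemma partial_op_zero: "partial_op v 0 = 0"
  by (simp add: partial_op_def fun_eq_iff)

lemma partial_op_in_space:
  assumes "f \<in> exp_poly_space"
  shows "partial_op v f \<in> exp_poly_space"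
  using assms
proof (induction rule: exp_poly_space_induct[where v = v and w = v])
  case zero
  show "partial_op v 0 \<in> exp_poly_space" by (simp add: partial_op_zero cfun.subspace_0)
next
  case (add c f g)
  then show "partial_op v (fscale c f + g) \<in> exp_poly_space"
    by (simp add: partial_op_add partial_op_scale cfun.subspace_add cfun.subspace_scale)
next
  case (base A \<alpha> m)
  then show "partial_op v (exp_monomial A \<alpha> m) \<in> exp_poly_space"
    by (simp add: partial_op_exp_monomial cfun.subspace_add cfun.subspace_scale)
qed

lemma partial_op_commute:
  assumes "f \<in> exp_poly_space"
  shows "partial_op v (partial_op w f) = partial_op w (partial_op v f)"
  using assms
proof (induction rule: exp_poly_space_induct[where v = v and w = w])
  case zero
  show "partial_op v (partial_op w 0) = partial_op w (partial_op v 0)" by (simp add: partial_op_zero)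
next
  case (add c f g)
  then show "partial_op v (partial_op w (fscale c f + g)) = partial_op w (partial_op v (fscale c f + g))"
    by (simp add: partial_op_add partial_op_scale partial_op_in_space cfun.subspace_scale)
next
  case (base A \<alpha> m)
  show "partial_op v (partial_op w (exp_monomial A \<alpha> m)) = partial_op w (partial_op v (exp_monomial A \<alpha> m))"
  proof (cases "v = w")
    case False
    with base show ?thesis
      by (simp add: partial_op_exp_monomial partial_op_add partial_op_scale cfun.subspace_scale)
        (simp add: fun_upd_twist fun_eq_iff algebra_simps)
  qed simp
qed

lemma partial_op_mult_op:
  assumes "f \<in> exp_poly_space"
  shows "partial_op v (mult_op w f) = mult_op w (partial_op v f) + (if v = w then f else 0)"
proof
  fix z
  show "partial_op v (mult_op w f) z = (mult_op w (partial_op v f) + (if v = w then f else 0)) z"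
  proof (cases "v = w")
    case True
    have "deriv (\<lambda>t. t * f (z(v := t))) (z v) = z v * deriv (\<lambda>t. f (z(v := t))) (z v) + f z"
      using exp_poly_space_differentiable[OF assms, of z v "z v"]
      by (subst deriv_mult) simp_all
    then show ?thesis using True by (simp add: partial_op_def mult_op_def)
  next
    case False
    have "deriv (\<lambda>t. z w * f (z(v := t))) (z v) = z w * deriv (\<lambda>t. f (z(v := t))) (z v)"
      using exp_poly_space_differentiable[OF assms, of z v "z v"] by (rule deriv_cmult)
    then show ?thesis using False by (simp add: partial_op_def mult_op_def)
  qed
qed


section \<open>The ring of linear operators on exponential polynomials\<close>

definition linear_on_space :: "coperator \<Rightarrow> bool"
  where "linear_on_space T \<longleftrightarrow> (\<forall>f\<in>exp_poly_space. T f \<in> exp_poly_space) \<and>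
    (\<forall>f\<in>exp_poly_space. \<forall>g\<in>exp_poly_space. T (f + g) = T f + T g) \<and>
    (\<forall>k. \<forall>f\<in>exp_poly_space. T (fscale k f) = fscale k (T f))"

text \<open>
  Setting the operators to zero outside the space makes equality of elements of the type the same
  as equality on the space (\<open>endo_eqI\<close>).
\<close>

typedef endo = "{T. linear_on_space T \<and> (\<forall>f. f \<notin> exp_poly_space \<longrightarrow> T f = 0)}"
  morphisms app Endo
  by (rule exI[of _ "\<lambda>_. 0"]) (auto simp: linear_on_space_def cfun.subspace_0)

definition endo_of :: "coperator \<Rightarrow> endo"
  where "endo_of T = Endo (\<lambda>f. if f \<in> exp_poly_space then T f else 0)"

lemma app_endo_of:
  assumes "linear_on_space T"
  shows "app (endo_of T) = (\<lambda>f. if f \<in> exp_poly_space then T f else 0)"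
  unfolding endo_of_def using assms
  by (intro Endo_inverse) (auto simp: linear_on_space_def cfun.subspace_add cfun.subspace_scale)

lemma
  shows app_in_space [simp]: "f \<in> exp_poly_space \<Longrightarrow> app T f \<in> exp_poly_space"
    and app_add: "f \<in> exp_poly_space \<Longrightarrow> g \<in> exp_poly_space \<Longrightarrow> app T (f + g) = app T f + app T g"
    and app_scale: "f \<in> exp_poly_space \<Longrightarrow> app T (fscale k f) = fscale k (app T f)"
    and app_outside: "f \<notin> exp_poly_space \<Longrightarrow> app T f = 0"
  using app[of T] by (auto simp: linear_on_space_def)

lemma app_zero_arg [simp]: "app T 0 = 0"
  using app_scale[of 0 T 0] by (simp add: fun_eq_iff cfun.subspace_0)

lemma app_diff:
  assumes "f \<in> exp_poly_space" "g \<in> exp_poly_space"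
  shows "app T (f - g) = app T f - app T g"
  using app_add[of "f - g" g T] assms by (simp add: cfun.subspace_diff)

lemma app_sum_arg:
  assumes "\<And>i. i \<in> I \<Longrightarrow> f i \<in> exp_poly_space"
  shows "app T (\<Sum>i\<in>I. f i) = (\<Sum>i\<in>I. app T (f i))"
  using assms
  by (induction I rule: infinite_finite_induct) (simp_all add: app_add cfun.subspace_sum)

instantiation endo :: ring_1
begin

definition "0 = endo_of (\<lambda>_. 0)"
definition "1 = endo_of (\<lambda>f. f)"
definition "S + T = endo_of (\<lambda>f. app S f + app T f)"
definition "- T = endo_of (\<lambda>f. - app T f)"
definition "S - T = endo_of (\<lambda>f. app S f - app T f)" for S T :: endo
definition "S * T = endo_of (\<lambda>f. app S (app T f))"

lemma app_ring_operations:
  "app 0 f = 0"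
  "app (S + T) f = app S f + app T f"
  "app (- T) f = - app T f"
  "app (S - T) f = app S f - app T f"
  "app (S * T) f = app S (app T f)"
  by (subst zero_endo_def plus_endo_def uminus_endo_def minus_endo_def times_endo_def, subst app_endo_of,
      auto simp: linear_on_space_def cfun.subspace_0 cfun.subspace_add cfun.subspace_neg cfun.subspace_diff
        app_add app_scale app_outside fun_eq_iff algebra_simps)+

lemma app_one: "f \<in> exp_poly_space \<Longrightarrow> app 1 f = f"
  by (subst one_endo_def, subst app_endo_of) (auto simp: linear_on_space_def)

lemma endo_eqI:
  assumes "\<And>f. f \<in> exp_poly_space \<Longrightarrow> app S f = app T f"
  shows "S = T"
proof -
  have "app S f = app T f" for f
    using assms by (cases "f \<in> exp_poly_space") (simp_all add: app_outside)
  then show ?thesis by (auto simp: app_inject[symmetric])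
qed

instance
proof
  have "app (0 :: endo) g \<noteq> app 1 g" if "g = exp_monomial {} (\<lambda>_. 0) (\<lambda>_. 0)" for g
    using that by (simp add: app_ring_operations app_one) (simp add: exp_monomial_def fun_eq_iff)
  then show "(0 :: endo) \<noteq> 1" by metis
qed (rule endo_eqI, simp add: app_ring_operations app_one app_add cfun.subspace_0 algebra_simps)+

end

lemma app_sum: "app (\<Sum>i\<in>I. T i) f = (\<Sum>i\<in>I. app (T i) f)"
  by (induction I rule: infinite_finite_induct) (simp_all add: app_ring_operations)

definition sc :: "complex \<Rightarrow> endo"
  where "sc k = endo_of (fscale k)"

lemma app_sc: "f \<in> exp_poly_space \<Longrightarrow> app (sc k) f = fscale k f"
  by (subst sc_def, subst app_endo_of)
    (auto simp: linear_on_space_def cfun.subspace_scale fun_eq_iff algebra_simps)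

lemma sc_hom:
  "sc 0 = 0" "sc 1 = 1" "sc (a + b) = sc a + sc b" "sc (a * b) = sc a * sc b"
  "sc (- a) = - sc a" "sc (a - b) = sc a - sc b"
  by (rule endo_eqI,
      simp add: app_ring_operations app_one app_sc fun_eq_iff cfun.subspace_scale algebra_simps)+

lemma sc_central: "T * sc k = sc k * T"
  by (rule endo_eqI) (simp add: app_ring_operations app_sc app_scale)

lemma sc_of_nat: "sc (of_nat k) = of_nat k"
  by (induction k) (simp_all add: sc_hom)


section \<open>Identities in the Weyl algebra\<close>

text \<open>
  An involution of the index set selects the quadratic form \<open>\<eta>\<close> and the dual Laplacian. The operators
  \<open>J\<close> are, up to sign, the images of the special conformal transformations.
\<close>

locale weyl_pairs =
  fixes C :: "'v set" and dual :: "'v \<Rightarrow> 'v" and q p :: "'v \<Rightarrow> endo" and c :: complex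
  assumes finite_C: "finite C"
    and dual_dual [simp]: "dual (dual v) = v"
    and dual_C: "v \<in> C \<Longrightarrow> dual v \<in> C"
    and q_comm: "q v * q w = q w * q v"
    and p_comm: "p v * p w = p w * p v"
    and p_q: "p v * q w = q w * p v + (if v = w then 1 else 0)"
begin

definition D :: endo where "D = (\<Sum>v\<in>C. q v * p v)"
definition Dc :: endo where "Dc = D + sc c"
definition eta :: endo where "eta = sc (1/2) * (\<Sum>v\<in>C. q v * q (dual v))"
definition Lap :: endo where "Lap = (\<Sum>v\<in>C. p v * p (dual v))"
definition J :: "'v \<Rightarrow> endo" where "J v = q v * Dc - eta * p (dual v)"

lemma half_double: "sc (1/2) * (T + T) = T"
proof -
  have "sc (1/2) * (T + T) = (sc (1/2) + sc (1/2)) * T"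
    by (simp add: algebra_simps)
  also have "sc (1/2) + sc (1/2) = 1"
    by (simp flip: sc_hom(3) add: sc_hom(2))
  finally show ?thesis by simp
qed

lemma eta_double: "(\<Sum>v\<in>C. q v * q (dual v)) = eta + eta"
  using half_double[of "\<Sum>v\<in>C. q v * q (dual v)"] by (simp add: eta_def distrib_left)

lemma sum_dual: "(\<Sum>v\<in>C. f (dual v)) = (\<Sum>v\<in>C. f v)"
  by (rule sum.reindex_bij_witness[of _ dual dual]) (auto simp: dual_C)

lemma sum_delta_mult: "v \<in> C \<Longrightarrow> (\<Sum>w\<in>C. f w * (if v = w then 1 else 0)) = f v" for f :: "'v \<Rightarrow> endo"
  using finite_C by (simp add: if_distrib[of "\<lambda>x. _ * x"] sum.delta' cong: if_cong)

lemma delta_mult_sum: "v \<in> C \<Longrightarrow> (\<Sum>w\<in>C. (if v = w then 1 else 0) * f w) = f v" for f :: "'v \<Rightarrow> endo"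
  using finite_C by (simp add: if_distrib[of "\<lambda>x. x * _"] sum.delta' cong: if_cong)

lemma D_q: assumes "v \<in> C" shows "D * q v = q v * D + q v"
proof -
  have "q w * p w * q v = q v * (q w * p w) + q w * (if v = w then 1 else 0)" for w
  proof -
    have "q w * p w * q v = q w * q v * p w + q w * (if v = w then 1 else 0)"
      by (simp add: mult.assoc p_q algebra_simps)
    also have "q w * q v = q v * q w" by (rule q_comm)
    finally show ?thesis by (simp add: mult.assoc)
  qed
  then show ?thesis
    using assms by (simp add: D_def sum_distrib_left sum_distrib_right sum.distrib sum_delta_mult)
qed

lemma p_D: assumes "v \<in> C" shows "p v * D = D * p v + p v"
proof -
  have "p v * (q w * p w) = q w * p w * p v + (if v = w then 1 else 0) * p w" for w
  proof -
    have "p v * (q w * p w) = (p v * q w) * p w" by (simp add: mult.assoc)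
    also have "\<dots> = q w * (p v * p w) + (if v = w then 1 else 0) * p w"
      by (simp add: p_q algebra_simps)
    also have "p v * p w = p w * p v" by (rule p_comm)
    finally show ?thesis by (simp add: mult.assoc)
  qed
  then show ?thesis
    using assms by (simp add: D_def sum_distrib_left sum_distrib_right sum.distrib delta_mult_sum)
qed

lemma eta_q: "eta * q v = q v * eta"
proof -
  have "q w * q (dual w) * q v = q v * (q w * q (dual w))" for w
    by (metis mult.assoc q_comm)
  then have "(\<Sum>w\<in>C. q w * q (dual w)) * q v = q v * (\<Sum>w\<in>C. q w * q (dual w))"
    by (simp add: sum_distrib_left sum_distrib_right)
  then show ?thesis
    unfolding eta_def by (metis mult.assoc sc_central)
qed

lemma p_eta: assumes "v \<in> C" shows "p v * eta = eta * p v + q (dual v)"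
proof -
  have "p v * (q w * q (dual w)) = q w * q (dual w) * p v
      + q w * (if dual v = w then 1 else 0) + (if v = w then 1 else 0) * q (dual w)" for w
  proof -
    have "p v * (q w * q (dual w)) = (p v * q w) * q (dual w)" by (simp add: mult.assoc)
    also have "\<dots> = q w * (p v * q (dual w)) + (if v = w then 1 else 0) * q (dual w)"
      by (simp add: p_q[of v w] algebra_simps)
    also have "q w * (p v * q (dual w)) = q w * q (dual w) * p v + q w * (if dual v = w then 1 else 0)"
      by (auto simp: p_q[of v "dual w"] algebra_simps)
    finally show ?thesis .
  qed
  then have "p v * (\<Sum>w\<in>C. q w * q (dual w)) = (\<Sum>w\<in>C. q w * q (dual w)) * p v + (q (dual v) + q (dual v))"
    using assms by (simp add: sum_distrib_left sum_distrib_right sum.distrib sum_delta_mult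
        delta_mult_sum dual_C)
  then have "sc (1/2) * (p v * (\<Sum>w\<in>C. q w * q (dual w))) = eta * p v + q (dual v)"
    by (simp add: distrib_left[of _ _ "q (dual v) + q (dual v)"] half_double eta_def mult.assoc)
  then show ?thesis
    unfolding eta_def by (metis mult.assoc sc_central)
qed

lemma D_eta: "D * eta = eta * D + eta + eta"
proof -
  have "D * (q w * q (dual w)) = q w * q (dual w) * D + (q w * q (dual w) + q w * q (dual w))"
    if "w \<in> C" for w
  proof -
    have "D * (q w * q (dual w)) = (q w * D + q w) * q (dual w)"
      using D_q[OF that] by (simp flip: mult.assoc)
    also have "\<dots> = q w * (D * q (dual w)) + q w * q (dual w)" by (simp add: algebra_simps)
    finally show ?thesis using D_q[OF dual_C[OF that]] by (simp add: algebra_simps)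
  qed
  then have "D * (eta + eta) = (eta + eta) * D + ((eta + eta) + (eta + eta))"
    unfolding eta_double[symmetric] by (simp add: sum_distrib_left sum_distrib_right sum.distrib)
  then have "sc (1/2) * (D * eta + D * eta) = sc (1/2) * ((eta * D + eta + eta) + (eta * D + eta + eta))"
    by (simp add: algebra_simps)
  then show ?thesis by (simp only: half_double)
qed

lemma Lap_D: "Lap * D = D * Lap + Lap + Lap"
proof -
  have "p w * p (dual w) * D = D * (p w * p (dual w)) + p w * p (dual w) + p w * p (dual w)"
    if "w \<in> C" for w
  proof -
    have "p w * p (dual w) * D = (p w * D) * p (dual w) + p w * p (dual w)"
      using p_D[OF dual_C[OF that]] by (simp add: algebra_simps)
    then show ?thesis using p_D[OF that] by (simp add: algebra_simps)
  qed
  then show ?thesis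
    unfolding Lap_def by (simp add: sum_distrib_left sum_distrib_right sum.distrib)
qed

lemma Lap_eta: "Lap * eta = eta * Lap + D + D + of_nat (card C)"
proof -
  have "p w * p (dual w) * eta = eta * (p w * p (dual w)) + q (dual w) * p (dual w) + q w * p w + 1"
    if "w \<in> C" for w
  proof -
    have "p w * p (dual w) * eta = (p w * eta) * p (dual w) + p w * q w"
      using p_eta[OF dual_C[OF that]] by (simp add: algebra_simps)
    then show ?thesis using p_eta[OF that] by (simp add: p_q algebra_simps)
  qed
  then have "Lap * eta = eta * Lap + (\<Sum>w\<in>C. q (dual w) * p (dual w)) + D + of_nat (card C)"
    unfolding Lap_def D_def by (simp add: sum_distrib_left sum_distrib_right sum.distrib)
  then show ?thesis using sum_dual[of "\<lambda>w. q w * p w"] by (simp add: D_def)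
qed

lemma Lap_eta_Lap: "Lap * (eta * Lap) = (eta * Lap + D + D + of_nat (card C)) * Lap"
  using Lap_eta by (simp flip: mult.assoc)

lemma D_eta_Lap: "D * (eta * Lap) = eta * Lap * D"
proof -
  have "D * (eta * Lap) = (D * eta) * Lap" by (simp add: mult.assoc)
  also have "\<dots> = eta * (D * Lap + Lap + Lap)" by (simp add: D_eta algebra_simps)
  also have "\<dots> = eta * (Lap * D)" by (simp only: Lap_D)
  finally show ?thesis by (simp add: mult.assoc)
qed

lemma Dc_q: "v \<in> C \<Longrightarrow> Dc * q v = q v * (Dc + 1)"
  by (simp add: Dc_def D_q sc_central algebra_simps)

lemma Dc_p: "v \<in> C \<Longrightarrow> Dc * p v = p v * (Dc - 1)"
  by (simp add: Dc_def p_D sc_central algebra_simps)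

lemma Dc_eta: "Dc * eta = eta * (Dc + 2)"
proof -
  have "(2 :: endo) = 1 + 1" by simp
  then show ?thesis by (simp only: Dc_def D_eta sc_central algebra_simps mult_1_right)
qed

text \<open>
  Contracting special conformal operators with translations produces \<open>\<eta>\<Delta>\<close> inside the enveloping
  algebra. It is the part of the rotation Casimir that is not a polynomial in \<open>D\<close>.
\<close>

lemma sum_J_p: "(\<Sum>v\<in>C. J v * p v) = D * (Dc - 1) - eta * Lap"
proof -
  have "J v * p v = q v * p v * (Dc - 1) - eta * (p v * p (dual v))" if "v \<in> C" for v
  proof -
    have "J v * p v = q v * (Dc * p v) - eta * (p (dual v) * p v)" by (simp add: J_def algebra_simps)
    then show ?thesis by (simp only: Dc_p[OF that] p_comm[of "dual v"] mult.assoc)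
  qed
  then show ?thesis
    by (simp add: D_def Lap_def sum_subtractf sum_distrib_left sum_distrib_right)
qed

text \<open>
  The inversion conjugate of the Laplacian. It is divisible by \<open>\<eta>\<close> on the left, and the cofactor
  commutes with \<open>D\<close> and \<open>\<eta>\<Delta>\<close>.
\<close>

lemma sum_J_J:
  "(\<Sum>v\<in>C. J v * J (dual v)) = eta * (eta * Lap + sc (2 * c + 2 - of_nat (card C)) * Dc)"
proof -
  let ?N = "of_nat (card C) :: endo"
  have "J v * J (dual v) = q v * q (dual v) * ((Dc + 1) * Dc) - eta * (q v * p v * (Dc + 1))
      - eta * (q (dual v) * p (dual v) * Dc) - eta * Dc + eta * (eta * (p v * p (dual v)))
      + eta * (q v * p v)" if v: "v \<in> C" for v
  proof -
    have t1: "q v * Dc * (q (dual v) * Dc) = q v * q (dual v) * ((Dc + 1) * Dc)"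
      using Dc_q[OF dual_C[OF v]] by (metis mult.assoc)
    have "q v * Dc * (eta * p v) = q v * (Dc * eta) * p v" by (simp add: mult.assoc)
    also have "\<dots> = eta * (q v * ((Dc + 2) * p v))"
      unfolding Dc_eta using eta_q[of v] by (metis mult.assoc)
    also have "(Dc + 2) * p v = p v * (Dc + 1)"
    proof -
      have "(2 :: endo) = 1 + 1" by simp
      then show ?thesis using Dc_p[OF v] by (simp only: algebra_simps) simp
    qed
    finally have t2: "q v * Dc * (eta * p v) = eta * (q v * p v * (Dc + 1))" by (simp add: mult.assoc)
    have t3: "eta * p (dual v) * (q (dual v) * Dc) = eta * (q (dual v) * p (dual v) * Dc) + eta * Dc"
    proof -
      have "eta * p (dual v) * (q (dual v) * Dc) = eta * ((p (dual v) * q (dual v)) * Dc)"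
        by (simp add: mult.assoc)
      then show ?thesis by (simp add: p_q algebra_simps)
    qed
    have t4: "eta * p (dual v) * (eta * p v) = eta * (eta * (p v * p (dual v))) + eta * (q v * p v)"
    proof -
      have "eta * p (dual v) * (eta * p v) = eta * ((p (dual v) * eta) * p v)"
        by (simp add: mult.assoc)
      then show ?thesis
        using p_comm[of v "dual v"] by (simp add: p_eta[OF dual_C[OF v]] algebra_simps)
    qed
    have "J v * J (dual v) = q v * Dc * (q (dual v) * Dc) - q v * Dc * (eta * p v)
        - eta * p (dual v) * (q (dual v) * Dc) + eta * p (dual v) * (eta * p v)"
      by (simp add: J_def algebra_simps)
    then show ?thesis unfolding t1 t2 t3 t4 by (simp add: algebra_simps)
  qed
  then have "(\<Sum>v\<in>C. J v * J (dual v)) = (eta + eta) * ((Dc + 1) * Dc) - eta * (D * (Dc + 1))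
      - eta * ((\<Sum>v\<in>C. q (dual v) * p (dual v)) * Dc) - ?N * (eta * Dc) + eta * (eta * Lap) + eta * D"
    unfolding eta_double[symmetric]
    by (simp add: D_def Lap_def sum.distrib sum_subtractf sum_distrib_left sum_distrib_right)
  also have "(\<Sum>v\<in>C. q (dual v) * p (dual v)) = D"
    using sum_dual[of "\<lambda>w. q w * p w"] by (simp add: D_def)
  also have "?N * (eta * Dc) = eta * (?N * Dc)"
    by (metis mult.assoc mult_of_nat_commute)
  also have "(eta + eta) * ((Dc + 1) * Dc) - eta * (D * (Dc + 1)) - eta * (D * Dc)
      - eta * (?N * Dc) + eta * (eta * Lap) + eta * D
      = eta * (eta * Lap + ((Dc - D) + (Dc - D) + 1 + 1 - ?N) * Dc)"
    by (simp add: algebra_simps)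
  also have "(Dc - D) + (Dc - D) + 1 + 1 - ?N = sc (2 * c + 2 - of_nat (card C))"
  proof -
    have "2 * c + 2 - of_nat (card C) = c + c + 1 + 1 - of_nat (card C)" by simp
    then show ?thesis
      by (simp only: sc_hom sc_of_nat) (simp add: Dc_def)
  qed
  finally show ?thesis .
qed

end


section \<open>The orthogonal Lie algebra as skew matrices\<close>

definition indices :: "nat \<Rightarrow> nat set"
  where "indices n = {0..2*n+2}"

lemma finite_indices [simp]: "finite (indices n)"
  by (simp add: indices_def)

text \<open>
  The position of the conjugate variable: the quadratic form preserved by the Lie algebra pairs \<open>r\<close>
  with \<open>opp n r\<close>.
\<close>

definition opp :: "nat \<Rightarrow> nat \<Rightarrow> nat"
  where "opp n r = (if r = 0 then 0 else if r \<le> n+1 then r + (n+1) else r - (n+1))"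

definition skew :: "nat \<Rightarrow> cmat \<Rightarrow> bool"
  where "skew n M \<longleftrightarrow> (\<forall>r\<in>indices n. \<forall>s\<in>indices n. M (opp n s, opp n r) = - M (r, s)) \<and>
    (\<forall>r s. r \<notin> indices n \<or> s \<notin> indices n \<longrightarrow> M (r, s) = 0)"

definition Fmat :: "nat \<Rightarrow> nat \<Rightarrow> nat \<Rightarrow> cmat"
  where "Fmat n r s = Emat r s - Emat (opp n s) (opp n r)"

lemma opp_opp [simp]: "r \<in> indices n \<Longrightarrow> opp n (opp n r) = r"
  by (auto simp: opp_def indices_def)

lemma opp_mem [simp]: "r \<in> indices n \<Longrightarrow> opp n r \<in> indices n"
  by (auto simp: opp_def indices_def)

lemma sum_opp: "(\<Sum>r\<in>indices n. f (opp n r)) = (\<Sum>r\<in>indices n. f r)"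
  by (rule sum.reindex_bij_witness[of _ "opp n" "opp n"]) auto

lemma skewD: "skew n M \<Longrightarrow> r \<in> indices n \<Longrightarrow> s \<in> indices n \<Longrightarrow> M (opp n s, opp n r) = - M (r, s)"
  by (simp add: skew_def)

lemma Fmat_opp: "r \<in> indices n \<Longrightarrow> s \<in> indices n \<Longrightarrow> Fmat n (opp n s) (opp n r) = - Fmat n r s"
  by (simp add: Fmat_def)

lemma Amat_eq_Fmat: "i \<in> {1..n+1} \<Longrightarrow> j \<in> {1..n+1} \<Longrightarrow> Amat n i j = Fmat n i j"
  by (simp add: Amat_def Fmat_def opp_def add.commute)

lemma Bmat_eq_Fmat: "i \<in> {1..n+1} \<Longrightarrow> j \<in> {1..n+1} \<Longrightarrow> Bmat n i j = Fmat n i (n+1+j)"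
  by (simp add: Bmat_def Fmat_def opp_def add.commute)

lemma Cmat_eq_Fmat: "i \<in> {1..n+1} \<Longrightarrow> j \<in> {1..n+1} \<Longrightarrow> Cmat n i j = Fmat n (n+1+i) j"
  by (simp add: Cmat_def Fmat_def opp_def add.commute)

lemma Kmat_eq_Fmat: "k \<in> {1..2*n+2} \<Longrightarrow> Kmat n k = Fmat n 0 k"
  by (auto simp: Kmat_def Fmat_def opp_def add.commute)

lemma index_cases:
  assumes "r \<in> indices n"
  obtains "r = 0" | i where "i \<in> {1..n+1}" "r = i" | i where "i \<in> {1..n+1}" "r = n+1+i"
proof -
  have "r = 0 \<or> r \<in> {1..n+1} \<or> (r - (n+1) \<in> {1..n+1} \<and> r = n+1+(r-(n+1)))"
    using assms by (auto simp: indices_def)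
  then show ?thesis using that by blast
qed

text \<open>
  Positions such as \<open>(r, 0)\<close> that do not occur among the generators are reduced to those that do by
  passing to the opposite pair, at the price of a sign.
\<close>

lemma Fmat_cases:
  assumes "r \<in> indices n" "s \<in> indices n"
  obtains "Fmat n r s = 0"
  | i j where "i \<in> {1..n+1}" "j \<in> {1..n+1}" "Fmat n r s = Amat n i j \<or> Fmat n r s = - Amat n i j
        \<or> Fmat n r s = Bmat n i j \<or> Fmat n r s = Cmat n i j"
  | k where "k \<in> {1..2*n+2}" "Fmat n r s = Kmat n k \<or> Fmat n r s = - Kmat n k"
proof (cases rule: index_cases[OF assms(1)]; cases rule: index_cases[OF assms(2)])
  assume "r = 0" "s = 0"
  then show ?thesis using that(1) by (simp add: Fmat_def opp_def)
next
  fix j assume "r = 0" "j \<in> {1..n+1}" "s = j"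
  then show ?thesis using that(3)[of j] Kmat_eq_Fmat[of j n] by simp
next
  fix j assume "r = 0" "j \<in> {1..n+1}" "s = n+1+j"
  then show ?thesis using that(3)[of s] Kmat_eq_Fmat[of s n] by simp
next
  fix i assume r: "i \<in> {1..n+1}" "r = i" "s = 0"
  then show ?thesis
    using that(3)[of "opp n r"] Kmat_eq_Fmat[of "opp n r" n] Fmat_opp[of r n s] assms
    by (simp add: opp_def)
next
  fix i assume r: "i \<in> {1..n+1}" "r = n+1+i" "s = 0"
  then show ?thesis
    using that(3)[of "opp n r"] Kmat_eq_Fmat[of "opp n r" n] Fmat_opp[of r n s] assms
    by (simp add: opp_def)
next
  fix i j assume "i \<in> {1..n+1}" "r = i" "j \<in> {1..n+1}" "s = j"
  then show ?thesis using that(2)[of i j] Amat_eq_Fmat[of i n j] by simp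
next
  fix i j assume "i \<in> {1..n+1}" "r = i" "j \<in> {1..n+1}" "s = n+1+j"
  then show ?thesis using that(2)[of i j] Bmat_eq_Fmat[of i n j] by simp
next
  fix i j assume "i \<in> {1..n+1}" "r = n+1+i" "j \<in> {1..n+1}" "s = j"
  then show ?thesis using that(2)[of i j] Cmat_eq_Fmat[of i n j] by simp
next
  fix i j assume "i \<in> {1..n+1}" "r = n+1+i" "j \<in> {1..n+1}" "s = n+1+j"
  then show ?thesis
    using that(2)[of j i] Amat_eq_Fmat[of j n i] Fmat_opp[of r n s] assms by (simp add: opp_def)
qed

lemma Fmat_in_o_odd:
  assumes "r \<in> indices n" "s \<in> indices n"
  shows "Fmat n r s \<in> o_odd n"
proof -
  have even: "M \<in> o_odd n" if "M \<in> {Amat n i j, Bmat n i j, Cmat n i j}"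
    "i \<in> {1..n+1}" "j \<in> {1..n+1}" for M i j
    unfolding o_odd_def o_even_def using that by (blast intro: cfun.span_base)
  have odd: "Kmat n k \<in> o_odd n" if "k \<in> {1..2*n+2}" for k
    unfolding o_odd_def using that by (blast intro: cfun.span_base)
  have neg: "- M \<in> o_odd n" if "M \<in> o_odd n" for M
    using that unfolding o_odd_def by (rule cfun.span_neg)
  show ?thesis
  proof (rule Fmat_cases[OF assms])
    assume "Fmat n r s = 0"
    then show ?thesis by (simp add: o_odd_def cfun.span_zero)
  next
    fix i j
    assume ij: "i \<in> {1..n+1}" "j \<in> {1..n+1}" and "Fmat n r s = Amat n i j \<or> Fmat n r s = - Amat n i j
        \<or> Fmat n r s = Bmat n i j \<or> Fmat n r s = Cmat n i j"
    then show ?thesis using even[OF _ ij] neg by (metis insertCI)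
  next
    fix k
    assume "k \<in> {1..2*n+2}" "Fmat n r s = Kmat n k \<or> Fmat n r s = - Kmat n k"
    then show ?thesis using odd neg by metis
  qed
qed

text \<open>
  Replacing \<open>(r, s)\<close> by the opposite pair changes the sign of both the coefficient and the matrix
  unit, and so the two matrix units in \<open>Fmat\<close> contribute equally to the sum.
\<close>

lemma skew_eq_sum_Fmat:
  assumes "skew n M"
  shows "M = fscale (1/2) (\<Sum>r\<in>indices n. \<Sum>s\<in>indices n. fscale (M (r, s)) (Fmat n r s))"
proof
  fix x :: "nat \<times> nat"
  obtain a b where x: "x = (a, b)" by (cases x)
  have pick: "(\<Sum>r\<in>indices n. \<Sum>s\<in>indices n. f r s * Emat r s (a, b)) =
      (if a \<in> indices n \<and> b \<in> indices n then f a b else 0)" for f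
  proof -
    have "f r s * Emat r s (a, b) = (if b = s then if a = r then f r s else 0 else 0)" for r s
      by (simp add: Emat_def)
    then show ?thesis
      by (cases "a \<in> indices n"; cases "b \<in> indices n") (simp_all add: sum.delta')
  qed
  have "(\<Sum>r\<in>indices n. \<Sum>s\<in>indices n. M (r, s) * Emat (opp n s) (opp n r) (a, b))
      = (\<Sum>r\<in>indices n. \<Sum>s\<in>indices n. M (opp n r, opp n s) * Emat (opp n (opp n s)) (opp n (opp n r)) (a, b))"
    by (subst sum_opp[symmetric], rule sum.cong[OF refl], subst sum_opp[symmetric], rule refl)
  also have "\<dots> = (\<Sum>r\<in>indices n. \<Sum>s\<in>indices n. - M (s, r) * Emat s r (a, b))"
    using skewD[OF assms] by (intro sum.cong refl) simp
  also have "\<dots> = (\<Sum>s\<in>indices n. \<Sum>r\<in>indices n. - M (s, r) * Emat s r (a, b))"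
    by (rule sum.swap)
  also have "\<dots> = (if a \<in> indices n \<and> b \<in> indices n then - M (a, b) else 0)" by (rule pick)
  finally have "(\<Sum>r\<in>indices n. \<Sum>s\<in>indices n. M (r, s) * Fmat n r s (a, b))
      = (if a \<in> indices n \<and> b \<in> indices n then 2 * M (a, b) else 0)"
    using pick[of "\<lambda>r s. M (r, s)"] by (simp add: Fmat_def algebra_simps sum_subtractf)
  moreover have "M (a, b) = 0" if "\<not> (a \<in> indices n \<and> b \<in> indices n)"
    using assms that unfolding skew_def by (blast)
  ultimately show "M x = fscale (1/2) (\<Sum>r\<in>indices n. \<Sum>s\<in>indices n. fscale (M (r, s)) (Fmat n r s)) x"
    unfolding x by (auto simp: sum_fun_apply)
qed

lemma Emat_opp:
  assumes "r \<in> indices n" "s \<in> indices n" "a \<in> indices n" "b \<in> indices n"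
  shows "Emat r s (opp n b, opp n a) = Emat (opp n s) (opp n r) (a, b)"
proof -
  have "opp n b = r \<longleftrightarrow> b = opp n r" "opp n a = s \<longleftrightarrow> a = opp n s"
    using assms by (metis opp_opp)+
  then show ?thesis by (auto simp: Emat_def)
qed

lemma skew_Fmat:
  assumes "r \<in> indices n" "s \<in> indices n"
  shows "skew n (Fmat n r s)"
proof -
  have 1: "Fmat n r s (opp n b, opp n a) = - Fmat n r s (a, b)" if "a \<in> indices n" "b \<in> indices n" for a b
    using assms that by (simp add: Fmat_def Emat_opp)
  have 2: "Fmat n r s (a, b) = 0" if "a \<notin> indices n \<or> b \<notin> indices n" for a b
  proof -
    have "(a, b) \<noteq> (r, s)" "(a, b) \<noteq> (opp n s, opp n r)"
      using that assms opp_mem by blast+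
    then show ?thesis
      unfolding Fmat_def fun_diff_def Emat_def by (simp only: if_False diff_self)
  qed
  show ?thesis
    unfolding skew_def
  proof (intro conjI ballI allI impI)
    fix a b assume "a \<in> indices n" "b \<in> indices n"
    then show "Fmat n r s (opp n b, opp n a) = - Fmat n r s (a, b)" by (rule 1)
  next
    fix a b assume "a \<notin> indices n \<or> b \<notin> indices n"
    then show "Fmat n r s (a, b) = 0" by (rule 2)
  qed
qed

lemma subspace_skew: "cfun.subspace {M. skew n M}"
  by (auto simp: cfun.subspace_def skew_def)

lemma o_odd_eq_skew: "o_odd n = {M. skew n M}"
proof
  have "Amat n i j \<in> {M. skew n M}" "Bmat n i j \<in> {M. skew n M}" "Cmat n i j \<in> {M. skew n M}"
    if "i \<in> {1..n+1}" "j \<in> {1..n+1}" for i j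
    using that by (auto simp: Amat_eq_Fmat Bmat_eq_Fmat Cmat_eq_Fmat indices_def intro!: skew_Fmat)
  then have "o_even n \<subseteq> {M. skew n M}"
    unfolding o_even_def by (intro cfun.span_minimal subspace_skew) blast
  moreover have "Kmat n k \<in> {M. skew n M}" if "k \<in> {1..2*n+2}" for k
    using that by (auto simp: Kmat_eq_Fmat indices_def intro!: skew_Fmat)
  ultimately show "o_odd n \<subseteq> {M. skew n M}"
    unfolding o_odd_def by (intro cfun.span_minimal subspace_skew) blast
next
  show "{M. skew n M} \<subseteq> o_odd n"
  proof
    fix M assume "M \<in> {M. skew n M}"
    then have M: "M = fscale (1/2) (\<Sum>r\<in>indices n. \<Sum>s\<in>indices n. fscale (M (r, s)) (Fmat n r s))"
      using skew_eq_sum_Fmat by blast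
    have F: "Fmat n r s \<in> o_odd n" if "r \<in> indices n" "s \<in> indices n" for r s
      using that Fmat_in_o_odd by simp
    have "cfun.subspace (o_odd n)" by (simp add: o_odd_def)
    then have "fscale (1/2) (\<Sum>r\<in>indices n. \<Sum>s\<in>indices n. fscale (M (r, s)) (Fmat n r s)) \<in> o_odd n"
      by (intro cfun.subspace_scale cfun.subspace_sum F) auto
    then show "M \<in> o_odd n" using M by simp
  qed
qed

lemma mmul_apply: "mmul n M N (r, s) = (\<Sum>k\<in>indices n. M (r, k) * N (k, s))"
  by (simp add: mmul_def indices_def)

lemma skew_commutator:
  assumes M: "skew n M" and N: "skew n N"
  shows "skew n (commutator n M N)"
proof -
  have *: "mmul n A B (opp n s, opp n r) = mmul n B A (r, s)"
    if "skew n A" "skew n B" "r \<in> indices n" "s \<in> indices n" for A B r s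
  proof -
    have "mmul n A B (opp n s, opp n r) = (\<Sum>k\<in>indices n. A (opp n s, opp n k) * B (opp n k, opp n r))"
      unfolding mmul_apply by (rule sum_opp[symmetric])
    also have "\<dots> = (\<Sum>k\<in>indices n. B (r, k) * A (k, s))"
      using that(3,4) by (intro sum.cong refl) (simp add: skewD[OF that(1)] skewD[OF that(2)])
    finally show ?thesis by (simp add: mmul_apply)
  qed
  have "mmul n A B (r, s) = 0" if "skew n A" "skew n B" "r \<notin> indices n \<or> s \<notin> indices n" for A B r s
    using that unfolding skew_def mmul_apply by (intro sum.neutral) auto
  note ** = this
  show ?thesis
    unfolding skew_def[of n "commutator n M N"] unfolding commutator_def fun_diff_def
    using *[OF M N] *[OF N M] **[OF M N] **[OF N M] by simp
qed


section \<open>The conformal representation in homogeneous coordinates\<close>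

text \<open>
  The index \<open>Y 0\<close> never occurs among the coordinates; it is fixed to obtain an involution of the
  whole type.
\<close>

fun cdual :: "coord \<Rightarrow> coord" where
  "cdual (X i) = (if i = 0 then X 0 else Y i)"
| "cdual (Y i) = (if i = 0 then Y 0 else X i)"

lemma cdual_cdual [simp]: "cdual (cdual v) = v"
  by (cases v) auto

lemma cdual_coords: "v \<in> coords n \<Longrightarrow> cdual v \<in> coords n"
  by (cases v) (auto simp: coords_def)

lemma finite_coords [simp]: "finite (coords n)"
  by (simp add: coords_def)

lemma card_coords: "card (coords n) = 2 * n + 1"
proof -
  have "card (X ` {0..n} \<union> Y ` {1..n}) = card (X ` {0..n}) + card (Y ` {1..n})"
    by (rule card_Un_disjoint) auto
  then show ?thesis by (simp add: coords_def card_image inj_on_def)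
qed

definition coord_of :: "nat \<Rightarrow> nat \<Rightarrow> coord"
  where "coord_of n r = (if r \<le> n then X r else Y (r - (n+1)))"

fun index_of :: "nat \<Rightarrow> coord \<Rightarrow> nat" where
  "index_of n (X i) = i"
| "index_of n (Y i) = n+1+i"

text \<open>
  The positions \<open>n+1\<close> and \<open>2n+2\<close> belong to the origin and to the point at infinity of the quadric
  that compactifies the affine space of the coordinates.
\<close>

definition org :: "nat \<Rightarrow> nat" where "org n = n+1"
definition infty_ix :: "nat \<Rightarrow> nat" where "infty_ix n = 2*n+2"
definition finite_index :: "nat \<Rightarrow> nat \<Rightarrow> bool"
  where "finite_index n r \<longleftrightarrow> r \<in> indices n \<and> r \<noteq> org n \<and> r \<noteq> infty_ix n"

lemma index_mem [simp]: "0 \<in> indices n" "org n \<in> indices n" "infty_ix n \<in> indices n"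
  by (auto simp: indices_def org_def infty_ix_def)

lemma org_neq_infty [simp]: "org n \<noteq> infty_ix n" "infty_ix n \<noteq> org n"
  by (auto simp: org_def infty_ix_def)

lemma opp_special [simp]: "opp n (org n) = infty_ix n" "opp n (infty_ix n) = org n"
  by (simp_all add: opp_def org_def infty_ix_def)

lemma index_trichotomy: "r \<in> indices n \<Longrightarrow> r = org n \<or> r = infty_ix n \<or> finite_index n r"
  by (auto simp: finite_index_def)

lemma finite_index_iff: "finite_index n r \<longleftrightarrow> r \<le> 2*n+1 \<and> r \<noteq> n+1"
  by (auto simp: finite_index_def indices_def org_def infty_ix_def)

lemma finite_indexD: "finite_index n r \<Longrightarrow> r \<in> indices n"
  "finite_index n r \<Longrightarrow> r \<noteq> org n" "finite_index n r \<Longrightarrow> r \<noteq> infty_ix n"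
  by (auto simp: finite_index_def)

lemma coord_of_mem: "finite_index n r \<Longrightarrow> coord_of n r \<in> coords n"
  by (auto simp: finite_index_iff coord_of_def coords_def intro!: imageI)

lemma index_of_mem: "v \<in> coords n \<Longrightarrow> finite_index n (index_of n v)"
  by (auto simp: finite_index_iff coords_def)

lemma coord_of_index_of: "v \<in> coords n \<Longrightarrow> coord_of n (index_of n v) = v"
  by (auto simp: finite_index_iff coord_of_def coords_def)

lemma coord_of_inj: "finite_index n r \<Longrightarrow> finite_index n s \<Longrightarrow> coord_of n r = coord_of n s \<longleftrightarrow> r = s"
  by (auto simp: finite_index_iff coord_of_def split: if_splits)

lemma coord_of_opp: "finite_index n r \<Longrightarrow> coord_of n (opp n r) = cdual (coord_of n r)"
  by (auto simp: finite_index_iff coord_of_def opp_def)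

lemma opp_finite_index: "finite_index n r \<Longrightarrow> finite_index n (opp n r)"
  by (auto simp: finite_index_iff opp_def)

lemma opp_index_of: "v \<in> coords n \<Longrightarrow> opp n (index_of n v) = index_of n (cdual v)"
  by (auto simp: finite_index_iff opp_def coords_def)

locale conformal =
  fixes n :: nat and q p :: "coord \<Rightarrow> endo" and c :: complex
  assumes q_comm: "q v * q w = q w * q v"
    and p_comm: "p v * p w = p w * p v"
    and p_q: "p v * q w = q w * p v + (if v = w then 1 else 0)"

sublocale conformal \<subseteq> weyl_pairs "coords n" cdual q p c
  by unfold_locales (simp_all add: cdual_coords q_comm p_comm p_q)

context conformal
begin

text \<open>
  The coordinates \<open>Zh\<close> satisfy \<open>\<Sum> Zh r * Zh (opp n r) = 0\<close> and \<open>Zh (org n) = 1\<close>: they parametrise an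
  affine section of the quadric cone. The operators \<open>Ph\<close> are the derivatives with respect to the
  homogeneous coordinates, acting on functions that are homogeneous of degree \<open>-c\<close> and independent
  of the coordinate in the position \<open>infty_ix n\<close>.
\<close>

definition Zh :: "nat \<Rightarrow> endo"
  where "Zh r = (if r = org n then 1 else if r = infty_ix n then - eta else q (coord_of n r))"

definition Ph :: "nat \<Rightarrow> endo"
  where "Ph r = (if r = org n then - Dc else if r = infty_ix n then 0 else p (coord_of n r))"

definition rho :: "cmat \<Rightarrow> endo"
  where "rho M = (\<Sum>r\<in>indices n. \<Sum>s\<in>indices n. sc (M (r, s)) * (Zh r * Ph s))"

lemma Zh_comm: "Zh r * Zh s = Zh s * Zh r"
  by (auto simp: Zh_def eta_q q_comm)

lemma Zh_values [simp]:
  "Zh (org n) = 1" "Zh (infty_ix n) = - eta" "finite_index n r \<Longrightarrow> Zh r = q (coord_of n r)"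
  by (auto simp: Zh_def finite_index_def)

lemma Ph_values [simp]:
  "Ph (org n) = - Dc" "Ph (infty_ix n) = 0" "finite_index n r \<Longrightarrow> Ph r = p (coord_of n r)"
  by (auto simp: Ph_def finite_index_def)

text \<open>
  The corrections to the canonical relation express that the section of the cone is not preserved.
\<close>

lemma Ph_Zh:
  assumes "r \<in> indices n" "s \<in> indices n"
  shows "Ph r * Zh s = Zh s * Ph r + (if r = s then 1 else 0) - (if r = org n then Zh s else 0)
    - (if s = infty_ix n then Zh (opp n r) else 0)"
proof -
  have e: "Dc * eta = eta * Dc + (eta + eta)"
  proof -
    have "(2 :: endo) = 1 + 1" by simp
    then show ?thesis by (simp only: Dc_eta distrib_left mult_1_right)
  qed
  consider (a) "r = org n" | (b) "r = infty_ix n" | (d) "finite_index n r"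
    using index_trichotomy[OF assms(1)] by blast
  then show ?thesis
  proof cases
    case a
    consider "s = org n" | "s = infty_ix n" | "finite_index n s" using index_trichotomy[OF assms(2)] by blast
    then show ?thesis
    proof cases
      case 3
      have "Dc * q (coord_of n s) = q (coord_of n s) * Dc + q (coord_of n s)"
        using Dc_q[OF coord_of_mem[OF 3]] by (simp add: distrib_left)
      with 3 show ?thesis by (auto simp: a dest: finite_indexD)
    qed (simp_all add: a e)
  next
    case b
    then show ?thesis by simp
  next
    case d
    consider "s = org n" | "s = infty_ix n" | "finite_index n s" using index_trichotomy[OF assms(2)] by blast
    then show ?thesis
    proof cases
      case 1
      with d show ?thesis by (auto dest: finite_indexD)
    next
      case 2
      with d show ?thesis
        by (auto simp: opp_finite_index coord_of_opp p_eta coord_of_mem dest: finite_indexD)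
    next
      case 3
      with d show ?thesis by (auto simp: p_q coord_of_inj dest: finite_indexD)
    qed
  qed
qed

lemma Ph_comm:
  assumes "r \<in> indices n" "s \<in> indices n"
  shows "Ph r * Ph s = Ph s * Ph r + (if r = org n then Ph s else 0) - (if s = org n then Ph r else 0)"
proof -
  have p: "Dc * p v = p v * Dc - p v" if "v \<in> coords n" for v
    using Dc_p[OF that] by (simp add: algebra_simps)
  have "(r = org n \<or> r = infty_ix n \<or> finite_index n r) \<and> (s = org n \<or> s = infty_ix n \<or> finite_index n s)"
    using index_trichotomy assms by simp
  then show ?thesis
    by (elim conjE disjE) (auto simp: p[OF coord_of_mem] p_comm dest: finite_indexD)
qed

lemma mult_if: "m * (if P then x else 0) = (if P then m * x else 0)" for m x :: endo
  by simp

lemma sum_index_delta: "t \<in> indices n \<Longrightarrow> (\<Sum>s\<in>indices n. if s = t then f s else 0) = f t"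
  for f :: "nat \<Rightarrow> endo"
  by simp

text \<open>
  Passing to the opposite pair of indices gives the sum with the other sign.
\<close>

lemma skew_sum_Zh_zero:
  assumes "skew n M"
  shows "(\<Sum>r\<in>indices n. \<Sum>s\<in>indices n. sc (M (r, s)) * (Zh r * Zh (opp n s))) = 0"
proof -
  define S where "S = (\<Sum>r\<in>indices n. \<Sum>s\<in>indices n. sc (M (r, s)) * (Zh r * Zh (opp n s)))"
  have "S = (\<Sum>r\<in>indices n. \<Sum>s\<in>indices n. sc (M (opp n r, opp n s)) * (Zh (opp n r) * Zh (opp n (opp n s))))"
    unfolding S_def
    by (subst sum_opp[symmetric], rule sum.cong[OF refl], subst sum_opp[symmetric], rule refl)
  also have "\<dots> = (\<Sum>r\<in>indices n. \<Sum>s\<in>indices n. - (sc (M (s, r)) * (Zh s * Zh (opp n r))))"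
    using skewD[OF assms] by (intro sum.cong refl) (simp add: sc_hom Zh_comm)
  also have "\<dots> = (\<Sum>s\<in>indices n. \<Sum>r\<in>indices n. - (sc (M (s, r)) * (Zh s * Zh (opp n r))))"
    by (rule sum.swap)
  also have "\<dots> = - S"
    by (simp only: sum_negf S_def)
  finally have "S + S = 0" by (metis add.right_inverse)
  then have "sc (1/2) * (S + S) = 0" by simp
  then show ?thesis by (simp only: half_double S_def)
qed

text \<open>
  The first sum is the action of the matrix on homogeneous coordinates, the second one the
  rescaling that leads back to the section.
\<close>

lemma rho_Zh:
  assumes "skew n M" "t \<in> indices n"
  shows "rho M * Zh t = Zh t * rho M + (\<Sum>r\<in>indices n. sc (M (r, t)) * Zh r)
    - (\<Sum>r\<in>indices n. sc (M (r, org n)) * Zh r) * Zh t"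
proof -
  have term_eq: "sc (M (r, s)) * (Zh r * Ph s) * Zh t = Zh t * (sc (M (r, s)) * (Zh r * Ph s))
      + (if s = t then sc (M (r, s)) * Zh r else 0) - (if s = org n then sc (M (r, s)) * Zh r * Zh t else 0)
      - (if t = infty_ix n then sc (M (r, s)) * (Zh r * Zh (opp n s)) else 0)"
    if "s \<in> indices n" for r s
  proof -
    have "sc (M (r, s)) * (Zh r * Ph s) * Zh t = sc (M (r, s)) * (Zh r * (Ph s * Zh t))"
      by (simp add: mult.assoc)
    also have "\<dots> = sc (M (r, s)) * (Zh r * Zh t * Ph s)
      + (if s = t then sc (M (r, s)) * Zh r else 0) - (if s = org n then sc (M (r, s)) * Zh r * Zh t else 0)
      - (if t = infty_ix n then sc (M (r, s)) * (Zh r * Zh (opp n s)) else 0)"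
      unfolding Ph_Zh[OF that assms(2)] by (simp add: algebra_simps)
    also have "sc (M (r, s)) * (Zh r * Zh t * Ph s) = Zh t * (sc (M (r, s)) * (Zh r * Ph s))"
      by (metis Zh_comm mult.assoc sc_central)
    finally show ?thesis .
  qed
  have "rho M * Zh t = (\<Sum>r\<in>indices n. \<Sum>s\<in>indices n. Zh t * (sc (M (r, s)) * (Zh r * Ph s))
      + (if s = t then sc (M (r, s)) * Zh r else 0) - (if s = org n then sc (M (r, s)) * Zh r * Zh t else 0)
      - (if t = infty_ix n then sc (M (r, s)) * (Zh r * Zh (opp n s)) else 0))"
    unfolding rho_def sum_distrib_right by (intro sum.cong refl term_eq) simp
  also have "\<dots> = Zh t * rho M + (\<Sum>r\<in>indices n. \<Sum>s\<in>indices n. if s = t then sc (M (r, s)) * Zh r else 0)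
      - (\<Sum>r\<in>indices n. \<Sum>s\<in>indices n. if s = org n then sc (M (r, s)) * Zh r * Zh t else 0)
      - (\<Sum>r\<in>indices n. \<Sum>s\<in>indices n. if t = infty_ix n then sc (M (r, s)) * (Zh r * Zh (opp n s)) else 0)"
    by (simp only: sum.distrib sum_subtractf rho_def sum_distrib_left)
  also have "(\<Sum>r\<in>indices n. \<Sum>s\<in>indices n. if t = infty_ix n then sc (M (r, s)) * (Zh r * Zh (opp n s)) else 0) = 0"
    using skew_sum_Zh_zero[OF assms(1)] by (cases "t = infty_ix n") simp_all
  finally show ?thesis
    using assms(2) by (simp add: sum_index_delta sum_distrib_right)
qed

lemma rho_Ph:
  assumes "skew n M" "u \<in> indices n"
  shows "rho M * Ph u = Ph u * rho M - (\<Sum>s\<in>indices n. sc (M (u, s)) * Ph s)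
    + Zh (opp n u) * (\<Sum>s\<in>indices n. sc (M (infty_ix n, s)) * Ph s)
    + (\<Sum>r\<in>indices n. sc (M (r, org n)) * Zh r) * Ph u"
proof -
  have term_eq: "sc (M (r, s)) * (Zh r * Ph s) * Ph u = Ph u * (sc (M (r, s)) * (Zh r * Ph s))
      - (if r = u then sc (M (r, s)) * Ph s else 0)
      + (if r = infty_ix n then Zh (opp n u) * (sc (M (r, s)) * Ph s) else 0)
      + (if s = org n then sc (M (r, s)) * Zh r * Ph u else 0)"
    if r: "r \<in> indices n" and s: "s \<in> indices n" for r s
  proof -
    let ?m = "sc (M (r, s))"
    have ZP: "Zh r * Ph u = Ph u * Zh r - (if u = r then 1 else 0) + (if u = org n then Zh r else 0)
        + (if r = infty_ix n then Zh (opp n u) else 0)"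
      using Ph_Zh[OF assms(2) r] by (simp add: algebra_simps)
    have "Zh r * Ph s * Ph u = Zh r * (Ph s * Ph u)" by (simp add: mult.assoc)
    also have "\<dots> = (Zh r * Ph u) * Ph s + (if s = org n then Zh r * Ph u else 0)
        - (if u = org n then Zh r * Ph s else 0)"
      unfolding Ph_comm[OF s assms(2)] by (simp add: algebra_simps)
    also have "(Zh r * Ph u) * Ph s = Ph u * Zh r * Ph s - (if u = r then Ph s else 0)
        + (if u = org n then Zh r * Ph s else 0) + (if r = infty_ix n then Zh (opp n u) * Ph s else 0)"
      unfolding ZP by (simp add: algebra_simps)
    finally have eq: "?m * (Zh r * Ph s * Ph u) = ?m * (Ph u * Zh r * Ph s) - (if r = u then ?m * Ph s else 0)
        + (if r = infty_ix n then ?m * (Zh (opp n u) * Ph s) else 0)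
        + (if s = org n then ?m * Zh r * Ph u else 0)"
      by (simp only: right_diff_distrib distrib_left mult_if mult.assoc) simp
    have move: "?m * (Ph u * Zh r * Ph s) = Ph u * (?m * (Zh r * Ph s))"
      "?m * (Zh (opp n u) * Ph s) = Zh (opp n u) * (?m * Ph s)"
      by (metis mult.assoc sc_central)+
    show ?thesis using eq unfolding move by (simp only: mult.assoc)
  qed
  have "rho M * Ph u = (\<Sum>r\<in>indices n. \<Sum>s\<in>indices n. Ph u * (sc (M (r, s)) * (Zh r * Ph s))
      - (if r = u then sc (M (r, s)) * Ph s else 0)
      + (if r = infty_ix n then Zh (opp n u) * (sc (M (r, s)) * Ph s) else 0)
      + (if s = org n then sc (M (r, s)) * Zh r * Ph u else 0))"
    unfolding rho_def sum_distrib_right by (intro sum.cong refl term_eq) simp_all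
  also have "\<dots> = Ph u * rho M - (\<Sum>r\<in>indices n. \<Sum>s\<in>indices n. if r = u then sc (M (r, s)) * Ph s else 0)
      + (\<Sum>r\<in>indices n. \<Sum>s\<in>indices n. if r = infty_ix n then Zh (opp n u) * (sc (M (r, s)) * Ph s) else 0)
      + (\<Sum>r\<in>indices n. \<Sum>s\<in>indices n. if s = org n then sc (M (r, s)) * Zh r * Ph u else 0)"
    by (simp only: sum.distrib sum_subtractf rho_def sum_distrib_left)
  also have "(\<Sum>r\<in>indices n. \<Sum>s\<in>indices n. if r = u then sc (M (r, s)) * Ph s else 0)
      = (\<Sum>s\<in>indices n. sc (M (u, s)) * Ph s)"
    by (subst sum.swap) (use assms(2) in \<open>simp add: sum_index_delta\<close>)
  also have "(\<Sum>r\<in>indices n. \<Sum>s\<in>indices n. if r = infty_ix n then Zh (opp n u) * (sc (M (r, s)) * Ph s) else 0)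
      = Zh (opp n u) * (\<Sum>s\<in>indices n. sc (M (infty_ix n, s)) * Ph s)"
    by (subst sum.swap) (simp add: sum_index_delta sum_distrib_left)
  also have "(\<Sum>r\<in>indices n. \<Sum>s\<in>indices n. if s = org n then sc (M (r, s)) * Zh r * Ph u else 0)
      = (\<Sum>r\<in>indices n. sc (M (r, org n)) * Zh r) * Ph u"
    by (simp add: sum_index_delta sum_distrib_right)
  finally show ?thesis .
qed

lemma rho_mmul:
  "rho (mmul n M N) = (\<Sum>t\<in>indices n. \<Sum>u\<in>indices n. sc (N (t, u)) * ((\<Sum>r\<in>indices n. sc (M (r, t)) * Zh r) * Ph u))"
    (is "_ = ?A")
  "rho (mmul n N M) = (\<Sum>t\<in>indices n. \<Sum>u\<in>indices n. sc (N (t, u)) * (Zh t * (\<Sum>s\<in>indices n. sc (M (u, s)) * Ph s)))"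
    (is "_ = ?B")
proof -
  have sc_sum: "sc (\<Sum>i\<in>I. f i) = (\<Sum>i\<in>I. sc (f i))" for f :: "nat \<Rightarrow> complex" and I
    by (induction I rule: infinite_finite_induct) (simp_all add: sc_hom)
  have "rho (mmul n M N) = (\<Sum>r\<in>indices n. \<Sum>u\<in>indices n. \<Sum>t\<in>indices n. sc (M (r, t)) * sc (N (t, u)) * (Zh r * Ph u))"
    by (simp only: rho_def mmul_apply sc_sum sc_hom sum_distrib_right)
  also have "\<dots> = (\<Sum>r\<in>indices n. \<Sum>t\<in>indices n. \<Sum>u\<in>indices n. sc (M (r, t)) * sc (N (t, u)) * (Zh r * Ph u))"
    by (intro sum.cong refl sum.swap)
  also have "\<dots> = (\<Sum>t\<in>indices n. \<Sum>r\<in>indices n. \<Sum>u\<in>indices n. sc (M (r, t)) * sc (N (t, u)) * (Zh r * Ph u))"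
    by (rule sum.swap)
  also have "\<dots> = (\<Sum>t\<in>indices n. \<Sum>u\<in>indices n. \<Sum>r\<in>indices n. sc (M (r, t)) * sc (N (t, u)) * (Zh r * Ph u))"
    by (intro sum.cong refl sum.swap)
  also have "\<dots> = ?A"
    unfolding sum_distrib_left sum_distrib_right
    by (intro sum.cong refl) (metis mult.assoc sc_central)
  finally show "rho (mmul n M N) = ?A" .
  have "rho (mmul n N M) = (\<Sum>t\<in>indices n. \<Sum>s\<in>indices n. \<Sum>u\<in>indices n. sc (N (t, u)) * sc (M (u, s)) * (Zh t * Ph s))"
    by (simp only: rho_def mmul_apply sc_sum sc_hom sum_distrib_right)
  also have "\<dots> = (\<Sum>t\<in>indices n. \<Sum>u\<in>indices n. \<Sum>s\<in>indices n. sc (N (t, u)) * sc (M (u, s)) * (Zh t * Ph s))"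
    by (intro sum.cong refl sum.swap)
  also have "\<dots> = ?B"
    unfolding sum_distrib_left sum_distrib_right
    by (intro sum.cong refl) (metis mult.assoc sc_central)
  finally show "rho (mmul n N M) = ?B" .
qed

lemma rho_add: "rho (M + N) = rho M + rho N"
  by (simp add: rho_def sc_hom algebra_simps sum.distrib)

lemma rho_scale: "rho (fscale k M) = sc k * rho M"
  by (simp add: rho_def sc_hom mult.assoc sum_distrib_left)

lemma rho_diff: "rho (M - N) = rho M - rho N"
  using rho_add[of "M - N" N] by simp

text \<open>
  The corrections in \<open>rho_Zh\<close> and \<open>rho_Ph\<close> disappear: multiplication by \<open>phi\<close> commutes with the
  coordinates and occurs with both signs, and the term with \<open>G\<close> carries the factor
  \<open>\<Sum> N(t,u) Z\<^sub>t Z\<^sub>u\<^sub>'\<close>, which is zero because \<open>N\<close> is skew.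
\<close>

lemma rho_commutator:
  assumes M: "skew n M" and N: "skew n N"
  shows "rho (commutator n M N) = rho M * rho N - rho N * rho M"
proof -
  define phi where "phi = (\<Sum>r\<in>indices n. sc (M (r, org n)) * Zh r)"
  define G where "G = (\<Sum>s\<in>indices n. sc (M (infty_ix n, s)) * Ph s)"
  define A where "A t = (\<Sum>r\<in>indices n. sc (M (r, t)) * Zh r)" for t
  define B where "B u = (\<Sum>s\<in>indices n. sc (M (u, s)) * Ph s)" for u
  have phi_Zh: "Zh t * phi = phi * Zh t" for t
    unfolding phi_def sum_distrib_left sum_distrib_right
    by (intro sum.cong refl) (metis mult.assoc sc_central Zh_comm)
  have term_eq: "rho M * (sc (N (t, u)) * (Zh t * Ph u)) = sc (N (t, u)) * (Zh t * Ph u) * rho M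
      + sc (N (t, u)) * (A t * Ph u) - sc (N (t, u)) * (Zh t * B u)
      + sc (N (t, u)) * (Zh t * Zh (opp n u)) * G"
    if t: "t \<in> indices n" and u: "u \<in> indices n" for t u
  proof -
    have Z: "rho M * Zh t = Zh t * rho M + A t - phi * Zh t"
      using rho_Zh[OF M t] by (simp add: A_def phi_def)
    have P: "rho M * Ph u = Ph u * rho M - B u + Zh (opp n u) * G + phi * Ph u"
      using rho_Ph[OF M u] by (simp add: B_def G_def phi_def)
    have "rho M * (sc (N (t, u)) * (Zh t * Ph u)) = sc (N (t, u)) * ((rho M * Zh t) * Ph u)"
      by (metis mult.assoc sc_central)
    also have "(rho M * Zh t) * Ph u = Zh t * (rho M * Ph u) + A t * Ph u - phi * Zh t * Ph u"
      by (simp add: Z algebra_simps)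
    also have "Zh t * (rho M * Ph u) = Zh t * Ph u * rho M - Zh t * B u + Zh t * Zh (opp n u) * G
        + Zh t * phi * Ph u"
      by (simp add: P algebra_simps)
    finally show ?thesis by (simp add: phi_Zh algebra_simps)
  qed
  have mmulA: "rho (mmul n M N) = (\<Sum>t\<in>indices n. \<Sum>u\<in>indices n. sc (N (t, u)) * (A t * Ph u))"
    and mmulB: "rho (mmul n N M) = (\<Sum>t\<in>indices n. \<Sum>u\<in>indices n. sc (N (t, u)) * (Zh t * B u))"
    unfolding A_def B_def by (rule rho_mmul)+
  have "rho M * rho N = (\<Sum>t\<in>indices n. \<Sum>u\<in>indices n. sc (N (t, u)) * (Zh t * Ph u) * rho M
      + sc (N (t, u)) * (A t * Ph u) - sc (N (t, u)) * (Zh t * B u)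
      + sc (N (t, u)) * (Zh t * Zh (opp n u)) * G)"
    unfolding rho_def[of N] sum_distrib_left by (intro sum.cong refl term_eq) simp_all
  also have "\<dots> = rho N * rho M + rho (mmul n M N) - rho (mmul n N M)
      + (\<Sum>t\<in>indices n. \<Sum>u\<in>indices n. sc (N (t, u)) * (Zh t * Zh (opp n u))) * G"
    unfolding mmulA mmulB
    unfolding sum.distrib sum_subtractf by (simp only: rho_def[of N] sum_distrib_right)
  finally show ?thesis
    unfolding skew_sum_Zh_zero[OF N] by (simp add: commutator_def rho_diff)
qed

end


section \<open>Invariant subspaces\<close>

definition preserves :: "cfunction set \<Rightarrow> endo \<Rightarrow> bool"
  where "preserves W T \<longleftrightarrow> (\<forall>f\<in>W. app T f \<in> W)"

lemma preservesD: "preserves W T \<Longrightarrow> f \<in> W \<Longrightarrow> app T f \<in> W"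
  by (simp add: preserves_def)

lemma preserves_mult: "preserves W S \<Longrightarrow> preserves W T \<Longrightarrow> preserves W (S * T)"
  by (simp add: preserves_def app_ring_operations)

lemma
  assumes W: "cfun.subspace W"
  shows preserves_zero: "preserves W 0"
    and preserves_add: "preserves W S \<Longrightarrow> preserves W T \<Longrightarrow> preserves W (S + T)"
    and preserves_diff: "preserves W S \<Longrightarrow> preserves W T \<Longrightarrow> preserves W (S - T)"
    and preserves_uminus: "preserves W T \<Longrightarrow> preserves W (- T)"
  using W by (simp_all add: preserves_def app_ring_operations cfun.subspace_0 cfun.subspace_add
      cfun.subspace_diff cfun.subspace_neg)

lemma preserves_sc: "cfun.subspace W \<Longrightarrow> W \<subseteq> exp_poly_space \<Longrightarrow> preserves W (sc k)"
  by (auto simp: preserves_def app_sc cfun.subspace_scale subset_iff)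

lemma preserves_one: "W \<subseteq> exp_poly_space \<Longrightarrow> preserves W 1"
  by (auto simp: preserves_def app_one subset_iff)

lemma preserves_sum:
  "cfun.subspace W \<Longrightarrow> (\<And>i. i \<in> I \<Longrightarrow> preserves W (T i)) \<Longrightarrow> preserves W (\<Sum>i\<in>I. T i)"
  by (simp add: preserves_def app_sum cfun.subspace_sum)

lemma (in conformal) rho_Emat:
  assumes "r \<in> indices n" "s \<in> indices n"
  shows "rho (Emat r s) = Zh r * Ph s"
proof -
  have "sc (Emat r s (a, b)) * (Zh a * Ph b) = (if s = b then if r = a then Zh a * Ph b else 0 else 0)" for a b
    by (auto simp: Emat_def sc_hom)
  then show ?thesis
    using assms by (simp add: rho_def)
qed

lemma (in conformal) rho_Fmat:
  assumes "r \<in> indices n" "s \<in> indices n"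
  shows "rho (Fmat n r s) = Zh r * Ph s - Zh (opp n s) * Ph (opp n r)"
  using assms by (simp add: Fmat_def rho_diff rho_Emat)

lemma (in conformal)
  assumes "v \<in> coords n"
  shows Zh_index_of: "Zh (index_of n v) = q v" and Ph_index_of: "Ph (index_of n v) = p v"
  using index_of_mem[OF assms] coord_of_index_of[OF assms] by simp_all

text \<open>
  Translations, the shifted Euler operator, special conformal operators and rotations.
\<close>

lemma (in conformal) rho_generators:
  assumes "v \<in> coords n" "w \<in> coords n"
  shows "rho (Fmat n (org n) (index_of n v)) = p v"
    and "rho (Fmat n (org n) (org n)) = - Dc"
    and "rho (Fmat n (index_of n v) (org n)) = - J v"
    and "rho (Fmat n (index_of n v) (index_of n w)) = q v * p w - q (cdual w) * p (cdual v)"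
  using assms finite_indexD(1)[OF index_of_mem]
  by (simp_all add: rho_Fmat Zh_index_of Ph_index_of opp_index_of cdual_coords J_def)


section \<open>The differential operators form a representation\<close>

lemma sum_coords: "(\<Sum>v\<in>coords n. f v) = (\<Sum>r=0..n. f (X r)) + (\<Sum>r=1..n. f (Y r))"
  for f :: "coord \<Rightarrow> 'b::comm_monoid_add"
  unfolding coords_def
  by (subst sum.union_disjoint) (auto simp: sum.reindex inj_on_def)

text \<open>
  Operators \<open>qo\<close> and \<open>po\<close> on arbitrary functions that represent the Weyl generators on the space of
  exponential polynomials.
\<close>

locale realisation = conformal +
  fixes qo po :: "coord \<Rightarrow> coperator"
  assumes app_q: "f \<in> exp_poly_space \<Longrightarrow> app (q v) f = qo v f"
    and app_p: "f \<in> exp_poly_space \<Longrightarrow> app (p v) f = po v f"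
begin

lemma qo_in_space [simp]: "f \<in> exp_poly_space \<Longrightarrow> qo v f \<in> exp_poly_space"
  using app_in_space[of f "q v"] by (simp add: app_q)

lemma po_in_space [simp]: "f \<in> exp_poly_space \<Longrightarrow> po v f \<in> exp_poly_space"
  using app_in_space[of f "p v"] by (simp add: app_p)

lemma D_op_eq: "f \<in> exp_poly_space \<Longrightarrow> D_op n qo po f = app D f"
  by (simp add: D_op_def D_def app_sum app_ring_operations app_q app_p sum_coords sum_fun_apply)

lemma Dc_op_eq: "f \<in> exp_poly_space \<Longrightarrow> Dc_op n qo po c f = app Dc f"
  by (simp add: Dc_op_def Dc_def D_op_eq app_ring_operations app_sc oscale_def)

lemma eta_op_eq:
  assumes f: "f \<in> exp_poly_space"
  shows "eta_op n qo f = app eta f"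
proof -
  have swap: "qo v (qo w f) = qo w (qo v f)" for v w
    using arg_cong[OF q_comm[of v w], of "\<lambda>T. app T f"] f by (simp add: app_ring_operations app_q)
  have "(\<Sum>v\<in>coords n. app (q v * q (cdual v)) f)
      = qo (X 0) (qo (X 0) f) + (\<Sum>i=1..n. qo (X i) (qo (Y i) f)) + (\<Sum>i=1..n. qo (Y i) (qo (X i) f))"
    using f by (simp add: sum_coords app_ring_operations app_q sum.atLeast_Suc_atMost)
  also have "(\<Sum>i=1..n. qo (Y i) (qo (X i) f)) = (\<Sum>i=1..n. qo (X i) (qo (Y i) f))"
    by (intro sum.cong refl swap)
  finally show ?thesis
    using f by (simp add: eta_def eta_op_def app_ring_operations app_sc app_sum oscale_def
        sum_fun_apply fun_eq_iff cfun.subspace_sum algebra_simps)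
qed

lemma pi_op_scale: "pi_op n qo po c (fscale k M) = oscale k (pi_op n qo po c M)"
proof -
  have scale: "oscale (k * a) T = oscale k (oscale a T)" for a T
    by (auto simp: oscale_def fun_eq_iff)
  have sum: "(\<Sum>i\<in>I. oscale k (T i)) = oscale k (\<Sum>i\<in>I. T i)" for I :: "nat set" and T
    by (auto simp: oscale_def fun_eq_iff sum_fun_apply sum_distrib_left)
  have add: "oscale k S + oscale k T = oscale k (S + T)" for S T
    by (auto simp: oscale_def fun_eq_iff algebra_simps)
  show ?thesis
    unfolding pi_op_def fscale_apply scale sum add ..
qed

definition agrees :: "cmat \<Rightarrow> bool"
  where "agrees M \<longleftrightarrow> (\<forall>f\<in>exp_poly_space. pi_op n qo po c M f = app (rho M) f)"

lemma subspace_agrees: "cfun.subspace {M. agrees M}"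
proof -
  have "rho 0 = 0" using rho_scale[of 0 0] by (simp add: sc_hom fscale_def zero_fun_def)
  then show ?thesis
    by (auto simp: cfun.subspace_def agrees_def pi_op_zero pi_op_add pi_op_scale rho_add rho_scale
        app_ring_operations app_sc oscale_def)
qed

lemma finite_coordinate_values:
  assumes "i \<in> {1..n}"
  shows "i \<in> indices n" "n+1+i \<in> indices n" "opp n i = n+1+i" "opp n (n+1+i) = i"
    "Zh i = q (X i)" "Ph i = p (X i)" "Zh (n+1+i) = q (Y i)" "Ph (n+1+i) = p (Y i)"
proof -
  have "X i \<in> coords n" "Y i \<in> coords n" using assms by (auto simp: coords_def)
  from Zh_index_of[OF this(1)] Ph_index_of[OF this(1)] Zh_index_of[OF this(2)] Ph_index_of[OF this(2)]
  show "Zh i = q (X i)" "Ph i = p (X i)" "Zh (n+1+i) = q (Y i)" "Ph (n+1+i) = p (Y i)" by simp_all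
qed (use assms in \<open>auto simp: indices_def opp_def\<close>)

lemma zero_coordinate_values: "opp n 0 = 0" "Zh 0 = q (X 0)" "Ph 0 = p (X 0)"
proof -
  have "X 0 \<in> coords n" by (auto simp: coords_def)
  from Zh_index_of[OF this] Ph_index_of[OF this] show "Zh 0 = q (X 0)" "Ph 0 = p (X 0)" by simp_all
qed (simp add: opp_def)

lemma agrees_iff_Fmat:
  assumes "r \<in> indices n" "s \<in> indices n"
  shows "agrees (Fmat n r s) \<longleftrightarrow> (\<forall>f\<in>exp_poly_space.
    pi_op n qo po c (Fmat n r s) f = app (Zh r * Ph s - Zh (opp n s) * Ph (opp n r)) f)"
  by (simp add: agrees_def rho_Fmat[OF assms])

lemmas app_expand = app_ring_operations app_q app_p Dc_op_eq eta_op_eq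

lemma agrees_Amat:
  assumes ij: "i \<in> {1..n+1}" "j \<in> {1..n+1}"
  shows "agrees (Amat n i j)"
proof -
  have mem: "i \<in> indices n" "j \<in> indices n" using ij by (auto simp: indices_def)
  have "(i \<in> {1..n} \<or> i = org n) \<and> (j \<in> {1..n} \<or> j = org n)"
    using ij by (auto simp: org_def)
  then have "\<forall>f\<in>exp_poly_space. A_op n qo po c i j f = app (Zh i * Ph j - Zh (opp n j) * Ph (opp n i)) f"
  proof (elim conjE disjE)
    assume i: "i \<in> {1..n}" and j: "j \<in> {1..n}"
    then have "i \<le> n" "j \<le> n" by auto
    then show ?thesis
      unfolding finite_coordinate_values[OF i] finite_coordinate_values[OF j]
      by (simp add: A_op_def app_expand)
  next
    assume i: "i \<in> {1..n}" and j: "j = org n"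
    then have "i \<le> n" "\<not> org n \<le> n" by (auto simp: org_def)
    then show ?thesis
      unfolding finite_coordinate_values[OF i] j
      by (simp add: A_op_def app_expand)
  next
    assume i: "i = org n" and j: "j \<in> {1..n}"
    then have "\<not> org n \<le> n" "j \<le> n" by (auto simp: org_def)
    then show ?thesis
      unfolding finite_coordinate_values[OF j] i
      by (simp add: A_op_def app_expand app_one)
  next
    assume i: "i = org n" and j: "j = org n"
    have "\<not> org n \<le> n" by (simp add: org_def)
    then show ?thesis
      unfolding i j by (simp add: A_op_def app_expand app_one)
  qed
  then show ?thesis
    unfolding Amat_eq_Fmat[OF ij] agrees_iff_Fmat[OF mem]
    using pi_op_Amat[OF ij, of qo po c] Amat_eq_Fmat[OF ij] by simp
qed

lemma agrees_uminus: "agrees M \<Longrightarrow> agrees (- M)"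
  using cfun.subspace_neg[OF subspace_agrees, of M] by simp

lemma agrees_zero: "agrees 0"
  using cfun.subspace_0[OF subspace_agrees] by simp

lemma agrees_Bmat:
  assumes ij: "i \<in> {1..n+1}" "j \<in> {1..n+1}"
  shows "agrees (Bmat n i j)"
proof -
  have swap: "Bmat n a b = - Bmat n b a" for a b by (simp add: Bmat_def)
  have last: "agrees (Bmat n i (n+1))" if i: "i \<in> {1..n}" for i
  proof -
    have "\<forall>f\<in>exp_poly_space. pi_op n qo po c (Bmat n i (n+1)) f = app (Zh i * Ph (infty_ix n) - Zh (org n) * Ph (opp n i)) f"
      unfolding pi_op_Bmat_last[OF i] finite_coordinate_values[OF i]
      by (simp add: app_expand app_one)
    moreover have "Bmat n i (n+1) = Fmat n i (infty_ix n)"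
      using i Bmat_eq_Fmat[of i n "n+1"] by (simp add: infty_ix_def mult_2)
    ultimately show ?thesis
      using agrees_iff_Fmat[OF finite_coordinate_values(1)[OF i], of "infty_ix n"] by simp
  qed
  have "(i \<in> {1..n} \<or> i = n+1) \<and> (j \<in> {1..n} \<or> j = n+1)"
    using ij by auto
  then show ?thesis
  proof (elim conjE disjE)
    assume i: "i \<in> {1..n}" and j: "j \<in> {1..n}"
    have "\<forall>f\<in>exp_poly_space. pi_op n qo po c (Bmat n i j) f
        = app (Zh i * Ph (n+1+j) - Zh (opp n (n+1+j)) * Ph (opp n i)) f"
      unfolding pi_op_Bmat[OF i j] finite_coordinate_values[OF i] finite_coordinate_values[OF j]
      by (simp add: app_expand)
    then show ?thesis
      using agrees_iff_Fmat[OF finite_coordinate_values(1)[OF i] finite_coordinate_values(2)[OF j]]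
      unfolding Bmat_eq_Fmat[OF ij] by simp
  next
    assume "i \<in> {1..n}" "j = n+1"
    then show ?thesis using last by simp
  next
    assume "i = n+1" "j \<in> {1..n}"
    then show ?thesis using agrees_uminus[OF last[of j]] swap[of i j] by simp
  next
    assume "i = n+1" "j = n+1"
    then have "Bmat n i j = 0" by (simp add: Bmat_def)
    then show ?thesis using agrees_zero by simp
  qed
qed

lemma agrees_Cmat:
  assumes ij: "i \<in> {1..n+1}" "j \<in> {1..n+1}"
  shows "agrees (Cmat n i j)"
proof -
  have swap: "Cmat n a b = - Cmat n b a" for a b by (simp add: Cmat_def)
  have last: "agrees (Cmat n (n+1) i)" if i: "i \<in> {1..n}" for i
  proof -
    have "\<forall>f\<in>exp_poly_space. pi_op n qo po c (Cmat n (n+1) i) f = app (Zh (infty_ix n) * Ph i - Zh (opp n i) * Ph (org n)) f"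
      unfolding pi_op_Cmat_last[OF i] finite_coordinate_values[OF i]
      by (simp add: app_expand)
    moreover have "Cmat n (n+1) i = Fmat n (infty_ix n) i"
      using i Cmat_eq_Fmat[of "n+1" n i] by (simp add: infty_ix_def mult_2)
    ultimately show ?thesis
      using agrees_iff_Fmat[OF _ finite_coordinate_values(1)[OF i], of "infty_ix n"] by simp
  qed
  have "(i \<in> {1..n} \<or> i = n+1) \<and> (j \<in> {1..n} \<or> j = n+1)"
    using ij by auto
  then show ?thesis
  proof (elim conjE disjE)
    assume i: "i \<in> {1..n}" and j: "j \<in> {1..n}"
    have "\<forall>f\<in>exp_poly_space. pi_op n qo po c (Cmat n i j) f
        = app (Zh (n+1+i) * Ph j - Zh (opp n j) * Ph (opp n (n+1+i))) f"
      unfolding pi_op_Cmat[OF i j] finite_coordinate_values[OF i] finite_coordinate_values[OF j]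
      by (simp add: app_expand)
    then show ?thesis
      using agrees_iff_Fmat[OF finite_coordinate_values(2)[OF i] finite_coordinate_values(1)[OF j]]
      unfolding Cmat_eq_Fmat[OF ij] by simp
  next
    assume "i = n+1" "j \<in> {1..n}"
    then show ?thesis using last by simp
  next
    assume "i \<in> {1..n}" "j = n+1"
    then show ?thesis using agrees_uminus[OF last[of i]] swap[of i j] by simp
  next
    assume "i = n+1" "j = n+1"
    then have "Cmat n i j = 0" by (simp add: Cmat_def)
    then show ?thesis using agrees_zero by simp
  qed
qed

lemma agrees_Kmat:
  assumes k: "k \<in> {1..2*n+2}"
  shows "agrees (Kmat n k)"
proof -
  have mem: "k \<in> indices n" using k by (auto simp: indices_def)
  have "k \<in> {1..n} \<or> k = n+1 \<or> (\<exists>i\<in>{1..n}. k = n+1+i) \<or> k = 2*n+2"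
  proof -
    have "k \<in> {1..n} \<or> k = n+1 \<or> (k - (n+1) \<in> {1..n} \<and> k = n+1+(k-(n+1))) \<or> k = 2*n+2"
      using k by auto
    then show ?thesis by blast
  qed
  then have "\<forall>f\<in>exp_poly_space. K_op n qo po c k f = app (Zh 0 * Ph k - Zh (opp n k) * Ph 0) f"
  proof (elim disjE bexE)
    assume i: "k \<in> {1..n}"
    then have "k \<le> n" by auto
    then show ?thesis
      unfolding finite_coordinate_values[OF i] zero_coordinate_values
      by (simp add: K_op_def app_expand)
  next
    assume i: "k = n+1"
    have "Zh 0 * Ph k - Zh (opp n k) * Ph 0 = q (X 0) * - Dc + eta * p (X 0)"
      using Ph_values(1) Zh_values(2) opp_special(1)[of n] i
      unfolding zero_coordinate_values by (simp add: org_def)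
    then show ?thesis
      using i by (simp add: K_op_def app_expand)
  next
    fix i assume i: "i \<in> {1..n}" and k: "k = n+1+i"
    show ?thesis
      unfolding k finite_coordinate_values[OF i] zero_coordinate_values
      using i by (simp add: K_op_def app_expand)
  next
    assume i: "k = 2*n+2"
    have "Zh 0 * Ph k - Zh (opp n k) * Ph 0 = - p (X 0)"
      using Ph_values(2) Zh_values(1) opp_special(2)[of n] i
      unfolding zero_coordinate_values by (simp add: infty_ix_def)
    then show ?thesis
      using i by (simp add: K_op_def app_expand)
  qed
  then show ?thesis
    unfolding Kmat_eq_Fmat[OF k] agrees_iff_Fmat[OF index_mem(1) mem]
    using pi_op_Kmat[OF k, of qo po c] Kmat_eq_Fmat[OF k] zero_coordinate_values(1) by simp
qed

text \<open>
  Both sides are linear in the matrix, and so it is enough to compare them on the generators.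
\<close>

lemma pi_op_eq_rho:
  assumes "M \<in> o_odd n" "f \<in> exp_poly_space"
  shows "pi_op n qo po c M f = app (rho M) f"
proof -
  have "o_even n \<subseteq> {M. agrees M}"
    unfolding o_even_def using agrees_Amat agrees_Bmat agrees_Cmat
    by (intro cfun.span_minimal subspace_agrees) blast
  then have "o_odd n \<subseteq> {M. agrees M}"
    unfolding o_odd_def using agrees_Kmat
    by (intro cfun.span_minimal subspace_agrees) blast
  then show ?thesis using assms by (auto simp: agrees_def)
qed

context
  fixes V :: "cfunction set"
  assumes V: "cfun.subspace V" "V \<subseteq> exp_poly_space"
begin

lemma preserves_rho:
  assumes q: "\<And>v. v \<in> coords n \<Longrightarrow> preserves V (q v)" and p: "\<And>v. v \<in> coords n \<Longrightarrow> preserves V (p v)"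
  shows "preserves V (rho M)"
proof -
  note closed = preserves_add[OF V(1)] preserves_uminus[OF V(1)] preserves_sum[OF V(1)] preserves_mult
    preserves_sc[OF V] preserves_zero[OF V(1)] preserves_one[OF V(2)]
  have "preserves V eta" unfolding eta_def by (intro closed q cdual_coords)
  then have Z: "preserves V (Zh r)" if "r \<in> indices n" for r
    using index_trichotomy[OF that] coord_of_mem[of n r] q by (auto intro!: closed)
  have "preserves V Dc" unfolding Dc_def D_def by (intro closed q p)
  then have P: "preserves V (Ph r)" if "r \<in> indices n" for r
    using index_trichotomy[OF that] coord_of_mem[of n r] p by (auto intro!: closed)
  show ?thesis unfolding rho_def by (intro closed Z P)
qed

lemma lie_representation_pi_op:
  assumes "\<And>M. M \<in> o_odd n \<Longrightarrow> preserves V (rho M)"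
  shows "lie_representation (o_odd n) (commutator n) V (pi_op n qo po c)"
proof -
  have E: "v \<in> exp_poly_space" if "v \<in> V" for v using V that by auto
  have span: "cfun.subspace (o_odd n)" by (simp add: o_odd_def)
  have comm: "commutator n M N \<in> o_odd n" if "M \<in> o_odd n" "N \<in> o_odd n" for M N
    using that skew_commutator by (auto simp: o_odd_eq_skew)
  have br: "rho (commutator n M N) = rho M * rho N - rho N * rho M" if "M \<in> o_odd n" "N \<in> o_odd n" for M N
    using that rho_commutator by (auto simp: o_odd_eq_skew)
  show ?thesis
    unfolding lie_representation_def
    using V(1) assms
    by (simp add: pi_op_eq_rho E preserves_def app_add app_scale cfun.subspace_add cfun.subspace_scale
        cfun.subspace_add[OF span] cfun.subspace_scale[OF span] rho_add rho_scale comm br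
        app_ring_operations app_sc)
qed

text \<open>
  This is all the information on an invariant subspace that the irreducibility proofs use.
\<close>

lemma invariant_preserves:
  assumes inv: "\<And>M w. M \<in> o_odd n \<Longrightarrow> w \<in> V \<Longrightarrow> pi_op n qo po c M w \<in> V"
    and v: "v \<in> coords n" "w \<in> coords n"
  shows "preserves V (p v)" "preserves V Dc" "preserves V (J v)"
    "preserves V (q v * p w - q (cdual w) * p (cdual v))"
proof -
  have F: "preserves V (rho (Fmat n r s))" if "r \<in> indices n" "s \<in> indices n" for r s
    unfolding preserves_def
  proof
    fix f assume f: "f \<in> V"
    have "Fmat n r s \<in> o_odd n" using that by (rule Fmat_in_o_odd)
    then show "app (rho (Fmat n r s)) f \<in> V"
      using inv[of "Fmat n r s" f] pi_op_eq_rho[of "Fmat n r s" f] f V(2) by auto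
  qed
  note ix = finite_indexD(1)[OF index_of_mem]
  note neg = preserves_uminus[OF V(1), of "- _", simplified]
  show "preserves V (p v)" using F[OF index_mem(2) ix[OF v(1)]] by (simp add: rho_generators(1)[OF v])
  show "preserves V Dc"
    using neg[of Dc] F[OF index_mem(2) index_mem(2)] by (simp add: rho_generators(2)[OF v])
  show "preserves V (J v)"
    using neg[of "J v"] F[OF ix[OF v(1)] index_mem(2)] by (simp add: rho_generators(3)[OF v])
  show "preserves V (q v * p w - q (cdual w) * p (cdual v))"
    using F[OF ix[OF v(1)] ix[OF v(2)]] by (simp add: rho_generators(4)[OF v])
qed

end

end


section \<open>Modules of exponential polynomials\<close>

definition exp_module :: "nat \<Rightarrow> (coord \<Rightarrow> complex) \<Rightarrow> cfunction set"
  where "exp_module n \<alpha> = cfun.span (range (exp_monomial (coords n) \<alpha>))"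

definition q0 :: "coord \<Rightarrow> endo" where "q0 v = endo_of (mult_op v)"
definition p0 :: "coord \<Rightarrow> endo" where "p0 v = endo_of (partial_op v)"

lemma app_q0: "f \<in> exp_poly_space \<Longrightarrow> app (q0 v) f = mult_op v f"
  unfolding q0_def
  by (subst app_endo_of) (auto simp: linear_on_space_def mult_op_in_space mult_op_add mult_op_scale)

lemma app_p0: "f \<in> exp_poly_space \<Longrightarrow> app (p0 v) f = partial_op v f"
  unfolding p0_def
  by (subst app_endo_of)
    (auto simp: linear_on_space_def partial_op_in_space partial_op_add partial_op_scale)

lemma q0_comm: "q0 v * q0 w = q0 w * q0 v"
  by (rule endo_eqI) (simp add: app_ring_operations app_q0 mult_op_in_space, simp add: mult_op_def fun_eq_iff)

lemma p0_comm: "p0 v * p0 w = p0 w * p0 v"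
  by (rule endo_eqI) (simp add: app_ring_operations app_p0 partial_op_in_space partial_op_commute)

lemma p0_q0: "p0 v * q0 w = q0 w * p0 v + (if v = w then 1 else 0)"
  by (rule endo_eqI)
    (simp add: app_ring_operations app_p0 app_q0 partial_op_in_space mult_op_in_space partial_op_mult_op app_one)

lemma subspace_exp_module [simp]: "cfun.subspace (exp_module n \<alpha>)"
  by (simp add: exp_module_def)

lemma exp_module_subset: "exp_module n \<alpha> \<subseteq> exp_poly_space"
  unfolding exp_module_def by (rule cfun.span_minimal) auto

lemma exp_monomial_in_module [simp]: "exp_monomial (coords n) \<alpha> m \<in> exp_module n \<alpha>"
  by (simp add: exp_module_def cfun.span_base)

lemma app_q0_exp_monomial:
  "v \<in> coords n \<Longrightarrow> app (q0 v) (exp_monomial (coords n) \<alpha> m) = exp_monomial (coords n) \<alpha> (m(v := Suc (m v)))"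
  by (simp add: app_q0 mult_op_exp_monomial)

lemma app_p0_exp_monomial:
  "v \<in> coords n \<Longrightarrow> app (p0 v) (exp_monomial (coords n) \<alpha> m) =
    fscale (of_nat (m v)) (exp_monomial (coords n) \<alpha> (m(v := m v - 1))) + fscale (\<alpha> v) (exp_monomial (coords n) \<alpha> m)"
  by (simp add: app_p0 partial_op_exp_monomial)

lemma app_span:
  assumes "f \<in> cfun.span B" "B \<subseteq> exp_poly_space" "cfun.subspace U"
    and "\<And>b. b \<in> B \<Longrightarrow> app T b \<in> U"
  shows "app T f \<in> U"
proof -
  have "cfun.subspace {f \<in> exp_poly_space. app T f \<in> U}"
    using assms(3) subspace_exp_poly_space
    unfolding cfun.subspace_def by (auto simp: app_add app_scale)
  then have "cfun.span B \<subseteq> {f \<in> exp_poly_space. app T f \<in> U}"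
    using assms(2,4) by (intro cfun.span_minimal) auto
  then show ?thesis using assms(1) by blast
qed

lemma preserves_exp_module:
  assumes "\<And>m. app T (exp_monomial (coords n) \<alpha> m) \<in> exp_module n \<alpha>"
  shows "preserves (exp_module n \<alpha>) T"
  unfolding preserves_def
proof
  fix f assume "f \<in> exp_module n \<alpha>"
  then have "f \<in> cfun.span (range (exp_monomial (coords n) \<alpha>))" by (simp add: exp_module_def)
  then show "app T f \<in> exp_module n \<alpha>"
    by (rule app_span) (use assms in auto)
qed

lemma exp_module_preserves_q0: "v \<in> coords n \<Longrightarrow> preserves (exp_module n \<alpha>) (q0 v)"
  by (rule preserves_exp_module) (simp add: app_q0_exp_monomial)

lemma exp_module_preserves_p0: "v \<in> coords n \<Longrightarrow> preserves (exp_module n \<alpha>) (p0 v)"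
  by (rule preserves_exp_module)
    (simp add: app_p0_exp_monomial cfun.subspace_add cfun.subspace_scale)

text \<open>
  An explicit linear combination of the generators is regrouped along the values of \<open>g\<close>.
\<close>

lemma span_group_by:
  assumes "f \<in> cfun.span (range e)"
  shows "\<exists>I F. finite I \<and> I \<subseteq> range g \<and> f = (\<Sum>i\<in>I. F i) \<and> (\<forall>i\<in>I. F i \<in> cfun.span (e ` {m. g m = i}))"
proof -
  have "\<exists>S c. finite S \<and> f = (\<Sum>m\<in>S. fscale (c m) (e m))"
  proof -
    obtain t r where tr: "finite t" "t \<subseteq> range e" "f = (\<Sum>a\<in>t. fscale (r a) a)"
      using assms unfolding cfun.span_explicit by blast
    obtain S where S: "inj_on e S" "t = e ` S"
      using tr(2) unfolding subset_image_inj by blast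
    have "finite S" using tr(1) S by (simp add: finite_image_iff)
    moreover have "f = (\<Sum>m\<in>S. fscale (r (e m)) (e m))"
      unfolding tr(3) S(2) by (subst sum.reindex[OF S(1)]) (simp add: comp_def)
    ultimately show ?thesis by (intro exI[of _ S] exI[of _ "\<lambda>m. r (e m)"]) simp
  qed
  then obtain S c where S: "finite S" and f: "f = (\<Sum>m\<in>S. fscale (c m) (e m))" by blast
  have "f = (\<Sum>i\<in>g ` S. \<Sum>m\<in>{m \<in> S. g m = i}. fscale (c m) (e m))"
    unfolding f by (rule sum.group[symmetric]) (use S in auto)
  moreover have "(\<Sum>m\<in>{m \<in> S. g m = i}. fscale (c m) (e m)) \<in> cfun.span (e ` {m. g m = i})" for i
    by (intro cfun.span_sum cfun.span_scale cfun.span_base) auto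
  ultimately show ?thesis
    using finite_imageI[OF S, of g]
    by (intro exI[of _ "g ` S"] exI[of _ "\<lambda>i. \<Sum>m\<in>{m \<in> S. g m = i}. fscale (c m) (e m)"]) blast
qed

text \<open>
  If the monomials are eigenvectors with eigenvalues depending on \<open>g\<close>, the homogeneous components
  with respect to \<open>g\<close> of an element of a stable subspace belong to this subspace. This is used with
  the degree, with the eigenvalue of \<open>D\<close> and with the weight as \<open>g\<close>.
\<close>

lemma eigen_components:
  assumes f: "f \<in> exp_module n \<alpha>" "f \<in> W"
    and W: "cfun.subspace W" "\<And>M. M \<in> H \<Longrightarrow> preserves W (T M)"
    and eig: "\<And>M m. M \<in> H \<Longrightarrow> app (T M) (exp_monomial (coords n) \<alpha> m) = fscale (ev M (g m)) (exp_monomial (coords n) \<alpha> m)"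
    and sep: "\<And>m m'. g m \<noteq> g m' \<Longrightarrow> \<exists>M\<in>H. ev M (g m) \<noteq> ev M (g m')"
  obtains I F where "finite I" "I \<subseteq> range g" "f = (\<Sum>i\<in>I. F i)" "\<And>i. i \<in> I \<Longrightarrow> F i \<in> W"
    "\<And>i. i \<in> I \<Longrightarrow> F i \<in> cfun.span (exp_monomial (coords n) \<alpha> ` {m. g m = i})"
    "\<And>i. i \<in> I \<Longrightarrow> F i \<in> exp_module n \<alpha>"
    "\<And>i M. i \<in> I \<Longrightarrow> M \<in> H \<Longrightarrow> app (T M) (F i) = fscale (ev M i) (F i)"
proof -
  obtain I F where I: "finite I" "I \<subseteq> range g" "f = (\<Sum>i\<in>I. F i)"
    and F: "\<And>i. i \<in> I \<Longrightarrow> F i \<in> cfun.span (exp_monomial (coords n) \<alpha> ` {m. g m = i})"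
    using span_group_by[of f "exp_monomial (coords n) \<alpha>" g] f(1) unfolding exp_module_def by metis
  have mod: "F i \<in> exp_module n \<alpha>" if "i \<in> I" for i
    using F[OF that] cfun.span_mono[of "exp_monomial (coords n) \<alpha> ` {m. g m = i}" "range (exp_monomial (coords n) \<alpha>)"]
    unfolding exp_module_def by auto
  have eigF: "app (T M) (F i) = fscale (ev M i) (F i)" if i: "i \<in> I" and M: "M \<in> H" for i M
  proof -
    have "app (T M - sc (ev M i)) (F i) \<in> {0}"
      by (rule app_span[OF F[OF i]])
        (auto simp: app_ring_operations app_sc eig[OF M] cfun.subspace_single_0)
    moreover have "F i \<in> exp_poly_space" using mod[OF i] exp_module_subset by blast
    ultimately show ?thesis by (simp add: app_ring_operations app_sc)
  qed
  have FW: "F i \<in> W" if "i \<in> I" for i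
  proof (rule joint_eigenvectors_in_subspace[where T = "\<lambda>M. app (T M)" and V = exp_poly_space and I = I and H = H])
    show "F i \<in> exp_poly_space" if "i \<in> I" for i
      using mod[OF that] exp_module_subset by blast
    show "\<exists>M\<in>H. ev M i \<noteq> ev M j" if "i \<in> I" "j \<in> I" "i \<noteq> j" for i j
      using that I(2) sep by blast
  qed (use I f W eigF that in \<open>auto simp: preserves_def app_add app_scale\<close>)
  show thesis using that I F mod eigF FW by blast
qed

definition degree_on :: "coord set \<Rightarrow> (coord \<Rightarrow> nat) \<Rightarrow> nat"
  where "degree_on A m = (\<Sum>v\<in>A. m v)"

lemma degree_on_upd:
  assumes "finite A" "v \<in> A"
  shows "degree_on A (m(v := k)) + m v = degree_on A m + k"
proof -
  have "(\<Sum>u\<in>A - {v}. (m(v := k)) u) = (\<Sum>u\<in>A - {v}. m u)"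
    by (rule sum.cong) auto
  then show ?thesis
    using assms by (simp add: degree_on_def sum.remove[of A v])
qed

lemma degree_on_upd_out: "v \<notin> A \<Longrightarrow> degree_on A (m(v := k)) = degree_on A m"
  unfolding degree_on_def by (rule sum.cong) auto

lemma exp_monomial_cong: "(\<And>v. v \<in> A \<Longrightarrow> m v = m' v) \<Longrightarrow> exp_monomial A \<alpha> m = exp_monomial A \<alpha> m'"
  by (simp add: exp_monomial_def cong: prod.cong)

lemma exp_monomial_degree_0:
  "finite A \<Longrightarrow> degree_on A m = 0 \<Longrightarrow> exp_monomial A \<alpha> m = exp_monomial A \<alpha> (\<lambda>_. 0)"
  by (rule exp_monomial_cong) (simp add: degree_on_def)

lemma exp_monomial_nonzero: "exp_monomial A \<alpha> m \<noteq> 0"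
proof
  assume "exp_monomial A \<alpha> m = 0"
  then have "exp_monomial A \<alpha> m (\<lambda>_. 1) = 0" by simp
  then show False by (simp add: exp_monomial_def)
qed

text \<open>
  The bound on the degree is strict in order that the filtration starts with the zero space.
\<close>

definition low_degree :: "nat \<Rightarrow> (coord \<Rightarrow> complex) \<Rightarrow> coord set \<Rightarrow> nat \<Rightarrow> cfunction set"
  where "low_degree n \<alpha> A k = cfun.span (exp_monomial (coords n) \<alpha> ` {m. degree_on A m < k})"

lemma low_degree_0: "low_degree n \<alpha> A 0 = {0}"
  by (simp add: low_degree_def)

lemma subspace_low_degree: "cfun.subspace (low_degree n \<alpha> A k)"
  by (simp add: low_degree_def)

lemma exp_monomial_low_degree:
  "degree_on A m < k \<Longrightarrow> exp_monomial (coords n) \<alpha> m \<in> low_degree n \<alpha> A k"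
  unfolding low_degree_def by (rule cfun.span_base) auto

lemma low_degree_mono: "k \<le> l \<Longrightarrow> low_degree n \<alpha> A k \<subseteq> low_degree n \<alpha> A l"
  unfolding low_degree_def by (rule cfun.span_mono) auto

lemma in_low_degree:
  assumes "f \<in> exp_module n \<alpha>"
  shows "\<exists>k. f \<in> low_degree n \<alpha> A k"
  using assms unfolding exp_module_def
proof (induction rule: cfun.span_induct_alt)
  case base
  have "0 \<in> low_degree n \<alpha> A 0" by (simp add: low_degree_0)
  then show "\<exists>k. 0 \<in> low_degree n \<alpha> A k" by blast
next
  case (step c x y)
  then obtain m k where m: "x = exp_monomial (coords n) \<alpha> m" and k: "y \<in> low_degree n \<alpha> A k" by auto
  let ?l = "max (Suc (degree_on A m)) k"
  have "x \<in> low_degree n \<alpha> A ?l" "y \<in> low_degree n \<alpha> A ?l"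
    using m k low_degree_mono[of k ?l] by (auto intro!: exp_monomial_low_degree)
  then have "fscale c x + y \<in> low_degree n \<alpha> A ?l"
    by (intro cfun.subspace_add cfun.subspace_scale subspace_low_degree)
  then show "\<exists>k. fscale c x + y \<in> low_degree n \<alpha> A k" by blast
qed

lemma app_low_degree:
  assumes "f \<in> low_degree n \<alpha> A k"
    and "\<And>m. degree_on A m < k \<Longrightarrow> app T (exp_monomial (coords n) \<alpha> m) \<in> low_degree n \<alpha> A l"
  shows "app T f \<in> low_degree n \<alpha> A l"
  using assms(1) unfolding low_degree_def[of n \<alpha> A k]
  by (rule app_span) (auto simp: subspace_low_degree assms(2))

text \<open>
  The operators \<open>p0 v - sc (\<alpha> v)\<close> differentiate the polynomial factor. A nonzero element of \<open>W\<close> of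
  lowest degree is annihilated by all of them, hence by the Euler operator of the polynomial factor,
  and is therefore a multiple of the exponential.
\<close>

lemma lowering_reaches_vacuum:
  assumes W: "cfun.subspace W" "W \<subseteq> exp_module n \<alpha>" "W \<noteq> {0}"
    and lower: "\<And>v. v \<in> coords n \<Longrightarrow> preserves W (p0 v - sc (\<alpha> v))"
  shows "exp_monomial (coords n) \<alpha> (\<lambda>_. 0) \<in> W"
proof -
  let ?e = "exp_monomial (coords n) \<alpha>" and ?C = "coords n"
  let ?L = "\<lambda>v. p0 v - sc (\<alpha> v)"
  have L: "app (?L v) (?e m) = fscale (of_nat (m v)) (?e (m(v := m v - 1)))" if "v \<in> ?C" for v m
    using that by (simp add: app_ring_operations app_p0_exp_monomial app_sc)
  define Eul where "Eul = (\<Sum>v\<in>?C. q0 v * ?L v)"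
  have Eul: "app Eul (?e m) = fscale (of_nat (degree_on ?C m)) (?e m)" for m
  proof -
    have "app (q0 v * ?L v) (?e m) = fscale (of_nat (m v)) (?e m)" if "v \<in> ?C" for v
    proof -
      have "app (q0 v * ?L v) (?e m) = fscale (of_nat (m v)) (?e (m(v := Suc (m v - 1))))"
        using that by (simp add: app_ring_operations(5) L app_scale app_q0_exp_monomial)
      moreover have "m(v := Suc (m v - 1)) = m" if "m v \<noteq> 0"
        using that by auto
      ultimately show ?thesis by (cases "m v = 0") (simp_all add: fscale_def)
    qed
    then show ?thesis
      by (simp add: Eul_def app_sum degree_on_def fun_eq_iff sum_fun_apply sum_distrib_right)
  qed
  obtain f0 where f0: "f0 \<in> W" "f0 \<noteq> 0" using W cfun.subspace_0[OF W(1)] by auto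
  define P where "P k \<longleftrightarrow> (\<exists>f\<in>W. f \<noteq> 0 \<and> f \<in> low_degree n \<alpha> ?C k)" for k
  have "\<exists>k. P k" unfolding P_def using f0 in_low_degree[of f0] W(2) by blast
  then obtain k where k: "P k" "\<And>l. l < k \<Longrightarrow> \<not> P l" by (metis exists_least_iff)
  then obtain f where f: "f \<in> W" "f \<noteq> 0" "f \<in> low_degree n \<alpha> ?C k" unfolding P_def by blast
  have fV: "f \<in> exp_module n \<alpha>" using f W by blast
  have L0: "app (?L v) f = 0" if v: "v \<in> ?C" for v
  proof -
    obtain l where l: "k = Suc l" using f low_degree_0 by (cases k) auto
    have "app (?L v) f \<in> low_degree n \<alpha> ?C l"
    proof (rule app_low_degree[OF f(3)])
      fix m assume m: "degree_on ?C m < k"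
      show "app (?L v) (?e m) \<in> low_degree n \<alpha> ?C l"
      proof (cases "m v = 0")
        case True
        have "app (?L v) (?e m) = 0" using True L[OF v, of m] by (simp add: fun_eq_iff)
        then show ?thesis using cfun.subspace_0[OF subspace_low_degree] by simp
      next
        case False
        then have "degree_on ?C (m(v := m v - 1)) < l"
          using degree_on_upd[OF finite_coords v, of m "m v - 1"] m l by simp
        then show ?thesis
          unfolding L[OF v] by (intro cfun.subspace_scale subspace_low_degree exp_monomial_low_degree)
      qed
    qed
    moreover have "app (?L v) f \<in> W" using lower[OF v] f(1) by (rule preservesD)
    ultimately show ?thesis using k(2)[of l] l unfolding P_def by blast
  qed
  then have "app Eul f = 0" by (simp add: Eul_def app_sum app_ring_operations(5))
  define K where "K = {h \<in> exp_poly_space. app Eul h = 0}"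
  have K: "cfun.subspace K" "f \<in> K"
    using \<open>app Eul f = 0\<close> fV exp_module_subset subspace_exp_poly_space
    unfolding K_def cfun.subspace_def by (auto simp: app_add app_scale)
  have KEul: "preserves K Eul"
    unfolding preserves_def K_def by (auto simp: cfun.subspace_0)
  obtain I F where IF: "finite I" "f = (\<Sum>i\<in>I. F i)" "\<And>i. i \<in> I \<Longrightarrow> F i \<in> K"
    "\<And>i. i \<in> I \<Longrightarrow> F i \<in> cfun.span (?e ` {m. degree_on ?C m = i})"
    "\<And>i M. i \<in> I \<Longrightarrow> M \<in> {()} \<Longrightarrow> app Eul (F i) = fscale (of_nat i) (F i)"
  proof (rule eigen_components[OF fV K(2,1), where H = "{()}" and T = "\<lambda>_. Eul"
        and ev = "\<lambda>_ k. of_nat k" and g = "degree_on ?C"])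
    show "preserves K Eul" by (rule KEul)
    show "app Eul (?e m) = fscale (of_nat (degree_on ?C m)) (?e m)" for m by (rule Eul)
  qed auto
  have "F i = 0" if "i \<in> I" "i \<noteq> 0" for i
    using IF(3)[OF that(1)] IF(5)[OF that(1), of "()"] that(2) by (auto simp: K_def fun_eq_iff)
  then have "f = (\<Sum>i\<in>I \<inter> {0}. F i)"
    unfolding IF(2) using IF(1) by (intro sum.mono_neutral_right) auto
  with f(2) have "0 \<in> I" and f_F: "f = F 0" by (cases "0 \<in> I"; simp)+
  have "?e ` {m. degree_on ?C m = 0} \<subseteq> {?e (\<lambda>_. 0)}"
    using exp_monomial_degree_0 by auto
  then have "F 0 \<in> cfun.span {?e (\<lambda>_. 0)}"
    using IF(4)[OF \<open>0 \<in> I\<close>] cfun.span_mono by blast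
  then obtain k where "f = fscale k (?e (\<lambda>_. 0))"
    unfolding f_F by (auto simp: cfun.span_singleton)
  moreover from this f(2) have "k \<noteq> 0" by auto
  ultimately have "?e (\<lambda>_. 0) = fscale (1 / k) f" by (simp add: fun_eq_iff)
  then show ?thesis using f(1) W(1) by (simp add: cfun.subspace_scale)
qed

lemma exp_module_generated:
  assumes W: "cfun.subspace W" "W \<subseteq> exp_module n \<alpha>"
    and "exp_monomial (coords n) \<alpha> (\<lambda>_. 0) \<in> W"
    and raise: "\<And>m v. v \<in> coords n \<Longrightarrow>
      (\<And>m'. degree_on (coords n) m' \<le> degree_on (coords n) m \<Longrightarrow> exp_monomial (coords n) \<alpha> m' \<in> W) \<Longrightarrow>
      exp_monomial (coords n) \<alpha> (m(v := Suc (m v))) \<in> W"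
  shows "W = exp_module n \<alpha>"
proof -
  have all: "degree_on (coords n) m \<le> k \<Longrightarrow> exp_monomial (coords n) \<alpha> m \<in> W" for m k
  proof (induction k arbitrary: m)
    case 0
    then show ?case using assms(3) exp_monomial_degree_0[of "coords n" m \<alpha>] by simp
  next
    case (Suc k)
    show ?case
    proof (cases "degree_on (coords n) m = 0")
      case True
      then show ?thesis using assms(3) exp_monomial_degree_0[of "coords n" m \<alpha>] by simp
    next
      case False
      then obtain v where v: "v \<in> coords n" "m v \<noteq> 0" by (auto simp: degree_on_def)
      let ?m = "m(v := m v - 1)"
      have "degree_on (coords n) ?m \<le> k"
        using degree_on_upd[OF finite_coords v(1), of m "m v - 1"] Suc.prems v(2) by simp
      then have "exp_monomial (coords n) \<alpha> (?m(v := Suc (?m v))) \<in> W"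
        using Suc.IH by (intro raise v) auto
      then show ?thesis using v(2) by simp
    qed
  qed
  show ?thesis
  proof
    show "exp_module n \<alpha> \<subseteq> W"
      unfolding exp_module_def using all by (intro cfun.span_minimal W) auto
  qed (rule W(2))
qed


section \<open>Spectrum of the product of the quadratic form and the Laplacian\<close>

lemma app_of_nat: "f \<in> exp_poly_space \<Longrightarrow> app (of_nat k) f = fscale (of_nat k) f"
  using app_sc[of f "of_nat k"] by (simp add: sc_of_nat)

context weyl_pairs
begin

text \<open>
  The eigenvalue of \<open>\<eta>\<Delta>\<close> on \<open>\<eta>^j h\<close> when \<open>h\<close> is harmonic and the product has \<open>D\<close>-eigenvalue \<open>d\<close>.
\<close>

definition mu :: "nat \<Rightarrow> complex \<Rightarrow> complex"
  where "mu j d = of_nat j * (2 * d - 2 * of_nat j + of_nat (card C) - 2)"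

definition kappa :: complex where "kappa = 2 * c + 2 - of_nat (card C)"

text \<open>
  The eigenvalue of \<open>\<eta>\<Delta> + \<kappa> (D+c)\<close> on such a vector splits into linear factors, which is why
  exceptional values of \<open>c\<close> occur only among the half-integers when \<open>d\<close> is an integer.
\<close>

lemma mu_factorisation: "mu j d + kappa * (d + c) = (c + d - of_nat j) * (2 * of_nat j + kappa)"
  by (simp add: mu_def kappa_def algebra_simps)

lemma D_Lap_eigen:
  assumes "f \<in> exp_poly_space" "app D f = fscale d f"
  shows "app D (app Lap f) = fscale (d - 2) (app Lap f)"
proof -
  have "app (Lap * D) f = app (D * Lap + Lap + Lap) f" by (simp only: Lap_D)
  then have "app D (app Lap f) = fscale d (app Lap f) - app Lap f - app Lap f"
    using assms by (simp add: app_ring_operations app_scale algebra_simps)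
  then show ?thesis by (simp add: fun_eq_iff algebra_simps)
qed

text \<open>
  The relation \<open>[\<Delta>, \<eta>] = 2 D + N\<close>, with \<open>N\<close> the number of variables, allows moving \<open>\<Delta>\<close> past a factor
  \<open>\<eta>\<Delta> - \<mu>\<close> at the price of lowering the index \<open>j\<close> by one and \<open>d\<close> by two.
\<close>

lemma Lap_factor:
  assumes f: "f \<in> exp_poly_space" "app D f = fscale d f"
  shows "app Lap (app (eta * Lap - sc (mu (Suc j) d)) f) = app (eta * Lap - sc (mu j (d - 2))) (app Lap f)"
proof -
  have "app (Lap * (eta * Lap)) f = app ((eta * Lap + D + D + of_nat (card C)) * Lap) f"
    by (simp only: Lap_eta_Lap)
  then have L: "app Lap (app (eta * Lap) f) = app (eta * Lap) (app Lap f)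
      + fscale (2 * (d - 2) + of_nat (card C)) (app Lap f)"
    using f D_Lap_eigen[OF f]
    by (simp add: app_ring_operations app_of_nat) (simp add: fun_eq_iff algebra_simps)
  have m: "mu (Suc j) d = mu j (d - 2) + (2 * (d - 2) + of_nat (card C))"
    by (simp add: mu_def algebra_simps)
  have "app Lap (app (eta * Lap - sc (mu (Suc j) d)) f)
      = app Lap (app (eta * Lap) f) - fscale (mu (Suc j) d) (app Lap f)"
    using f(1) by (simp add: app_ring_operations(4) app_sc app_diff app_scale cfun.subspace_scale)
  also have "\<dots> = app (eta * Lap) (app Lap f) - fscale (mu j (d - 2)) (app Lap f)"
    unfolding L m by (simp add: fun_eq_iff algebra_simps)
  finally show ?thesis
    using f(1) by (simp add: app_ring_operations(4) app_sc)
qed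

definition chain :: "(nat \<Rightarrow> complex) \<Rightarrow> nat list \<Rightarrow> endo"
  where "chain \<nu> js = prod_list (map (\<lambda>j. eta * Lap - sc (\<nu> j)) js)"

lemma D_chain: "D * chain \<nu> js = chain \<nu> js * D"
proof (induction js)
  case (Cons j js)
  have "D * (eta * Lap - sc (\<nu> j)) = (eta * Lap - sc (\<nu> j)) * D"
    by (simp add: left_diff_distrib right_diff_distrib D_eta_Lap sc_central)
  then have "D * ((eta * Lap - sc (\<nu> j)) * chain \<nu> js) = (eta * Lap - sc (\<nu> j)) * (D * chain \<nu> js)"
    by (metis mult.assoc)
  then show ?case using Cons.IH by (simp add: chain_def mult.assoc)
qed (simp add: chain_def)

lemma D_chain_eigen:
  assumes "f \<in> exp_poly_space" "app D f = fscale d f"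
  shows "app D (app (chain \<nu> js) f) = fscale d (app (chain \<nu> js) f)"
proof -
  have "app (D * chain \<nu> js) f = app (chain \<nu> js * D) f" by (simp only: D_chain)
  then show ?thesis using assms by (simp add: app_ring_operations app_scale)
qed

lemma Lap_chain:
  assumes f: "f \<in> exp_poly_space" "app D f = fscale d f"
  shows "app Lap (app (chain (\<lambda>j. mu (Suc j) d) js) f) = app (chain (\<lambda>j. mu j (d - 2)) js) (app Lap f)"
proof (induction js)
  case Nil
  then show ?case using f by (simp add: chain_def app_one)
next
  case (Cons j js)
  have "app Lap (app (chain (\<lambda>j. mu (Suc j) d) (j # js)) f)
      = app Lap (app (eta * Lap - sc (mu (Suc j) d)) (app (chain (\<lambda>j. mu (Suc j) d) js) f))"
    by (simp add: chain_def app_ring_operations(5))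
  also have "\<dots> = app (eta * Lap - sc (mu j (d - 2))) (app Lap (app (chain (\<lambda>j. mu (Suc j) d) js) f))"
    using f D_chain_eigen[OF f] by (intro Lap_factor) auto
  also have "\<dots> = app (eta * Lap - sc (mu j (d - 2))) (app (chain (\<lambda>j. mu j (d - 2)) js) (app Lap f))"
    by (simp only: Cons.IH)
  finally show "app Lap (app (chain (\<lambda>j. mu (Suc j) d) (j # js)) f)
      = app (chain (\<lambda>j. mu j (d - 2)) (j # js)) (app Lap f)"
    by (simp add: chain_def app_ring_operations(5))
qed

text \<open>
  By induction the factors with positive index make the vector harmonic, and then the remaining
  factor \<open>\<eta>\<Delta> - \<mu>\<^sub>0 = \<eta>\<Delta>\<close> gives zero.
\<close>

lemma chain_kills:
  assumes "f \<in> exp_poly_space" "app D f = fscale d f" "app (Lap ^ k) f = 0"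
  shows "app (chain (\<lambda>j. mu j d) [0..<k]) f = 0"
  using assms
proof (induction k arbitrary: f d)
  case 0
  then have "f = 0" by (simp add: app_one fun_eq_iff)
  then show "app (chain (\<lambda>j. mu j d) [0..<0]) f = 0" by simp
next
  case (Suc k)
  have "app (Lap ^ k) (app Lap f) = 0"
    using Suc.prems(3) by (simp only: power_Suc2 app_ring_operations(5))
  then have "app (chain (\<lambda>j. mu j (d - 2)) [0..<k]) (app Lap f) = 0"
    by (intro Suc.IH app_in_space D_Lap_eigen Suc.prems)
  then have killed: "app Lap (app (chain (\<lambda>j. mu (Suc j) d) [0..<k]) f) = 0"
    using Lap_chain[OF Suc.prems(1,2)] by simp
  have mu_0: "mu 0 d = 0" by (simp add: mu_def)
  have split: "chain (\<lambda>j. mu j d) [0..<Suc k] = (eta * Lap - sc (mu 0 d)) * chain (\<lambda>j. mu (Suc j) d) [0..<k]"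
    unfolding upt_conv_Cons[OF zero_less_Suc] map_Suc_upt[symmetric] chain_def by (simp add: comp_def)
  have "app (chain (\<lambda>j. mu j d) [0..<Suc k]) f
      = app eta (app Lap (app (chain (\<lambda>j. mu (Suc j) d) [0..<k]) f))"
    by (simp only: split mu_0 sc_hom diff_zero app_ring_operations(5))
  then show "app (chain (\<lambda>j. mu j d) [0..<Suc k]) f = 0"
    unfolding killed by simp
qed

context
  fixes W :: "cfunction set"
  assumes W: "cfun.subspace W" "W \<subseteq> exp_poly_space"
    and p_W: "\<And>v. v \<in> C \<Longrightarrow> preserves W (p v)"
    and Dc_W: "preserves W Dc"
    and J_W: "\<And>v. v \<in> C \<Longrightarrow> preserves W (J v)"
begin

lemma preserves_D: "preserves W D"
proof -
  have "D = Dc - sc c" by (simp add: Dc_def)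
  then show ?thesis using preserves_diff[OF W(1) Dc_W preserves_sc[OF W]] by simp
qed

lemma preserves_eta_Lap: "preserves W (eta * Lap)"
proof -
  have "eta * Lap = D * (Dc - 1) - (\<Sum>v\<in>C. J v * p v)" by (simp add: sum_J_p)
  also have "preserves W \<dots>"
    by (intro preserves_diff preserves_mult preserves_sum preserves_one W preserves_D Dc_W J_W p_W)
  finally show ?thesis .
qed

lemma preserves_eta_shifted: "preserves W (eta * (eta * Lap + sc kappa * Dc))"
  unfolding kappa_def sum_J_J[symmetric]
  by (intro preserves_sum preserves_mult J_W dual_C W)

text \<open>
  The inverse of \<open>\<eta>\<Delta> + \<kappa> (D+c)\<close> on the span of the powers of \<open>\<eta>\<Delta>\<close> applied to \<open>f\<close> is constructed one
  factor at a time: if \<open>g\<close> is the image of \<open>f\<close> under the last factor, then \<open>\<eta> (\<eta>\<Delta> + \<kappa> (D+c)) f\<close> and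
  \<open>\<eta> g\<close> are in \<open>W\<close> and differ by a nonzero multiple of \<open>\<eta> f\<close>.
\<close>

lemma eta_from_chain:
  assumes "f \<in> W" "app D f = fscale d f" "app (chain \<nu> js) f = 0"
    and "\<And>j. j \<in> set js \<Longrightarrow> \<nu> j + kappa * (d + c) \<noteq> 0"
  shows "app eta f \<in> W"
  using assms
proof (induction js arbitrary: f rule: rev_induct)
  case Nil
  have "f \<in> exp_poly_space" using Nil.prems(1) W(2) by blast
  with Nil.prems(3) have "f = 0" by (simp add: chain_def app_one fun_eq_iff)
  then show "app eta f \<in> W" using W(1) by (simp add: cfun.subspace_0)
next
  case (snoc j js)
  have fE: "f \<in> exp_poly_space" using snoc.prems(1) W(2) by blast
  define g where "g = app (eta * Lap - sc (\<nu> j)) f"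
  have "g \<in> W"
    unfolding g_def using snoc.prems(1)
    by (intro preservesD[OF preserves_diff] preserves_eta_Lap preserves_sc W)
  moreover have "app D g = fscale d g"
    using D_chain_eigen[OF fE snoc.prems(2), of \<nu> "[j]"] by (simp add: g_def chain_def)
  moreover have "app (chain \<nu> js) g = 0"
    using snoc.prems(3) by (simp add: g_def chain_def app_ring_operations(5) fun_eq_iff)
  ultimately have "app eta g \<in> W"
    using snoc.prems(4) by (intro snoc.IH) auto
  moreover have "app (eta * (eta * Lap + sc kappa * Dc)) f \<in> W"
    using preserves_eta_shifted snoc.prems(1) by (rule preservesD)
  ultimately have diff: "app (eta * (eta * Lap + sc kappa * Dc)) f - app eta g \<in> W"
    using W(1) by (simp add: cfun.subspace_diff)
  have Dc: "app Dc f = fscale (d + c) f"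
    using snoc.prems(2) fE by (simp add: Dc_def app_ring_operations app_sc fun_eq_iff algebra_simps)
  have "app (eta * (eta * Lap + sc kappa * Dc)) f - app eta g
      = app eta (app (eta * Lap + sc kappa * Dc) f - g)"
    using fE by (simp add: app_ring_operations(5)[of eta] app_diff g_def)
  also have "app (eta * Lap + sc kappa * Dc) f - g = fscale (\<nu> j + kappa * (d + c)) f"
    unfolding g_def app_ring_operations(2)[of "eta * Lap"] app_ring_operations(4)[of "eta * Lap"]
      app_ring_operations(5)[of "sc kappa"] Dc
    using fE by (simp add: app_sc app_scale cfun.subspace_scale) (simp add: fun_eq_iff algebra_simps)
  also have "app eta (fscale (\<nu> j + kappa * (d + c)) f) = fscale (\<nu> j + kappa * (d + c)) (app eta f)"
    using fE by (rule app_scale)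
  finally have "fscale (1 / (\<nu> j + kappa * (d + c))) (fscale (\<nu> j + kappa * (d + c)) (app eta f)) \<in> W"
    using diff W(1) by (simp only: cfun.subspace_scale)
  then show "app eta f \<in> W" using snoc.prems(4)[of j] by (simp add: fscale_def)
qed

lemma eta_preserved_on_eigenvector:
  assumes "f \<in> W" "app D f = fscale d f" "app (Lap ^ k) f = 0"
    and "\<And>j. c + d - of_nat j \<noteq> 0" "\<And>j. 2 * of_nat j + kappa \<noteq> 0"
  shows "app eta f \<in> W"
proof (rule eta_from_chain[OF assms(1,2)])
  show "app (chain (\<lambda>j. mu j d) [0..<k]) f = 0"
    using assms(1-3) W(2) by (intro chain_kills) auto
  show "mu j d + kappa * (d + c) \<noteq> 0" for j
    using assms(4,5)[of j] by (simp add: mu_factorisation)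
qed

lemma q_preserved_on_eigenvector:
  assumes eta: "preserves W eta"
    and f: "f \<in> W" "app D f = fscale d f" and "c + d \<noteq> 0" and v: "v \<in> C"
  shows "app (q v) f \<in> W"
proof -
  have fE: "f \<in> exp_poly_space" using f W(2) by blast
  have "preserves W (J v + eta * p (dual v))"
    by (intro preserves_add preserves_mult W eta J_W p_W dual_C v)
  then have "app (J v + eta * p (dual v)) f \<in> W" using f(1) by (rule preservesD)
  also have "J v + eta * p (dual v) = q v * Dc" by (simp add: J_def)
  also have "app (q v * Dc) f = fscale (c + d) (app (q v) f)"
  proof -
    have "app Dc f = fscale (c + d) f"
      using f(2) fE by (simp add: Dc_def app_ring_operations app_sc fun_eq_iff algebra_simps)
    then show ?thesis using fE by (simp add: app_ring_operations(5) app_scale)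
  qed
  finally have "fscale (1 / (c + d)) (fscale (c + d) (app (q v) f)) \<in> W"
    using W(1) by (simp only: cfun.subspace_scale)
  then show ?thesis using assms(4) by (simp add: fscale_def)
qed

end

end


section \<open>Irreducibility\<close>

lemma (in realisation) irreducible_pi_opI:
  assumes V: "cfun.subspace V" "V \<subseteq> exp_poly_space" "V \<noteq> {0}"
    and "\<And>v. v \<in> coords n \<Longrightarrow> preserves V (q v)" "\<And>v. v \<in> coords n \<Longrightarrow> preserves V (p v)"
    and irr: "\<And>W. cfun.subspace W \<Longrightarrow> W \<subseteq> V \<Longrightarrow> W \<noteq> {0} \<Longrightarrow>
      (\<And>v. v \<in> coords n \<Longrightarrow> preserves W (p v)) \<Longrightarrow> preserves W Dc \<Longrightarrow>
      (\<And>v. v \<in> coords n \<Longrightarrow> preserves W (J v)) \<Longrightarrow>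
      (\<And>v w. v \<in> coords n \<Longrightarrow> w \<in> coords n \<Longrightarrow> preserves W (q v * p w - q (cdual w) * p (cdual v))) \<Longrightarrow>
      W = V"
  shows "irreducible_representation (o_odd n) (commutator n) V (pi_op n qo po c)"
  unfolding irreducible_representation_def
proof (intro conjI allI impI)
  show "lie_representation (o_odd n) (commutator n) V (pi_op n qo po c)"
    using V assms(4,5) by (intro lie_representation_pi_op preserves_rho) auto
  show "V \<noteq> {0}" by (rule V(3))
next
  fix W assume "cfun.subspace W \<and> W \<subseteq> V \<and> (\<forall>M\<in>o_odd n. \<forall>w\<in>W. pi_op n qo po c M w \<in> W)"
  then have W: "cfun.subspace W" "W \<subseteq> V" "W \<subseteq> exp_poly_space"
    and inv: "\<And>M w. M \<in> o_odd n \<Longrightarrow> w \<in> W \<Longrightarrow> pi_op n qo po c M w \<in> W"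
    using V(2) by auto
  have "X 0 \<in> coords n" by (simp add: coords_def)
  then show "W = {0} \<or> W = V"
    using irr[OF W(1,2)] invariant_preserves[OF W(1,3) inv] by blast
qed

lemma exp_module_nontrivial: "exp_module n \<alpha> \<noteq> {0}"
  using exp_monomial_in_module[of n \<alpha> "\<lambda>_. 0"] exp_monomial_nonzero[of "coords n" \<alpha> "\<lambda>_. 0"] by force

text \<open>
  The nonvanishing sum is the norm of the frequency vector \<open>\<alpha>\<close> under the quadratic form. It is the
  factor that appears when \<open>x\<^sub>r\<close> is written as a combination of the forms
  \<open>\<alpha>\<^sub>v\<^sub>' x\<^sub>r - \<alpha>\<^sub>r\<^sub>' x\<^sub>v\<close> and \<open>\<Sum> \<alpha>\<^sub>v x\<^sub>v\<close>.
\<close>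

lemma irreducible_exp_module:
  assumes nonisotropic: "(\<Sum>v\<in>coords n. \<alpha> v * \<alpha> (cdual v)) \<noteq> 0"
  shows "irreducible_representation (o_odd n) (commutator n) (exp_module n \<alpha>) (pi_op n mult_op partial_op c)"
proof -
  interpret realisation n q0 p0 c mult_op partial_op
    by unfold_locales (simp_all add: q0_comm p0_comm p0_q0 app_q0 app_p0)
  let ?e = "exp_monomial (coords n) \<alpha>"
  show ?thesis
  proof (rule irreducible_pi_opI)
    fix W assume W: "cfun.subspace W" "W \<subseteq> exp_module n \<alpha>" "W \<noteq> {0}"
      and p_W: "\<And>v. v \<in> coords n \<Longrightarrow> preserves W (p0 v)" and Dc_W: "preserves W Dc"
      and J_W: "\<And>v. v \<in> coords n \<Longrightarrow> preserves W (J v)"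
      and rot: "\<And>v w. v \<in> coords n \<Longrightarrow> w \<in> coords n \<Longrightarrow>
        preserves W (q0 v * p0 w - q0 (cdual w) * p0 (cdual v))"
    have WE: "W \<subseteq> exp_poly_space" using W(2) exp_module_subset by blast
    have D_W: "preserves W D"
      by (rule preserves_D[OF W(1) WE p_W Dc_W J_W])
    show "W = exp_module n \<alpha>"
    proof (rule exp_module_generated[OF W(1,2)])
      show "?e (\<lambda>_. 0) \<in> W"
        by (intro lowering_reaches_vacuum W preserves_diff preserves_sc p_W WE)
    next
      fix m r assume r: "r \<in> coords n"
        and low: "\<And>m'. degree_on (coords n) m' \<le> degree_on (coords n) m \<Longrightarrow> ?e m' \<in> W"
      have split: "app (q0 v * p0 w) (?e m) = fscale (of_nat (m w)) (app (q0 v) (?e (m(w := m w - 1))))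
          + fscale (\<alpha> w) (app (q0 v) (?e m))" if "w \<in> coords n" for v w
        using that by (simp add: app_ring_operations(5) app_p0_exp_monomial app_add app_scale cfun.subspace_scale)
      \<comment> \<open>differentiating the polynomial factor compensates the multiplication in degree\<close>
      have lower_term: "fscale (of_nat (m w)) (app (q0 v) (?e (m(w := m w - 1)))) \<in> W"
        if v: "v \<in> coords n" and w: "w \<in> coords n" for v w
      proof (cases "m w = 0")
        case True
        then show ?thesis using cfun.subspace_0[OF W(1)] by (simp add: fscale_def zero_fun_def)
      next
        case False
        let ?m = "m(w := m w - 1)"
        have "degree_on (coords n) (?m(v := Suc (?m v))) \<le> degree_on (coords n) m"
          using degree_on_upd[OF finite_coords w, of m "m w - 1"]
            degree_on_upd[OF finite_coords v, of ?m "Suc (?m v)"] False by simp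
        then have "app (q0 v) (?e ?m) \<in> W"
          unfolding app_q0_exp_monomial[OF v] by (rule low)
        then show ?thesis using W(1) by (simp add: cfun.subspace_scale)
      qed
      \<comment> \<open>modulo \<open>W\<close>, the rotations act by the linear forms \<open>\<alpha> w q v - \<alpha> (dual v) q (dual w)\<close>\<close>
      have rotation: "fscale (\<alpha> w) (app (q0 v) (?e m)) - fscale (\<alpha> (cdual v)) (app (q0 (cdual w)) (?e m)) \<in> W"
        if v: "v \<in> coords n" and w: "w \<in> coords n" for v w
      proof -
        have "app (q0 v * p0 w - q0 (cdual w) * p0 (cdual v)) (?e m) \<in> W"
          using rot[OF v w] low[of m] by (auto intro: preservesD)
        moreover have "fscale (\<alpha> w) (app (q0 v) (?e m)) - fscale (\<alpha> (cdual v)) (app (q0 (cdual w)) (?e m))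
          = app (q0 v * p0 w - q0 (cdual w) * p0 (cdual v)) (?e m)
            - fscale (of_nat (m w)) (app (q0 v) (?e (m(w := m w - 1))))
            + fscale (of_nat (m (cdual v))) (app (q0 (cdual w)) (?e (m(cdual v := m (cdual v) - 1))))"
          using v w by (simp add: app_ring_operations(4) split cdual_coords)
        ultimately show ?thesis
          using lower_term[OF v w] lower_term[OF cdual_coords[OF w] cdual_coords[OF v]] W(1)
          by (simp add: cfun.subspace_add cfun.subspace_diff)
      qed
      have euler: "(\<Sum>v\<in>coords n. fscale (\<alpha> v) (app (q0 v) (?e m))) \<in> W"
      proof -
        have "app D (?e m) \<in> W" using D_W low[of m] by (auto intro: preservesD)
        moreover have "(\<Sum>v\<in>coords n. fscale (\<alpha> v) (app (q0 v) (?e m)))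
            = app D (?e m) - (\<Sum>v\<in>coords n. fscale (of_nat (m v)) (app (q0 v) (?e (m(v := m v - 1)))))"
          by (simp add: D_def app_sum split sum.distrib)
        ultimately show ?thesis
          using lower_term W(1) by (simp add: cfun.subspace_diff cfun.subspace_sum)
      qed
      let ?N = "\<Sum>v\<in>coords n. \<alpha> v * \<alpha> (cdual v)"
      \<comment> \<open>the terms with \<open>q0 v\<close> cancel against the Euler operator multiplied by \<open>\<alpha> (cdual r)\<close>\<close>
      have "fscale ?N (app (q0 r) (?e m)) =
          (\<Sum>v\<in>coords n. fscale (\<alpha> v) (fscale (\<alpha> (cdual v)) (app (q0 r) (?e m)) - fscale (\<alpha> (cdual r)) (app (q0 (cdual (cdual v))) (?e m))))
          + fscale (\<alpha> (cdual r)) (\<Sum>v\<in>coords n. fscale (\<alpha> v) (app (q0 v) (?e m)))"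
        by (simp add: fun_eq_iff sum_fun_apply sum_distrib_left sum_distrib_right sum_subtractf algebra_simps)
      also have "\<dots> \<in> W"
        by (intro cfun.subspace_add cfun.subspace_sum cfun.subspace_scale W(1) euler rotation cdual_coords r)
      finally have "fscale (1 / ?N) (fscale ?N (app (q0 r) (?e m))) \<in> W"
        using W(1) by (simp only: cfun.subspace_scale)
      then show "?e (m(r := Suc (m r))) \<in> W"
        using nonisotropic r by (simp add: fscale_def app_q0_exp_monomial)
    qed
  qed (use exp_module_nontrivial in \<open>auto simp: exp_module_subset intro: exp_module_preserves_q0 exp_module_preserves_p0\<close>)
qed


section \<open>The oscillator representation\<close>

definition qS :: "coord set \<Rightarrow> coord \<Rightarrow> endo" where "qS S v = (if v \<in> S then p0 v else q0 v)"
definition pS :: "coord set \<Rightarrow> coord \<Rightarrow> endo" where "pS S v = (if v \<in> S then - q0 v else p0 v)"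

text \<open>
  The variables in \<open>S\<close> are swapped with their derivatives. Two dual variables must not both be
  swapped: otherwise the Laplacian would contain the product of the two variables and would not be
  nilpotent.
\<close>

locale oscillator =
  fixes n :: nat and S :: "coord set" and c :: complex
  assumes S_coords: "S \<subseteq> coords n" and S_dual: "v \<in> S \<Longrightarrow> cdual v \<notin> S"

sublocale oscillator \<subseteq> realisation n "qS S" "pS S" c
  "\<lambda>v. if v \<in> S then partial_op v else mult_op v" "\<lambda>v. if v \<in> S then - mult_op v else partial_op v"
proof
  fix v w
  show "qS S v * qS S w = qS S w * qS S v"
    using p0_q0[of v w] p0_q0[of w v] by (auto simp: qS_def q0_comm p0_comm)
  show "pS S v * pS S w = pS S w * pS S v"
    using p0_q0[of v w] p0_q0[of w v] by (auto simp: pS_def q0_comm p0_comm)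
  show "pS S v * qS S w = qS S w * pS S v + (if v = w then 1 else 0)"
    using p0_q0[of v w] p0_q0[of w v] by (auto simp: pS_def qS_def q0_comm p0_comm)
qed (auto simp: qS_def pS_def app_q0 app_p0 app_ring_operations)

context oscillator
begin

abbreviation pmonomial :: "(coord \<Rightarrow> nat) \<Rightarrow> cfunction"
  where "pmonomial \<equiv> exp_monomial (coords n) (\<lambda>_. 0)"

abbreviation pmodule :: "cfunction set"
  where "pmodule \<equiv> exp_module n (\<lambda>_. 0)"

text \<open>
  The eigenvalue of \<open>q\<^sub>v p\<^sub>v\<close>. For a swapped variable this operator is \<open>- \<partial>\<^sub>v x\<^sub>v\<close>, whence the shift.
\<close>

definition number :: "coord \<Rightarrow> (coord \<Rightarrow> nat) \<Rightarrow> int"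
  where "number v m = (if v \<in> S then - int (m v) - 1 else int (m v))"

lemma qS_pS_mono:
  assumes "v \<in> coords n"
  shows "app (qS S v * pS S v) (pmonomial m) = fscale (of_int (number v m)) (pmonomial m)"
proof (cases "v \<in> S")
  case True
  then show ?thesis
    using assms app_scale[of "pmonomial (m(v := Suc (m v)))" "p0 v" "-1"]
    by (simp add: qS_def pS_def number_def app_ring_operations app_q0_exp_monomial fscale_def)
      (simp add: fun_eq_iff app_p0_exp_monomial algebra_simps)
next
  case False
  have "app (qS S v * pS S v) (pmonomial m) = fscale (of_nat (m v)) (pmonomial (m(v := Suc (m v - 1))))"
  proof -
    have "app (p0 v) (pmonomial m) = fscale (of_nat (m v)) (pmonomial (m(v := m v - 1)))"
      using assms by (simp add: app_p0_exp_monomial fun_eq_iff)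
    then show ?thesis
      using False assms
      by (simp add: qS_def pS_def app_ring_operations(5) app_scale app_q0_exp_monomial)
  qed
  moreover have "m(v := Suc (m v - 1)) = m" if "m v \<noteq> 0" using that by auto
  ultimately show ?thesis
    using False by (cases "m v = 0") (simp_all add: number_def fun_eq_iff)
qed

definition energy :: "(coord \<Rightarrow> nat) \<Rightarrow> int"
  where "energy m = (\<Sum>v\<in>coords n. number v m)"

lemma D_mono: "app D (pmonomial m) = fscale (of_int (energy m)) (pmonomial m)"
  by (simp add: D_def app_sum qS_pS_mono energy_def fun_eq_iff sum_fun_apply sum_distrib_right)

lemma p0_lowers:
  assumes v: "v \<in> A" and A: "A \<subseteq> coords n" and f: "f \<in> low_degree n (\<lambda>_. 0) A (Suc k)"
  shows "app (p0 v) f \<in> low_degree n (\<lambda>_. 0) A k"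
proof (rule app_low_degree[OF f])
  fix m assume m: "degree_on A m < Suc k"
  have p: "app (p0 v) (pmonomial m) = fscale (of_nat (m v)) (pmonomial (m(v := m v - 1)))"
    using v A by (auto simp: app_p0_exp_monomial fun_eq_iff)
  show "app (p0 v) (pmonomial m) \<in> low_degree n (\<lambda>_. 0) A k"
  proof (cases "m v = 0")
    case True
    then have "app (p0 v) (pmonomial m) = 0" by (simp add: p fun_eq_iff)
    then show ?thesis using cfun.subspace_0[OF subspace_low_degree] by simp
  next
    case False
    have "degree_on A (m(v := m v - 1)) < k"
      using degree_on_upd[OF finite_subset[OF A finite_coords] v, of m "m v - 1"] m False by simp
    then show ?thesis
      unfolding p by (intro cfun.subspace_scale subspace_low_degree exp_monomial_low_degree)
  qed
qed

lemma pS_low_degree: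
  assumes v: "v \<in> coords n" and f: "f \<in> low_degree n (\<lambda>_. 0) (coords n - S) k"
  shows "app (pS S v) f \<in> low_degree n (\<lambda>_. 0) (coords n - S) k"
proof (cases "v \<in> S")
  case True
  show ?thesis
  proof (rule app_low_degree[OF f])
    fix m assume m: "degree_on (coords n - S) m < k"
    have "app (pS S v) (pmonomial m) = - pmonomial (m(v := Suc (m v)))"
      using True v by (simp add: pS_def app_ring_operations app_q0_exp_monomial)
    moreover have "pmonomial (m(v := Suc (m v))) \<in> low_degree n (\<lambda>_. 0) (coords n - S) k"
      using m True by (intro exp_monomial_low_degree) (simp add: degree_on_upd_out)
    ultimately show "app (pS S v) (pmonomial m) \<in> low_degree n (\<lambda>_. 0) (coords n - S) k"
      using cfun.subspace_neg[OF subspace_low_degree] by simp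
  qed
next
  case False
  then have "app (pS S v) f = app (p0 v) f" by (simp add: pS_def)
  moreover have "f \<in> low_degree n (\<lambda>_. 0) (coords n - S) (Suc k)"
    using f low_degree_mono[of k "Suc k"] by auto
  ultimately show ?thesis using p0_lowers[of v "coords n - S"] False v by auto
qed

lemma pS_lowers:
  "v \<in> coords n - S \<Longrightarrow> f \<in> low_degree n (\<lambda>_. 0) (coords n - S) (Suc k) \<Longrightarrow>
    app (pS S v) f \<in> low_degree n (\<lambda>_. 0) (coords n - S) k"
  using p0_lowers[of v "coords n - S" f k] by (simp add: pS_def)

text \<open>
  Each summand of the Laplacian differentiates at least one variable outside \<open>S\<close>, and multiplication
  by variables in \<open>S\<close> does not affect the degree in the others.
\<close>

lemma Lap_lowers:
  assumes f: "f \<in> low_degree n (\<lambda>_. 0) (coords n - S) (Suc k)"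
  shows "app Lap f \<in> low_degree n (\<lambda>_. 0) (coords n - S) k"
proof -
  have "app (pS S v * pS S (cdual v)) f \<in> low_degree n (\<lambda>_. 0) (coords n - S) k" if v: "v \<in> coords n" for v
  proof (cases "v \<in> S")
    case True
    then have "cdual v \<in> coords n - S" using S_dual v cdual_coords by auto
    then show ?thesis
      using f v by (auto simp: app_ring_operations(5) intro: pS_low_degree pS_lowers)
  next
    case False
    then show ?thesis
      using f v cdual_coords[OF v] by (auto simp: app_ring_operations(5) intro: pS_low_degree pS_lowers)
  qed
  then show ?thesis
    unfolding Lap_def app_sum by (intro cfun.subspace_sum subspace_low_degree)
qed

lemma Lap_nilpotent:
  assumes "f \<in> pmodule"
  shows "\<exists>k. app (Lap ^ k) f = 0"
proof -
  have "f \<in> low_degree n (\<lambda>_. 0) (coords n - S) k \<Longrightarrow> app (Lap ^ k) f = 0" for k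
  proof (induction k arbitrary: f)
    case 0
    then have "f = 0" by (simp add: low_degree_0)
    then show "app (Lap ^ 0) f = 0" by simp
  next
    case (Suc k)
    have "app (Lap ^ k) (app Lap f) = 0" by (intro Suc.IH Lap_lowers Suc.prems)
    then show "app (Lap ^ Suc k) f = 0" by (simp only: power_Suc2 app_ring_operations(5))
  qed
  then show ?thesis using in_low_degree[OF assms] by blast
qed

text \<open>
  After decomposing by the integral eigenvalues of \<open>D\<close>, an invariant subspace is closed under \<open>\<eta>\<close> and
  then under all \<open>q\<^sub>v\<close>. Multiplications and derivatives are recovered from \<open>q\<^sub>v\<close> and \<open>p\<^sub>v\<close> up to sign, and
  polynomials are a simple module over them.
\<close>

lemma irreducible_oscillator:
  assumes c: "c \<notin> {of_int m / 2 | m. True}"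
  shows "irreducible_representation (o_odd n) (commutator n) pmodule
    (pi_op n (\<lambda>v. if v \<in> S then partial_op v else mult_op v)
      (\<lambda>v. if v \<in> S then - mult_op v else partial_op v) c)"
proof (rule irreducible_pi_opI)
  have half: "2 * c \<noteq> of_int m" for m
  proof
    assume "2 * c = of_int m"
    then have "c = of_int m / 2" by (metis nonzero_mult_div_cancel_left zero_neq_numeral)
    with c show False by blast
  qed
  have c1: "c + of_int i - of_nat j \<noteq> 0" for i j
  proof
    assume "c + of_int i - of_nat j = 0"
    then have "c = of_nat j - of_int i" by (simp add: eq_diff_eq)
    then have "2 * c = of_int (2 * (int j - i))" by simp
    with half show False by blast
  qed
  have c2: "2 * of_nat j + kappa \<noteq> 0" for j
  proof
    assume "2 * of_nat j + kappa = 0"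
    then have "2 * c + (2 * of_nat j + 2 - of_nat (card (coords n))) = 0"
      by (simp add: kappa_def algebra_simps)
    then have "2 * c = - (2 * of_nat j + 2 - of_nat (card (coords n)))"
      by (simp only: eq_neg_iff_add_eq_0)
    also have "\<dots> = of_int (int (card (coords n)) - 2 - 2 * int j)" by simp
    finally have "2 * c = of_int (int (card (coords n)) - 2 - 2 * int j)" .
    with half show False by blast
  qed
  fix W assume W: "cfun.subspace W" "W \<subseteq> pmodule" "W \<noteq> {0}"
    and p_W: "\<And>v. v \<in> coords n \<Longrightarrow> preserves W (pS S v)" and Dc_W: "preserves W Dc"
    and J_W: "\<And>v. v \<in> coords n \<Longrightarrow> preserves W (J v)"
  have WE: "W \<subseteq> exp_poly_space" using W(2) exp_module_subset by blast
  have D_W: "preserves W D"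
    by (rule preserves_D[OF W(1) WE p_W Dc_W J_W])
  \<comment> \<open>closure under a linear operator can be tested on eigenvectors of \<open>D\<close>\<close>
  have by_energy: "preserves W T"
    if T: "\<And>f i. f \<in> W \<Longrightarrow> app D f = fscale (of_int i) f \<Longrightarrow> app T f \<in> W" for T
    unfolding preserves_def
  proof
    fix f assume f: "f \<in> W"
    then have "f \<in> pmodule" using W(2) by blast
    then obtain I F where IF: "finite I" "f = (\<Sum>i\<in>I. F i)" "\<And>i. i \<in> I \<Longrightarrow> F i \<in> W"
      "\<And>i M. i \<in> I \<Longrightarrow> M \<in> {()} \<Longrightarrow> app D (F i) = fscale (of_int i) (F i)"
    proof (rule eigen_components[OF _ f W(1), where H = "{()}" and T = "\<lambda>_. D"
          and ev = "\<lambda>_. of_int" and g = energy])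
      show "preserves W D" by (rule D_W)
      show "app D (pmonomial m) = fscale (of_int (energy m)) (pmonomial m)" for m by (rule D_mono)
    qed auto
    have "app T f = (\<Sum>i\<in>I. app T (F i))"
      unfolding IF(2) using IF(3) WE by (intro app_sum_arg) blast
    also have "\<dots> \<in> W" using T IF(3,4) by (intro cfun.subspace_sum W) auto
    finally show "app T f \<in> W" .
  qed
  have eta_W: "preserves W eta"
  proof (rule by_energy)
    fix f i assume f: "f \<in> W" "app D f = fscale (of_int i) f"
    obtain k where k: "app (Lap ^ k) f = 0" using f(1) W(2) Lap_nilpotent by blast
    show "app eta f \<in> W"
    proof (rule eta_preserved_on_eigenvector[OF W(1) WE p_W Dc_W J_W f k])
      show "c + of_int i - of_nat j \<noteq> 0" "2 * of_nat j + kappa \<noteq> 0" for j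
        by (rule c1, rule c2)
    qed
  qed
  have q_W: "preserves W (qS S v)" if v: "v \<in> coords n" for v
  proof (rule by_energy)
    fix f i assume f: "f \<in> W" "app D f = fscale (of_int i) f"
    show "app (qS S v) f \<in> W"
      using c1[of i 0] by (intro q_preserved_on_eigenvector[OF W(1) WE p_W Dc_W J_W eta_W f _ v]) auto
  qed
  have q0_W: "preserves W (q0 v)" and p0_W: "preserves W (p0 v)" if v: "v \<in> coords n" for v
    using q_W[OF v] p_W[OF v] preserves_uminus[OF W(1), of "- q0 v"]
    by (cases "v \<in> S"; simp add: qS_def pS_def)+
  show "W = pmodule"
  proof (rule exp_module_generated[OF W(1,2)])
    show "pmonomial (\<lambda>_. 0) \<in> W"
      by (intro lowering_reaches_vacuum W preserves_diff preserves_sc p0_W WE)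
    fix m v assume v: "v \<in> coords n"
      and "\<And>m'. degree_on (coords n) m' \<le> degree_on (coords n) m \<Longrightarrow> pmonomial m' \<in> W"
    then have "app (q0 v) (pmonomial m) \<in> W" by (intro preservesD[OF q0_W]) auto
    then show "pmonomial (m(v := Suc (m v))) \<in> W" using v by (simp add: app_q0_exp_monomial)
  qed
next
  show "preserves pmodule (qS S v)" if "v \<in> coords n" for v
    using that by (simp add: qS_def exp_module_preserves_p0 exp_module_preserves_q0)
  show "preserves pmodule (pS S v)" if "v \<in> coords n" for v
    using that by (simp add: pS_def exp_module_preserves_p0 exp_module_preserves_q0 preserves_uminus)
qed (use exp_module_nontrivial in \<open>auto simp: exp_module_subset\<close>)

end

text \<open>
  A finite set has bounded degree and is annihilated by a power of a derivative, but no power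
  annihilates all polynomials.
\<close>

lemma exp_module_infinite_dimensional: "\<not> finite_dimensional (exp_module n (\<lambda>_. 0))"
proof
  interpret oscillator n "{}" 0 by unfold_locales auto
  have X0: "X 0 \<in> coords n" by (simp add: coords_def)
  let ?m = "\<lambda>k. (\<lambda>_. 0)(X 0 := k)"
  assume "finite_dimensional pmodule"
  then obtain B where B: "finite B" "B \<subseteq> pmodule" "pmodule = cfun.span B"
    unfolding finite_dimensional_def by blast
  have "\<exists>k. B \<subseteq> low_degree n (\<lambda>_. 0) (coords n) k"
    using B(1,2)
  proof (induction B rule: finite_induct)
    case (insert b B)
    then obtain k l where "B \<subseteq> low_degree n (\<lambda>_. 0) (coords n) k" "b \<in> low_degree n (\<lambda>_. 0) (coords n) l"
      using in_low_degree by blast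
    then have "insert b B \<subseteq> low_degree n (\<lambda>_. 0) (coords n) (max k l)"
      using low_degree_mono[of k "max k l" n "\<lambda>_. 0" "coords n"]
        low_degree_mono[of l "max k l" n "\<lambda>_. 0" "coords n"] by auto
    then show ?case by blast
  qed simp
  then obtain k where "B \<subseteq> low_degree n (\<lambda>_. 0) (coords n) k" by blast
  then have "pmodule \<subseteq> low_degree n (\<lambda>_. 0) (coords n) k"
    unfolding B(3) by (intro cfun.span_minimal subspace_low_degree)
  then have mem: "pmonomial (?m k) \<in> low_degree n (\<lambda>_. 0) (coords n) k" by auto
  have killed: "f \<in> low_degree n (\<lambda>_. 0) (coords n) k \<Longrightarrow> app (p0 (X 0) ^ k) f = 0" for f k
  proof (induction k arbitrary: f)
    case 0
    then have "f = 0" by (simp add: low_degree_0)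
    then show "app (p0 (X 0) ^ 0) f = 0" by simp
  next
    case (Suc k)
    have "app (p0 (X 0) ^ k) (app (p0 (X 0)) f) = 0" by (intro Suc.IH p0_lowers X0 Suc.prems order_refl)
    then show "app (p0 (X 0) ^ Suc k) f = 0" by (simp only: power_Suc2 app_ring_operations(5))
  qed
  have "app (p0 (X 0) ^ k) (pmonomial (?m k)) = fscale (fact k) (pmonomial (\<lambda>_. 0))" for k
  proof (induction k)
    case 0
    have "?m 0 = (\<lambda>_. 0)" by auto
    then show ?case by (simp add: app_one)
  next
    case (Suc k)
    have "app (p0 (X 0)) (pmonomial (?m (Suc k))) = fscale (of_nat (Suc k)) (pmonomial (?m k))"
      using X0 by (simp add: app_p0_exp_monomial fun_eq_iff)
    then have "app (p0 (X 0) ^ Suc k) (pmonomial (?m (Suc k))) = fscale (of_nat (Suc k)) (app (p0 (X 0) ^ k) (pmonomial (?m k)))"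
      by (simp only: power_Suc2 app_ring_operations(5) app_scale exp_monomial_in_space finite_coords)
    then show "app (p0 (X 0) ^ Suc k) (pmonomial (?m (Suc k))) = fscale (fact (Suc k)) (pmonomial (\<lambda>_. 0))"
      by (simp only: Suc.IH) (simp add: fun_eq_iff)
  qed
  with killed[OF mem] have "fscale (fact k) (pmonomial (\<lambda>_. 0)) = 0" by simp
  then have "fscale (1 / fact k) (fscale (fact k) (pmonomial (\<lambda>_. 0))) = 0" by (simp add: fun_eq_iff)
  then have "pmonomial (\<lambda>_. 0) = 0" by (simp add: fscale_def)
  then show False using exp_monomial_nonzero by blast
qed


section \<open>Weights\<close>

lemma cartan_subset: "cartan n \<subseteq> o_odd n"
proof -
  have "Amat n i i \<in> o_odd n" if "i \<in> {1..n+1}" for i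
    using that unfolding Amat_eq_Fmat[OF that that] by (intro Fmat_in_o_odd) (auto simp: indices_def)
  then show ?thesis
    unfolding cartan_def by (intro cfun.span_minimal) (auto simp: o_odd_def)
qed

lemma Amat_in_cartan: "i \<in> {1..n+1} \<Longrightarrow> Amat n i i \<in> cartan n"
  unfolding cartan_def by (intro cfun.span_base imageI)

text \<open>
  Evaluation with the argument first. As a constant it keeps the application of a weight to a matrix
  opaque to higher-order unification.
\<close>

definition eval_at :: "'a \<Rightarrow> ('a \<Rightarrow> 'b) \<Rightarrow> 'b"
  where "eval_at x f = f x"

lemma dual_space_separates:
  assumes "\<mu> \<in> dual_space H" "\<nu> \<in> dual_space H" "\<mu> \<noteq> \<nu>"
  shows "\<exists>M\<in>H. eval_at M \<mu> \<noteq> eval_at M \<nu>"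
proof (rule ccontr)
  assume "\<not> (\<exists>M\<in>H. eval_at M \<mu> \<noteq> eval_at M \<nu>)"
  then have "\<forall>M\<in>H. \<mu> M = \<nu> M" by (simp add: eval_at_def)
  moreover have "\<mu> \<in> extensional H" "\<nu> \<in> extensional H"
    using assms by (simp_all add: dual_space_def)
  ultimately have "\<mu> = \<nu>" by (intro extensionalityI[of \<mu> H \<nu>]) auto
  with assms(3) show False ..
qed

context oscillator
begin

abbreviation rep :: "cmat \<Rightarrow> coperator"
  where "rep \<equiv> pi_op n (\<lambda>v. if v \<in> S then partial_op v else mult_op v)
    (\<lambda>v. if v \<in> S then - mult_op v else partial_op v) c"

text \<open>
  The eigenvalue of \<open>A\<^sub>i\<^sub>i\<close> on a monomial.
\<close>

definition diagonal_weight :: "nat \<Rightarrow> (coord \<Rightarrow> nat) \<Rightarrow> complex"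
  where "diagonal_weight i m =
    (if i \<le> n then of_int (number (X i) m - number (Y i) m) else - (of_int (energy m) + c))"

definition diagonal_pairing :: "(coord \<Rightarrow> nat) \<Rightarrow> cmat \<Rightarrow> complex"
  where "diagonal_pairing m M = (\<Sum>i=1..n+1. M (i, i) * diagonal_weight i m)"

definition weight :: "(coord \<Rightarrow> nat) \<Rightarrow> cmat \<Rightarrow> complex"
  where "weight m = restrict (diagonal_pairing m) (cartan n)"

lemma diagonal_pairing_add: "diagonal_pairing m (M + N) = diagonal_pairing m M + diagonal_pairing m N"
  unfolding diagonal_pairing_def plus_fun_apply distrib_right by (rule sum.distrib)

lemma diagonal_pairing_scale: "diagonal_pairing m (fscale k M) = k * diagonal_pairing m M"
  unfolding diagonal_pairing_def fscale_apply mult.assoc by (rule sum_distrib_left[symmetric])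

lemma diagonal_pairing_Amat:
  assumes k: "k \<in> {1..n+1}"
  shows "diagonal_pairing m (Amat n k k) = diagonal_weight k m"
proof -
  have "Amat n k k (i, i) * diagonal_weight i m = (if i = k then diagonal_weight k m else 0)"
    if "i \<in> {1..n+1}" for i
    using that k by (auto simp: Amat_def Emat_def)
  then have "diagonal_pairing m (Amat n k k) = (\<Sum>i=1..n+1. if i = k then diagonal_weight k m else 0)"
    unfolding diagonal_pairing_def by (intro sum.cong refl) blast
  also have "\<dots> = diagonal_weight k m"
    using k by (subst sum.delta) auto
  finally show ?thesis .
qed

lemma rho_Amat_pmonomial:
  assumes "i \<in> {1..n+1}"
  shows "app (rho (Amat n i i)) (pmonomial m) = fscale (diagonal_weight i m) (pmonomial m)"
proof (cases "i \<in> {1..n}")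
  case True
  then have mem: "X i \<in> coords n" "Y i \<in> coords n" and "i \<noteq> 0" "i \<le> n" by (auto simp: coords_def)
  have "Amat n i i = Fmat n (index_of n (X i)) (index_of n (X i))"
    using Amat_eq_Fmat[OF assms assms] by simp
  then have r: "rho (Amat n i i) = qS S (X i) * pS S (X i) - qS S (Y i) * pS S (Y i)"
    using rho_generators(4)[OF mem(1) mem(1)] \<open>i \<noteq> 0\<close> by simp
  show ?thesis
    unfolding r using \<open>i \<le> n\<close> by (simp add: app_ring_operations(4) qS_pS_mono[OF mem(1)] qS_pS_mono[OF mem(2)]
        diagonal_weight_def fun_eq_iff algebra_simps)
next
  case False
  then have i: "i = org n" using assms by (auto simp: org_def)
  have "X 0 \<in> coords n" by (simp add: coords_def)
  then have r: "rho (Amat n i i) = - Dc"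
    using rho_generators(2)[of "X 0" "X 0"] Amat_eq_Fmat[OF assms assms] i by simp
  have "\<not> i \<le> n" using i by (simp add: org_def)
  then show ?thesis
    unfolding r
    by (simp only: Dc_def app_ring_operations(2,3) D_mono app_sc exp_monomial_in_space finite_coords)
      (simp add: diagonal_weight_def fun_eq_iff algebra_simps)
qed

lemma rho_pmonomial:
  assumes "M \<in> cartan n"
  shows "app (rho M) (pmonomial m) = fscale (weight m M) (pmonomial m)"
proof -
  let ?K = "{M. app (rho M) (pmonomial m) = fscale (diagonal_pairing m M) (pmonomial m)}"
  have zero: "rho 0 = 0" using rho_scale[of 0 0] by (simp add: sc_hom fscale_def zero_fun_def)
  have "cfun.subspace ?K"
    unfolding cfun.subspace_def
  proof (intro conjI ballI allI)
    show "0 \<in> ?K"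
      by (simp add: zero app_ring_operations(1) diagonal_pairing_def fun_eq_iff)
    show "M + N \<in> ?K" if "M \<in> ?K" "N \<in> ?K" for M N
      using that by (simp add: rho_add app_ring_operations(2) diagonal_pairing_add fun_eq_iff algebra_simps)
    show "fscale k M \<in> ?K" if "M \<in> ?K" for k M
      using that by (simp add: rho_scale app_ring_operations(5) app_sc diagonal_pairing_scale fun_eq_iff)
  qed
  moreover have "Amat n k k \<in> ?K" if k: "k \<in> {1..n+1}" for k
    using rho_Amat_pmonomial[OF k] diagonal_pairing_Amat[OF k] by simp
  ultimately have "cartan n \<subseteq> ?K"
    unfolding cartan_def by (intro cfun.span_minimal) blast
  then show ?thesis using assms by (auto simp: weight_def)
qed

lemma weight_Amat:
  assumes "i \<in> {1..n+1}"
  shows "weight m (Amat n i i) = diagonal_weight i m"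
  unfolding weight_def restrict_apply
  using Amat_in_cartan[OF assms] diagonal_pairing_Amat[OF assms] by (simp only: if_True)

lemma weight_in_dual_space: "weight m \<in> dual_space (cartan n)"
proof -
  have "cfun.subspace (cartan n)" by (simp add: cartan_def)
  then show ?thesis
    by (simp add: dual_space_def weight_def cfun.subspace_add cfun.subspace_scale
        diagonal_pairing_add diagonal_pairing_scale)
qed

lemma weight_space_eq:
  "weight_space (cartan n) pmodule rep \<mu> = {f \<in> pmodule. \<forall>M\<in>cartan n. app (rho M) f = fscale (\<mu> M) f}"
proof -
  have "rep M f = app (rho M) f" if "M \<in> cartan n" "f \<in> pmodule" for M f
    using that cartan_subset exp_module_subset by (intro pi_op_eq_rho) blast+
  then show ?thesis unfolding weight_space_def by auto
qed

lemma subspace_weight_space: "cfun.subspace (weight_space (cartan n) pmodule rep \<mu>)"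
proof -
  have E: "f \<in> exp_poly_space" if "f \<in> pmodule" for f using that exp_module_subset by blast
  show ?thesis
    unfolding weight_space_eq cfun.subspace_def
  proof (intro conjI ballI allI)
    show "0 \<in> {f \<in> pmodule. \<forall>M\<in>cartan n. app (rho M) f = fscale (\<mu> M) f}"
      by (simp add: cfun.subspace_0 fun_eq_iff)
    show "f + g \<in> {f \<in> pmodule. \<forall>M\<in>cartan n. app (rho M) f = fscale (\<mu> M) f}"
      if "f \<in> {f \<in> pmodule. \<forall>M\<in>cartan n. app (rho M) f = fscale (\<mu> M) f}"
        "g \<in> {f \<in> pmodule. \<forall>M\<in>cartan n. app (rho M) f = fscale (\<mu> M) f}" for f g
      using that by (simp add: E app_add cfun.subspace_add cfun.scale_right_distrib)
    show "fscale k f \<in> {f \<in> pmodule. \<forall>M\<in>cartan n. app (rho M) f = fscale (\<mu> M) f}"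
      if "f \<in> {f \<in> pmodule. \<forall>M\<in>cartan n. app (rho M) f = fscale (\<mu> M) f}" for k f
      using that by (simp add: E app_scale cfun.subspace_scale cfun.scale_left_commute)
  qed
qed

lemma pmonomial_in_weight_space: "pmonomial m \<in> weight_space (cartan n) pmodule rep (weight m)"
  by (simp add: weight_space_eq rho_pmonomial)

text \<open>
  Monomials are weight vectors and span; independence of the weight spaces is the case of the zero
  subspace in \<open>joint_eigenvectors_in_subspace\<close>.
\<close>

lemma weight_module_oscillator: "weight_module (cartan n) pmodule rep"
  unfolding weight_module_def is_direct_sum_def
proof (intro conjI)
  show "\<forall>\<mu>\<in>dual_space (cartan n). cfun.subspace (weight_space (cartan n) pmodule rep \<mu>)"
    using subspace_weight_space by blast
  show "pmodule = cfun.span (\<Union>\<mu>\<in>dual_space (cartan n). weight_space (cartan n) pmodule rep \<mu>)"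
  proof
    have "range pmonomial \<subseteq> (\<Union>\<mu>\<in>dual_space (cartan n). weight_space (cartan n) pmodule rep \<mu>)"
      using weight_in_dual_space pmonomial_in_weight_space by blast
    then have "cfun.span (range pmonomial)
        \<subseteq> cfun.span (\<Union>\<mu>\<in>dual_space (cartan n). weight_space (cartan n) pmodule rep \<mu>)"
      by (rule cfun.span_mono)
    then show "pmodule \<subseteq> cfun.span (\<Union>\<mu>\<in>dual_space (cartan n). weight_space (cartan n) pmodule rep \<mu>)"
      by (simp only: exp_module_def[of n "\<lambda>_. 0", symmetric])
    have "(\<Union>\<mu>\<in>dual_space (cartan n). weight_space (cartan n) pmodule rep \<mu>) \<subseteq> pmodule"
      unfolding weight_space_def by blast
    then show "cfun.span (\<Union>\<mu>\<in>dual_space (cartan n). weight_space (cartan n) pmodule rep \<mu>) \<subseteq> pmodule"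
      using subspace_exp_module by (rule cfun.span_minimal)
  qed
next
  show "\<forall>J f. finite J \<and> J \<subseteq> dual_space (cartan n) \<and> (\<forall>i\<in>J. f i \<in> weight_space (cartan n) pmodule rep i)
      \<and> (\<Sum>i\<in>J. f i) = 0 \<longrightarrow> (\<forall>i\<in>J. f i = 0)"
  proof (intro allI impI)
    fix J and f :: "(cmat \<Rightarrow> complex) \<Rightarrow> cfunction"
    assume J: "finite J \<and> J \<subseteq> dual_space (cartan n) \<and> (\<forall>i\<in>J. f i \<in> weight_space (cartan n) pmodule rep i)
      \<and> (\<Sum>i\<in>J. f i) = 0"
    then have fin: "finite J" and sum: "(\<Sum>i\<in>J. f i) \<in> {0}" by blast+
    show "\<forall>i\<in>J. f i = 0"
    proof
      fix \<mu> assume \<mu>: "\<mu> \<in> J"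
      have "f \<mu> \<in> {0}"
      proof (rule joint_eigenvectors_in_subspace[where T = "\<lambda>M. app (rho M)" and V = exp_poly_space
            and I = J and H = "cartan n" and ev = eval_at and f = f and i = \<mu> and W = "{0}"])
        show "\<exists>M\<in>cartan n. eval_at M i \<noteq> eval_at M j" if "i \<in> J" "j \<in> J" "i \<noteq> j" for i j
          using that J dual_space_separates by blast
        show "f i \<in> exp_poly_space" if "i \<in> J" for i
          using J that exp_module_subset unfolding weight_space_eq by blast
        show "app (rho M) (f i) = fscale (eval_at M i) (f i)" if "M \<in> cartan n" "i \<in> J" for M i
        proof -
          have "f i \<in> weight_space (cartan n) pmodule rep i" using J that by blast
          then show ?thesis using that(1) by (simp add: weight_space_eq eval_at_def)
        qed
      qed (use fin sum \<mu> in \<open>simp_all add: app_add app_scale cfun.subspace_single_0\<close>)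
      then show "f \<mu> = 0" by simp
    qed
  qed
qed

text \<open>
  Exponents outside the actual coordinates do not influence the monomial. They are required to
  vanish because the set would be infinite otherwise.
\<close>

definition monomials_of_weight :: "(cmat \<Rightarrow> complex) \<Rightarrow> (coord \<Rightarrow> nat) set"
  where "monomials_of_weight \<mu> = {m. weight m = \<mu> \<and> (\<forall>v. v \<notin> coords n \<longrightarrow> m v = 0)}"

text \<open>
  With exactly one of \<open>x\<^sub>i\<close>, \<open>y\<^sub>i\<close> swapped, the two number operators enter \<open>A\<^sub>i\<^sub>i\<close> with the same sign on
  the exponents.
\<close>

lemma number_difference:
  assumes "weight m = weight m'" "v \<in> S"
  shows "m v + m (cdual v) = m' v + m' (cdual v)"
proof -
  have "\<exists>i\<in>{1..n}. v = X i \<or> v = Y i"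
  proof (cases v)
    case (X i)
    have "i \<noteq> 0"
    proof
      assume "i = 0"
      then show False using S_dual[OF assms(2)] assms(2) X by simp
    qed
    then show ?thesis using X assms(2) S_coords by (auto simp: coords_def)
  next
    case (Y i)
    then show ?thesis using assms(2) S_coords by (auto simp: coords_def)
  qed
  then obtain i where i: "i \<in> {1..n}" "v = X i \<or> v = Y i" by blast
  then have "i \<noteq> 0" "i \<le> n" "i \<in> {1..n+1}" by auto
  have "diagonal_weight i m = diagonal_weight i m'"
    using weight_Amat[OF \<open>i \<in> {1..n+1}\<close>] assms(1) by metis
  then have "number (X i) m - number (Y i) m = number (X i) m' - number (Y i) m'"
    using \<open>i \<le> n\<close> unfolding diagonal_weight_def by (simp only: if_True of_int_eq_iff)
  moreover have "(v = X i \<and> X i \<in> S \<and> Y i \<notin> S) \<or> (v = Y i \<and> Y i \<in> S \<and> X i \<notin> S)"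
    using i(2) assms(2) S_dual[OF assms(2)] \<open>i \<noteq> 0\<close> by auto
  ultimately show ?thesis
    using \<open>i \<noteq> 0\<close> by (auto simp: number_def)
qed

lemma energy_weight:
  assumes "weight m = weight m'"
  shows "energy m = energy m'"
proof -
  have "diagonal_weight (n+1) m = diagonal_weight (n+1) m'"
    using weight_Amat[of "n+1"] assms by (metis atLeastAtMost_iff le_add2 order_refl)
  then show ?thesis by (simp add: diagonal_weight_def)
qed

text \<open>
  Fix one monomial \<open>m0\<close> of the given weight. For the others, \<open>number_difference\<close> bounds the exponents
  of the swapped variables, and the energy expresses the total degree in the remaining variables
  through them.
\<close>

lemma finite_monomials_of_weight: "finite (monomials_of_weight \<mu>)"
proof (cases "monomials_of_weight \<mu> = {}")
  case False
  then obtain m0 where m0: "weight m0 = \<mu>" by (auto simp: monomials_of_weight_def)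
  define K where "K = (\<Sum>v\<in>coords n - S. m0 v) + (\<Sum>v\<in>S. m0 v + m0 (cdual v))"
  have fin: "finite S" using S_coords finite_subset finite_coords by blast
  have bound: "m v \<le> K" if m: "m \<in> monomials_of_weight \<mu>" and v: "v \<in> coords n" for m v
  proof -
    have w: "weight m = weight m0" using m m0 by (simp add: monomials_of_weight_def)
    have S_part: "m u \<le> m0 u + m0 (cdual u)" if "u \<in> S" for u
      using number_difference[OF w that] by simp
    have energy_split: "energy k = int (\<Sum>u\<in>coords n - S. k u) - (\<Sum>u\<in>S. int (k u)) - int (card S)" for k
    proof -
      have "energy k = (\<Sum>u\<in>coords n - S. number u k) + (\<Sum>u\<in>S. number u k)"
        unfolding energy_def by (rule sum.subset_diff[OF S_coords finite_coords])
      also have "(\<Sum>u\<in>S. number u k) = - (\<Sum>u\<in>S. int (k u) + 1)"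
        unfolding sum_negf[symmetric] by (rule sum.cong) (auto simp: number_def)
      also have "(\<Sum>u\<in>coords n - S. number u k) = int (\<Sum>u\<in>coords n - S. k u)"
        unfolding of_nat_sum by (rule sum.cong) (auto simp: number_def)
      also have "(\<Sum>u\<in>S. int (k u) + 1) = (\<Sum>u\<in>S. int (k u)) + int (card S)"
        unfolding sum.distrib by simp
      finally show ?thesis by linarith
    qed
    have "int (\<Sum>u\<in>coords n - S. m u) = int (\<Sum>u\<in>coords n - S. m0 u)
        + (\<Sum>u\<in>S. int (m u)) - (\<Sum>u\<in>S. int (m0 u))"
      using energy_weight[OF w] energy_split[of m] energy_split[of m0] by linarith
    also have "\<dots> \<le> int (\<Sum>u\<in>coords n - S. m0 u) + (\<Sum>u\<in>S. int (m0 u + m0 (cdual u)))"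
    proof -
      have "(\<Sum>u\<in>S. int (m u)) \<le> (\<Sum>u\<in>S. int (m0 u + m0 (cdual u)))"
        by (intro sum_mono) (simp only: of_nat_le_iff S_part)
      moreover have "0 \<le> (\<Sum>u\<in>S. int (m0 u))" by (simp add: sum_nonneg)
      ultimately show ?thesis by linarith
    qed
    also have "\<dots> = int K" by (simp add: K_def)
    finally have rest: "(\<Sum>u\<in>coords n - S. m u) \<le> K" by linarith
    show ?thesis
    proof (cases "v \<in> S")
      case True
      have "m0 v + m0 (cdual v) \<le> (\<Sum>u\<in>S. m0 u + m0 (cdual u))"
        using fin True by (intro member_le_sum) auto
      then show ?thesis using S_part[OF True] by (simp add: K_def)
    next
      case False
      then have "m v \<le> (\<Sum>u\<in>coords n - S. m u)"
        using v by (intro member_le_sum) auto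
      with rest show ?thesis by simp
    qed
  qed
  have "finite {m. \<forall>v. (v \<in> coords n \<longrightarrow> m v \<in> {..K}) \<and> (v \<notin> coords n \<longrightarrow> m v = 0)}"
    by (intro finite_set_of_finite_funs) auto
  then show ?thesis
    by (rule finite_subset[rotated]) (use bound in \<open>auto simp: monomials_of_weight_def\<close>)
qed simp

text \<open>
  The component of a weight vector at any other weight has two different weights and is zero.
\<close>

lemma weight_space_subset_span:
  assumes \<mu>: "\<mu> \<in> dual_space (cartan n)"
  shows "weight_space (cartan n) pmodule rep \<mu> \<subseteq> cfun.span (pmonomial ` monomials_of_weight \<mu>)"
proof
  let ?U = "weight_space (cartan n) pmodule rep \<mu>"
  fix f assume f: "f \<in> ?U"
  then have fV: "f \<in> pmodule" by (simp add: weight_space_def)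
  have pres: "preserves ?U (rho M)" if M: "M \<in> cartan n" for M
    unfolding preserves_def
  proof
    fix g assume g: "g \<in> ?U"
    then have "app (rho M) g = fscale (\<mu> M) g" using M by (simp add: weight_space_eq)
    then show "app (rho M) g \<in> ?U" using g subspace_weight_space by (simp add: cfun.subspace_scale)
  qed
  obtain I F where IF: "finite I" "I \<subseteq> range weight" "f = (\<Sum>i\<in>I. F i)" "\<And>i. i \<in> I \<Longrightarrow> F i \<in> ?U"
    "\<And>i. i \<in> I \<Longrightarrow> F i \<in> cfun.span (pmonomial ` {m. weight m = i})"
    "\<And>i M. i \<in> I \<Longrightarrow> M \<in> cartan n \<Longrightarrow> app (rho M) (F i) = fscale (eval_at M i) (F i)"
  proof (rule eigen_components[OF fV f subspace_weight_space, where H = "cartan n" and T = rho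
        and ev = eval_at and g = weight])
    show "preserves ?U (rho M)" if "M \<in> cartan n" for M using that by (rule pres)
    show "app (rho M) (pmonomial m) = fscale (eval_at M (weight m)) (pmonomial m)" if "M \<in> cartan n" for M m
      unfolding eval_at_def using that by (rule rho_pmonomial)
    show "\<exists>M\<in>cartan n. eval_at M (weight m) \<noteq> eval_at M (weight m')" if "weight m \<noteq> weight m'" for m m'
      using that weight_in_dual_space by (intro dual_space_separates)
  qed auto
  have other: "F i = 0" if i: "i \<in> I" "i \<noteq> \<mu>" for i
  proof -
    have "i \<in> dual_space (cartan n)" using IF(2) i(1) weight_in_dual_space by auto
    then obtain M where M: "M \<in> cartan n" "i M \<noteq> \<mu> M"
      using dual_space_separates[OF _ \<mu> i(2)] unfolding eval_at_def by blast
    have "app (rho M) (F i) = fscale (i M) (F i)"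
      using IF(6)[OF i(1) M(1)] by (simp only: eval_at_def)
    moreover have "app (rho M) (F i) = fscale (\<mu> M) (F i)"
      using IF(4)[OF i(1)] M(1) by (simp add: weight_space_eq)
    ultimately show ?thesis using M(2) cfun.scale_cancel_right by metis
  qed
  have "pmonomial ` {m. weight m = \<mu>} \<subseteq> pmonomial ` monomials_of_weight \<mu>"
  proof
    fix g assume "g \<in> pmonomial ` {m. weight m = \<mu>}"
    then obtain m where m: "weight m = \<mu>" "g = pmonomial m" by auto
    let ?m = "\<lambda>v. if v \<in> coords n then m v else 0"
    have g: "g = pmonomial ?m" unfolding m(2) by (rule exp_monomial_cong) simp
    have num: "number v ?m = number v m" if "v \<in> coords n" for v using that by (simp add: number_def)
    have "energy ?m = energy m" unfolding energy_def by (intro sum.cong refl num)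
    moreover have "number (X i) ?m = number (X i) m" "number (Y i) ?m = number (Y i) m"
      if "i \<in> {1..n}" for i
    proof -
      have "X i \<in> coords n" "Y i \<in> coords n" using that by (auto simp: coords_def)
      then show "number (X i) ?m = number (X i) m" "number (Y i) ?m = number (Y i) m"
        by (simp_all only: num)
    qed
    ultimately have "diagonal_weight i ?m = diagonal_weight i m" if "i \<in> {1..n+1}" for i
      using that by (simp add: diagonal_weight_def)
    then have "diagonal_pairing ?m = diagonal_pairing m"
      unfolding diagonal_pairing_def by (intro ext sum.cong refl) simp
    then have "weight ?m = weight m" by (simp add: weight_def)
    then show "g \<in> pmonomial ` monomials_of_weight \<mu>"
      unfolding g using m(1) by (intro imageI) (simp add: monomials_of_weight_def)
  qed
  then have mono: "cfun.span (pmonomial ` {m. weight m = \<mu>}) \<subseteq> cfun.span (pmonomial ` monomials_of_weight \<mu>)"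
    by (rule cfun.span_mono)
  have "F i \<in> cfun.span (pmonomial ` monomials_of_weight \<mu>)" if "i \<in> I" for i
  proof (cases "i = \<mu>")
    case True
    then show ?thesis using IF(5)[OF that] mono by blast
  next
    case False
    then show ?thesis using other[OF that] cfun.span_zero by simp
  qed
  then show "f \<in> cfun.span (pmonomial ` monomials_of_weight \<mu>)"
    unfolding IF(3) by (rule cfun.span_sum)
qed

lemma finite_dimensional_weight_space:
  assumes "\<mu> \<in> dual_space (cartan n)"
  shows "finite_dimensional (weight_space (cartan n) pmodule rep \<mu>)"
  unfolding finite_dimensional_def
proof (intro exI conjI)
  have sub: "pmonomial ` monomials_of_weight \<mu> \<subseteq> weight_space (cartan n) pmodule rep \<mu>"
    using pmonomial_in_weight_space by (auto simp: monomials_of_weight_def)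
  then show "pmonomial ` monomials_of_weight \<mu> \<subseteq> weight_space (cartan n) pmodule rep \<mu>" .
  show "finite (pmonomial ` monomials_of_weight \<mu>)"
    by (intro finite_imageI finite_monomials_of_weight)
  show "weight_space (cartan n) pmodule rep \<mu> = cfun.span (pmonomial ` monomials_of_weight \<mu>)"
    using weight_space_subset_span[OF assms] cfun.span_minimal[OF sub subspace_weight_space] by blast
qed

end


section \<open>The two families of representations\<close>

lemma polys_eq_exp_module: "polys n = exp_module n (\<lambda>_. 0)"
proof -
  have "monomial n = exp_monomial (coords n) (\<lambda>_. 0)"
    by (simp add: monomial_def exp_monomial_def fun_eq_iff)
  then show ?thesis by (simp add: polys_def exp_module_def)
qed

lemma exp_polys_eq_exp_module: "exp_polys n a b = exp_module n (case_coord a b)"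
proof -
  let ?E = "\<lambda>z :: point. exp ((\<Sum>i=0..n. a i * z (X i)) + (\<Sum>i=1..n. b i * z (Y i)))"
  let ?L = "\<lambda>f z. f z * ?E z"
  have E: "(\<Sum>v\<in>coords n. case_coord a b v * z v) = (\<Sum>i=0..n. a i * z (X i)) + (\<Sum>i=1..n. b i * z (Y i))" for z
    by (simp add: sum_coords)
  have L: "?L (monomial n m) = exp_monomial (coords n) (case_coord a b) m" for m
    unfolding monomial_def exp_monomial_def E ..
  have image: "exp_polys n a b = ?L ` polys n"
    unfolding exp_polys_def by auto
  have "?L ` polys n \<subseteq> exp_module n (case_coord a b)"
  proof
    have "cfun.subspace {f. ?L f \<in> exp_module n (case_coord a b)}"
    proof -
      have "?L 0 = 0" "?L (f + g) = ?L f + ?L g" "?L (fscale k f) = fscale k (?L f)" for f g k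
        by (simp_all add: fun_eq_iff algebra_simps)
      then show ?thesis
        unfolding cfun.subspace_def
        by (simp add: cfun.subspace_0 cfun.subspace_add cfun.subspace_scale del: plus_fun_apply zero_fun_apply fscale_apply)
    qed
    moreover have "range (monomial n) \<subseteq> {f. ?L f \<in> exp_module n (case_coord a b)}"
      using L by auto
    ultimately have "polys n \<subseteq> {f. ?L f \<in> exp_module n (case_coord a b)}"
      unfolding polys_def by (intro cfun.span_minimal)
    then show "g \<in> exp_module n (case_coord a b)" if "g \<in> ?L ` polys n" for g
      using that by blast
  qed
  moreover have "exp_module n (case_coord a b) \<subseteq> ?L ` polys n"
    unfolding exp_module_def
  proof (rule cfun.span_minimal)
    show "range (exp_monomial (coords n) (case_coord a b)) \<subseteq> ?L ` polys n"
      unfolding L[symmetric] polys_def by (auto intro!: imageI cfun.span_base)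
    have sub: "cfun.subspace (polys n)" by (simp add: polys_def)
    show "cfun.subspace (?L ` polys n)"
      unfolding cfun.subspace_def
    proof (intro conjI ballI allI)
      have "0 = ?L 0" by (simp add: fun_eq_iff)
      then show "0 \<in> ?L ` polys n" using cfun.subspace_0[OF sub] by (rule image_eqI)
    next
      fix x y assume "x \<in> ?L ` polys n" "y \<in> ?L ` polys n"
      then obtain f g where fg: "f \<in> polys n" "g \<in> polys n" "x = ?L f" "y = ?L g" by blast
      have "x + y = ?L (f + g)" by (simp add: fg fun_eq_iff algebra_simps)
      then show "x + y \<in> ?L ` polys n" using cfun.subspace_add[OF sub fg(1,2)] by (rule image_eqI)
    next
      fix k x assume "x \<in> ?L ` polys n"
      then obtain f where f: "f \<in> polys n" "x = ?L f" by blast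
      have "fscale k x = ?L (fscale k f)" by (simp add: f fun_eq_iff)
      then show "fscale k x \<in> ?L ` polys n" using cfun.subspace_scale[OF sub f(1)] by (rule image_eqI)
    qed
  qed
  ultimately show ?thesis using image by blast
qed

lemma oscillator_swapped:
  assumes "n1 \<in> {1..n}" "n2 \<in> {1..n}" "n1 \<le> n2"
  shows "oscillator n (swapped n n1 n2)"
  using assms by unfold_locales (auto simp: swapped_def coords_def)

theorem theorem2:
  fixes n :: nat
  assumes "n \<ge> 1"
  shows
    "(\<forall>(a :: nat \<Rightarrow> complex) (b :: nat \<Rightarrow> complex) (c :: complex).
        (a 0)\<^sup>2 + 2 * (\<Sum>i=1..n. a i * b i) \<noteq> 0 \<longrightarrow>
        irreducible_representation (o_odd n) (commutator n) (exp_polys n a b) (pi_rep n c)) \<and>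
     (\<forall>(n1 :: nat) (n2 :: nat) (c :: complex).
        n1 \<in> {1..n} \<and> n2 \<in> {1..n} \<and> n1 \<le> n2 \<and> c \<notin> {of_int m / 2 | m. True} \<longrightarrow>
        irreducible_representation (o_odd n) (commutator n) (polys n) (pi_swap_rep n n1 n2 c) \<and>
        \<not> finite_dimensional (polys n) \<and>
        weight_module (cartan n) (polys n) (pi_swap_rep n n1 n2 c) \<and>
        (\<forall>\<mu> \<in> dual_space (cartan n).
           finite_dimensional (weight_space (cartan n) (polys n) (pi_swap_rep n n1 n2 c) \<mu>)))"
proof (intro conjI allI impI)
  fix a b :: "nat \<Rightarrow> complex" and c :: complex
  assume nonisotropic: "(a 0)\<^sup>2 + 2 * (\<Sum>i=1..n. a i * b i) \<noteq> 0"
  let ?\<alpha> = "case_coord a b"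
  have "(\<Sum>v\<in>coords n. ?\<alpha> v * ?\<alpha> (cdual v))
      = a 0 * a 0 + (\<Sum>i=1..n. a i * b i) + (\<Sum>i=1..n. b i * a i)"
    by (simp add: sum_coords sum.atLeast_Suc_atMost)
  also have "\<dots> = (a 0)\<^sup>2 + 2 * (\<Sum>i=1..n. a i * b i)"
    by (simp add: power2_eq_square mult.commute)
  finally show "irreducible_representation (o_odd n) (commutator n) (exp_polys n a b) (pi_rep n c)"
    unfolding exp_polys_eq_exp_module pi_rep_def
    using nonisotropic by (intro irreducible_exp_module) simp
next
  fix n1 n2 :: nat and c :: complex
  assume *: "n1 \<in> {1..n} \<and> n2 \<in> {1..n} \<and> n1 \<le> n2 \<and> c \<notin> {of_int m / 2 | m. True}"
  then interpret oscillator n "swapped n n1 n2" c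
    by (intro oscillator_swapped) auto
  show "irreducible_representation (o_odd n) (commutator n) (polys n) (pi_swap_rep n n1 n2 c)"
    unfolding polys_eq_exp_module pi_swap_rep_def using * by (intro irreducible_oscillator) blast
  show "\<not> finite_dimensional (polys n)"
    unfolding polys_eq_exp_module by (rule exp_module_infinite_dimensional)
  show "weight_module (cartan n) (polys n) (pi_swap_rep n n1 n2 c)"
    unfolding polys_eq_exp_module pi_swap_rep_def by (rule weight_module_oscillator)
  show "\<forall>\<mu>\<in>dual_space (cartan n). finite_dimensional (weight_space (cartan n) (polys n) (pi_swap_rep n n1 n2 c) \<mu>)"
    unfolding polys_eq_exp_module pi_swap_rep_def by (intro ballI finite_dimensional_weight_space)
qed

end
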